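(* Let $G$ be a locally compact group, $1<p<\infty$ and $H$ be a proper closed subgroup of $G$. If $I_p(H)$ has a bounded approximate identity, then $G$ is amenable.
   Context: For a locally compact group $G$ and $1<p<\infty$ with $1/p+1/q=1$, $A_p(G)$ (the Figà-Talamanca–Herz algebra) is the space of all functions $u\in C_0(G)$ of the form $u=\sum_{i=1}^\infty f_i*\widetilde{g_i}$ with $f_i\in L^p(G)$, $g_i\in L^q(G)$, $\sum_{i=1}^\infty\|f_i\|_p\|g_i\|_q<\infty$, where $\widetilde g(x)=\overline{g(x^{-1})}$. It is a commutative semisimple Banach algebra under pointwise operations and the norm $\|u\|_{A_p(G)}=\inf\{\sum_i\|f_i\|_p\|g_i\|_q : u=\sum_i f_i*\widetilde{g_i}\}$. For a closed non-empty subset $E\subseteq G$, $I_p(E)=\{u\in A_p(G): u(x)=0\text{ for all }x\in E\}$, a closed ideal of $A_p(G)$ carrying the norm of $A_p(G)$. A bounded approximate identity for a commutative Banach algebra $B$ is a norm-bounded net $(e_\alpha)$ in $B$ with $\|be_\alpha-b\|\to0$ for every $b\in B$. A locally compact group $G$ is amenable if there exists $m\in L^\infty(G)^*$ with $m\ge0$, $m(1)=1$ and $m(L_xf)=m(f)$ for all $x\in G$, $f\in L^\infty(G)$, where $L_xf(y)=f(x^{-1}y)$. *)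

theory Defs
  imports "HOL-Analysis.Analysis"
begin

text \<open>
  Topological groups are rendered by the class \<^class>\<open>topological_group_add\<close>. It extends
  \<^class>\<open>group_add\<close>, which is not commutative, so \<open>x + y\<close> is the product \<open>xy\<close>, \<open>- x\<close> the
  inverse and \<open>0\<close> the identity of an arbitrary, possibly non-abelian, group.
\<close>

definition add_subgroup :: "'a::group_add set \<Rightarrow> bool" where
  "add_subgroup H \<longleftrightarrow> 0 \<in> H \<and> (\<forall>x\<in>H. \<forall>y\<in>H. x + y \<in> H) \<and> (\<forall>x\<in>H. - x \<in> H)"

definition left_haar_measure :: "'a::{topological_group_add,t2_space} measure \<Rightarrow> bool" where
  "left_haar_measure M \<longleftrightarrow>
     sets M = sets borel \<and>
     (\<forall>K. compact K \<longrightarrow> emeasure M K < \<infinity>) \<and>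
     (\<forall>A\<in>sets borel. emeasure M A = (INF U\<in>{U. open U \<and> A \<subseteq> U}. emeasure M U)) \<and>
     (\<forall>U. open U \<longrightarrow> emeasure M U = (SUP K\<in>{K. compact K \<and> K \<subseteq> U}. emeasure M K)) \<and>
     (\<forall>x. \<forall>A\<in>sets borel. emeasure M ((\<lambda>y. x + y) ` A) = emeasure M A) \<and>
     emeasure M UNIV \<noteq> 0"

text \<open>
  Elements of Lebesgue spaces are represented by Borel functions rather than by equivalence classes.
\<close>

definition Lp_space :: "'a measure \<Rightarrow> real \<Rightarrow> ('a \<Rightarrow> complex) set" where
  "Lp_space M p = {f \<in> borel_measurable M. integrable M (\<lambda>x. norm (f x) powr p)}"

definition Lp_norm :: "'a measure \<Rightarrow> real \<Rightarrow> ('a \<Rightarrow> complex) \<Rightarrow> real" where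
  "Lp_norm M p f = (LINT x|M. norm (f x) powr p) powr (1 / p)"

definition conjugate_exponent :: "real \<Rightarrow> real" where
  "conjugate_exponent p = p / (p - 1)"

lemma conjugate_exponent:
  assumes "1 < p"
  shows "1 / p + 1 / conjugate_exponent p = 1"
  using assms by (simp add: conjugate_exponent_def field_simps)

definition convolution ::
  "'a::group_add measure \<Rightarrow> ('a \<Rightarrow> complex) \<Rightarrow> ('a \<Rightarrow> complex) \<Rightarrow> 'a \<Rightarrow> complex" where
  "convolution M f h x = (LINT y|M. f y * h (- y + x))"

definition tilde :: "('a::group_add \<Rightarrow> complex) \<Rightarrow> 'a \<Rightarrow> complex" where
  "tilde g x = cnj (g (- x))"

definition C0_space :: "('a::topological_space \<Rightarrow> complex) set" where
  "C0_space = {u. continuous_on UNIV u \<and> (\<forall>\<epsilon>>0. \<exists>K. compact K \<and> (\<forall>x. x \<notin> K \<longrightarrow> norm (u x) < \<epsilon>))}"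

text \<open>
  By Hoelder's inequality the series below converges absolutely and uniformly as soon as the norms
  are summable, so pointwise convergence to \<open>u\<close> and convergence to \<open>u\<close> in the supremum norm agree.
\<close>

definition Ap_representation :: "'a::{topological_group_add,t2_space} measure \<Rightarrow> real \<Rightarrow>
    ('a \<Rightarrow> complex) \<Rightarrow> (nat \<Rightarrow> 'a \<Rightarrow> complex) \<Rightarrow> (nat \<Rightarrow> 'a \<Rightarrow> complex) \<Rightarrow> bool" where
  "Ap_representation M p u f g \<longleftrightarrow>
     (\<forall>i. f i \<in> Lp_space M p) \<and>
     (\<forall>i. g i \<in> Lp_space M (conjugate_exponent p)) \<and>
     summable (\<lambda>i. Lp_norm M p (f i) * Lp_norm M (conjugate_exponent p) (g i)) \<and>
     (\<forall>x. (\<lambda>i. convolution M (f i) (tilde (g i)) x) sums u x)"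

definition Ap_space :: "'a::{topological_group_add,t2_space} measure \<Rightarrow> real \<Rightarrow> ('a \<Rightarrow> complex) set" where
  "Ap_space M p = {u \<in> C0_space. \<exists>f g. Ap_representation M p u f g}"

definition Ap_norm :: "'a::{topological_group_add,t2_space} measure \<Rightarrow> real \<Rightarrow> ('a \<Rightarrow> complex) \<Rightarrow> real" where
  "Ap_norm M p u =
     Inf {(\<Sum>i. Lp_norm M p (f i) * Lp_norm M (conjugate_exponent p) (g i)) | f g.
            Ap_representation M p u f g}"

definition Ip_ideal ::
  "'a::{topological_group_add,t2_space} measure \<Rightarrow> real \<Rightarrow> 'a set \<Rightarrow> ('a \<Rightarrow> complex) set" where
  "Ip_ideal M p E = {u \<in> Ap_space M p. \<forall>x\<in>E. u x = 0}"

text \<open>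
  A net is a family indexed by a directed set \<open>D\<close>; a pair \<open>(\<alpha>, \<beta>)\<close> in the relation \<open>r\<close> means that
  \<open>\<beta>\<close> is beyond \<open>\<alpha>\<close>.
\<close>

definition directed_set :: "'i set \<Rightarrow> 'i rel \<Rightarrow> bool" where
  "directed_set D r \<longleftrightarrow>
     D \<noteq> {} \<and> preorder_on D r \<and> (\<forall>\<alpha>\<in>D. \<forall>\<beta>\<in>D. \<exists>\<gamma>\<in>D. (\<alpha>, \<gamma>) \<in> r \<and> (\<beta>, \<gamma>) \<in> r)"

definition bounded_approximate_identity :: "('a \<Rightarrow> complex) set \<Rightarrow> (('a \<Rightarrow> complex) \<Rightarrow> real) \<Rightarrow>
    'i set \<Rightarrow> 'i rel \<Rightarrow> ('i \<Rightarrow> 'a \<Rightarrow> complex) \<Rightarrow> bool" where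
  "bounded_approximate_identity B N D r e \<longleftrightarrow>
     directed_set D r \<and>
     (\<forall>\<alpha>\<in>D. e \<alpha> \<in> B) \<and>
     (\<exists>C. \<forall>\<alpha>\<in>D. N (e \<alpha>) \<le> C) \<and>
     (\<forall>b\<in>B. \<forall>\<epsilon>>0. \<exists>\<alpha>\<in>D. \<forall>\<beta>. (\<alpha>, \<beta>) \<in> r \<longrightarrow> N (\<lambda>x. b x * e \<beta> x - b x) < \<epsilon>)"

text \<open>
  As usual for groups that need not be \<open>\<sigma>\<close>-compact, \<open>L\<^sup>\<infinity>\<close> is formed modulo locally null sets.
\<close>

definition locally_ae :: "'a measure \<Rightarrow> ('a \<Rightarrow> bool) \<Rightarrow> bool" where
  "locally_ae M P \<longleftrightarrow> (\<forall>F\<in>sets M. emeasure M F < \<infinity> \<longrightarrow> (AE x in M. x \<in> F \<longrightarrow> P x))"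

definition Linf_space :: "'a measure \<Rightarrow> ('a \<Rightarrow> complex) set" where
  "Linf_space M = {f \<in> borel_measurable M. \<exists>C. locally_ae M (\<lambda>x. norm (f x) \<le> C)}"

definition Linf_norm :: "'a measure \<Rightarrow> ('a \<Rightarrow> complex) \<Rightarrow> real" where
  "Linf_norm M f = Inf {C. 0 \<le> C \<and> locally_ae M (\<lambda>x. norm (f x) \<le> C)}"

text \<open>
  Boundedness with respect to the essential supremum makes such a functional constant on classes of
  locally almost everywhere equal functions.
\<close>

definition Linf_dual :: "'a measure \<Rightarrow> (('a \<Rightarrow> complex) \<Rightarrow> complex) set" where
  "Linf_dual M = {m.
     (\<forall>f\<in>Linf_space M. \<forall>g\<in>Linf_space M. m (\<lambda>x. f x + g x) = m f + m g) \<and>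
     (\<forall>c. \<forall>f\<in>Linf_space M. m (\<lambda>x. c * f x) = c * m f) \<and>
     (\<exists>K. \<forall>f\<in>Linf_space M. norm (m f) \<le> K * Linf_norm M f)}"

definition left_translate :: "'a::group_add \<Rightarrow> ('a \<Rightarrow> complex) \<Rightarrow> 'a \<Rightarrow> complex" where
  "left_translate x f y = f (- x + y)"

definition amenable :: "'a::{topological_group_add,t2_space} measure \<Rightarrow> bool" where
  "amenable M \<longleftrightarrow> (\<exists>m\<in>Linf_dual M.
     (\<forall>f\<in>Linf_space M. locally_ae M (\<lambda>x. f x \<in> \<real>\<^sub>\<ge>\<^sub>0) \<longrightarrow> m f \<in> \<real>\<^sub>\<ge>\<^sub>0) \<and>
     m (\<lambda>x. 1) = 1 \<and>
     (\<forall>x. \<forall>f\<in>Linf_space M. m (left_translate x f) = m f))"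

end

theory Submission
  imports Defs
begin

text \<open>
  Let \<open>C\<close> bound the norms of an approximate identity \<open>(e\<^sub>\<alpha>)\<close> of \<open>I\<^sub>p(H)\<close>. Every \<open>e\<^sub>\<alpha>\<close> vanishes on \<open>H\<close>,
  and \<open>e\<^sub>\<alpha>(x)\<close> tends to \<open>1\<close> for each \<open>x \<notin> H\<close>. Fix \<open>a \<notin> H\<close>. The cosets \<open>H\<close> and \<open>aH\<close> are disjoint, so
  \<open>v\<^sub>\<alpha>(x) = e\<^sub>\<alpha>(x) + e\<^sub>\<alpha>(a\<inverse>x)\<close> is a bounded net in \<open>A\<^sub>p(G)\<close> whose real part is eventually at least \<open>1/2\<close>
  on any given finite set. The rest of the argument uses only such a net.

  Let \<open>F\<close> be a finite set and \<open>T\<close> the sum of the left translations by elements of \<open>F\<close>, acting on \<open>L\<^sup>q(G)\<close>.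
  Since \<open>(f * g~)(xs) = (f * (L\<^sub>s g)~)(x)\<close>, summing \<open>v\<^sub>\<alpha>\<close> over all words of length \<open>n\<close> in \<open>F\<close>
  amounts to applying \<open>T\<^sup>n\<close> to the second factors, so the sum is at most a constant times \<open>\<parallel>T\<parallel>\<^sup>n\<close>. It is
  also at least \<open>|F|\<^sup>n/2\<close> for suitable \<open>\<alpha>\<close>. Letting \<open>n\<close> grow gives \<open>\<parallel>T\<parallel> \<ge> |F|\<close>, which is Kesten's
  criterion (\<open>almost_norming_vector\<close>). A nearly norming \<open>k \<ge> 0\<close> and its dual function \<open>h \<in> L\<^sup>p\<close>
  then satisfy \<open>\<integral> h L\<^sub>s k \<approx> \<parallel>h\<parallel> \<parallel>k\<parallel>\<close> for every \<open>s \<in> F\<close>. Near equality in Young's inequality makes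
  all \<open>(L\<^sub>s k)\<^sup>q\<close> close to \<open>h\<^sup>p\<close> in \<open>L\<^sup>1\<close>, up to normalisation, so \<open>k\<^sup>q\<close> is an almost invariant density
  (\<open>almost_invariant_density\<close>). Compactness turns these densities into an invariant mean
  (\<open>amenable_if_almost_invariant_densities\<close>).

  The remaining part is the pointwise convergence \<open>e\<^sub>\<alpha>(x) \<rightarrow> 1\<close>. It follows from \<open>\<parallel>b e\<^sub>\<alpha> - b\<parallel> \<rightarrow> 0\<close> for
  one \<open>b \<in> I\<^sub>p(H)\<close> with \<open>b(x) \<noteq> 0\<close>, because the \<open>A\<^sub>p\<close>-norm dominates the supremum norm. As
  this norm is an infimum over representations, the comparison needs a representation of \<open>b e\<^sub>\<alpha> - b\<close>. So
  for \<open>b = f * g~\<close> with continuous compactly supported \<open>f\<close>, \<open>g\<close>, it must be shown that \<open>b A\<^sub>p \<subseteq> A\<^sub>p\<close>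
  (\<open>product_minus_in_Ap\<close>). By left invariance \<open>b(x) = \<integral> f(zw) g(x\<inverse>zw)\<^sup>- dw\<close> for every \<open>z\<close>, the bar denoting
  complex conjugation, hence formally \<open>b (h * k~) = \<integral> (h R\<^sub>w f) * (k R\<^sub>w g)~ dw\<close> with \<open>R\<^sub>w f(z) = f(zw)\<close>. Replacing \<open>w \<mapsto> R\<^sub>w f\<close> by functions with
  finitely many values turns this integral into a series of convolutions.
\<close>

section \<open>Locally compact groups\<close>

definition compactly_supported :: "('a::topological_space \<Rightarrow> 'b::real_normed_vector) \<Rightarrow> bool" where
  "compactly_supported f \<longleftrightarrow> continuous_on UNIV f \<and> (\<exists>K. compact K \<and> (\<forall>x. x \<notin> K \<longrightarrow> f x = 0))"

definition translates :: "'a::group_add set \<Rightarrow> 'a \<Rightarrow> 'a set" where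
  "translates V t = (\<lambda>x. x + t) ` V"

lemma in_translates_iff: "x \<in> translates V t \<longleftrightarrow> x - t \<in> V" for t :: "'a::group_add"
  by (force simp: translates_def image_iff)

lemma compact_translates:
  fixes V :: "'a::topological_group_add set"
  assumes "compact V" shows "compact (translates V t)"
  unfolding translates_def by (intro compact_continuous_image continuous_intros assms)

lemma open_translates:
  fixes V :: "'a::topological_group_add set"
  assumes "open V" shows "open (translates V t)"
proof -
  have "translates V t = (\<lambda>x. x - t) -` V" by (auto simp: in_translates_iff)
  then show ?thesis by (auto intro!: open_vimage assms continuous_intros)
qed

lemma compact_diff:
  fixes A B :: "'a::topological_group_add set"
  assumes "compact A" "compact B" shows "compact ((\<lambda>(x, y). - x + y) ` (A \<times> B))"
    and "compact ((\<lambda>(x, y). x - y) ` (A \<times> B))"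
  by (intro compact_continuous_image compact_Times assms; auto simp: case_prod_beta intro!: continuous_intros)+

lemma diff_neighbourhood:
  fixes V :: "'a::topological_group_add set"
  assumes "open V" "0 \<in> V"
  obtains U where "open U" "0 \<in> U" "\<And>x y. x \<in> U \<Longrightarrow> y \<in> U \<Longrightarrow> x - y \<in> V"
proof -
  have "open ((\<lambda>(x, y). x - y) -` V)"
    using assms by (intro open_vimage) (auto simp: case_prod_beta intro!: continuous_intros)
  moreover have "(0, 0) \<in> (\<lambda>(x, y). x - y) -` V" using assms by simp
  ultimately obtain A B where "open A" "open B" "(0, 0) \<in> A \<times> B" "A \<times> B \<subseteq> (\<lambda>(x, y). x - y) -` V"
    by (rule open_prod_elim)
  then show ?thesis using that[of "A \<inter> B"] by (auto simp: subset_iff)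
qed

text \<open>
  Common part of left and right uniform continuity, with \<open>\<tau> m\<close> the translation by \<open>m\<close> on either side. Joint
  continuity and compactness of the support \<open>K\<close> give a neighbourhood that works for \<open>y \<in> K\<close>. If \<open>y\<close> is outside
  \<open>K\<close> and its translate is inside, the roles of the two points are exchanged, which is why the neighbourhood has to
  be closed under inversion.
\<close>

lemma uniformly_continuous_translates:
  fixes f :: "'a::topological_group_add \<Rightarrow> 'b::real_normed_vector" and \<tau> :: "'a \<Rightarrow> 'a \<Rightarrow> 'a"
  assumes f: "compactly_supported f" and "0 < \<epsilon>"
    and \<tau>: "continuous_on UNIV (\<lambda>(m, y). \<tau> m y)"
    and \<tau>0: "\<And>y. \<tau> 0 y = y" and \<tau>_inv: "\<And>m y. \<tau> (- m) (\<tau> m y) = y"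
  obtains N where "open N" "0 \<in> N" "\<And>m y. m \<in> N \<Longrightarrow> norm (f (\<tau> m y) - f y) < \<epsilon>"
proof -
  from f obtain K where K: "compact K" "\<And>x. x \<notin> K \<Longrightarrow> f x = 0" and cont: "continuous_on UNIV f"
    by (auto simp: compactly_supported_def)
  define W where "W = (\<lambda>(m, y). norm (f (\<tau> m y) - f y)) -` {..<\<epsilon>}"
  have \<tau>': "continuous_on UNIV (\<lambda>z. \<tau> (fst z) (snd z))"
    using \<tau> by (simp add: case_prod_beta)
  have W: "open W"
    unfolding W_def
    using continuous_on_compose2[OF cont \<tau>'] continuous_on_compose2[OF cont continuous_on_snd[OF continuous_on_id]]
    by (intro open_vimage) (auto simp: case_prod_beta intro!: continuous_intros)
  have "{0} \<times> K \<subseteq> W" using \<open>0 < \<epsilon>\<close> by (auto simp: W_def \<tau>0)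
  from Elementary_Topology.tube_lemma[OF K(1) W this] obtain X where
    X: "0 \<in> X" "open X" "X \<times> K \<subseteq> W" by (elim exE conjE)
  have "norm (f (\<tau> m y) - f y) < \<epsilon>" if "m \<in> X" "- m \<in> X" for m y
  proof (cases "y \<in> K")
    case True then show ?thesis using X that by (auto simp: W_def)
  next
    case False
    show ?thesis
    proof (cases "\<tau> m y \<in> K")
      case True
      then have "(- m, \<tau> m y) \<in> W" using X that by auto
      then show ?thesis by (simp add: W_def \<tau>_inv norm_minus_commute)
    qed (use False K \<open>0 < \<epsilon>\<close> in simp)
  qed
  moreover have "open (X \<inter> uminus -` X)"
    using X by (intro open_Int open_vimage) (auto intro!: continuous_intros)
  ultimately show ?thesis using that[of "X \<inter> uminus -` X"] X by auto
qed

lemma right_uniformly_continuous: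
  fixes f :: "'a::topological_group_add \<Rightarrow> 'b::real_normed_vector"
  assumes "compactly_supported f" "0 < \<epsilon>"
  obtains N where "open N" "0 \<in> N" "\<And>m y. m \<in> N \<Longrightarrow> norm (f (y + m) - f y) < \<epsilon>"
  by (rule uniformly_continuous_translates[OF assms, of "\<lambda>m y. y + m"])
     (auto simp: case_prod_beta add.assoc intro!: continuous_intros)

lemma left_uniformly_continuous:
  fixes f :: "'a::topological_group_add \<Rightarrow> 'b::real_normed_vector"
  assumes "compactly_supported f" "0 < \<epsilon>"
  obtains N where "open N" "0 \<in> N" "\<And>m y. m \<in> N \<Longrightarrow> norm (f (m + y) - f y) < \<epsilon>"
  by (rule uniformly_continuous_translates[OF assms, of "\<lambda>m y. m + y"])
     (auto simp: case_prod_beta add.assoc[symmetric] intro!: continuous_intros)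

lemma compactly_supported_bounded:
  fixes f :: "'a::topological_space \<Rightarrow> 'b::real_normed_vector"
  assumes "compactly_supported f"
  obtains B where "0 < B" "\<And>x. norm (f x) \<le> B"
proof -
  from assms obtain K where K: "compact K" "\<And>x. x \<notin> K \<Longrightarrow> f x = 0" and cont: "continuous_on UNIV f"
    by (auto simp: compactly_supported_def)
  have "bounded (f ` K)"
    using compact_continuous_image[OF continuous_on_subset[OF cont] K(1)] compact_imp_bounded by auto
  then obtain B where "0 < B" "\<And>x. x \<in> K \<Longrightarrow> norm (f x) \<le> B"
    by (auto simp: bounded_pos)
  then show ?thesis using that[of B] K by (metis norm_zero less_imp_le)
qed

lemma compactly_supported_add_left:
  fixes f :: "'a::topological_group_add \<Rightarrow> 'b::real_normed_vector"
  assumes "compactly_supported f" shows "compactly_supported (\<lambda>y. f (x + y))"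
proof -
  from assms obtain K where K: "compact K" "\<And>x. x \<notin> K \<Longrightarrow> f x = 0" and cont: "continuous_on UNIV f"
    by (auto simp: compactly_supported_def)
  have "compact ((\<lambda>y. - x + y) ` K)"
    by (intro compact_continuous_image continuous_intros K)
  moreover have "f (x + y) = 0" if "y \<notin> (\<lambda>y. - x + y) ` K" for y
    using that by (intro K) (auto simp: image_iff add.assoc[symmetric])
  ultimately show ?thesis
    unfolding compactly_supported_def
    by (auto intro!: continuous_on_compose2[OF cont] continuous_intros)
qed

lemma compact_neighbourhood:
  assumes "locally_compact_space (euclidean :: 'a::{topological_group_add,t2_space} topology)"
  obtains O' K where "open O'" "compact K" "(0::'a) \<in> O'" "O' \<subseteq> K"
proof -
  have "\<forall>x. \<exists>U. open U \<and> (\<exists>K. compact K \<and> (x::'a) \<in> U \<and> U \<subseteq> K)"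
    using assms by (simp add: locally_compact_space_def)
  then have "\<exists>U. open U \<and> (\<exists>K. compact K \<and> (0::'a) \<in> U \<and> U \<subseteq> K)" by (rule spec)
  then show ?thesis by (elim exE conjE) (rule that; assumption)
qed

lemma bump_function:
  fixes U :: "'a::{topological_group_add,t2_space} set"
  assumes lc: "locally_compact_space (euclidean :: 'a topology)" and U: "open U" "0 \<in> U"
  obtains f :: "'a \<Rightarrow> real" where "compactly_supported f" "f 0 = 1" "\<And>x. x \<notin> U \<Longrightarrow> f x = 0" "\<And>x. 0 \<le> f x"
proof -
  obtain O' K where OK: "open O'" "compact K" "(0::'a) \<in> O'" "O' \<subseteq> K"
    by (rule compact_neighbourhood[OF lc])
  have "completely_regular_space (euclidean :: 'a topology)"
  proof (rule locally_compact_regular_imp_completely_regular_space[OF lc], rule disjI1)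
    show "Hausdorff_space (euclidean :: 'a topology)"
      unfolding Hausdorff_space_def disjnt_def by simp (metis hausdorff)
  qed
  then have "\<forall>S x. closedin euclidean S \<longrightarrow> x \<in> topspace euclidean - S \<longrightarrow>
      (\<exists>f::'a \<Rightarrow> real. continuous_map euclidean euclidean f \<and> f x = 1 \<and> f ` S \<subseteq> {0})"
    by (subst (asm) completely_regular_space_gen_alt[of 1 0]) simp
  moreover have "closedin euclidean (- (U \<inter> O'))" "0 \<in> topspace euclidean - (- (U \<inter> O'))"
    using U OK by (auto simp: open_Int)
  ultimately obtain f :: "'a \<Rightarrow> real" where f: "continuous_map euclidean euclidean f" "f 0 = 1" "f ` (- (U \<inter> O')) \<subseteq> {0}"
    by blast
  define h where "h x = max 0 (f x)" for x
  have 0: "f x = 0" if "x \<notin> U \<inter> O'" for x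
  proof -
    have "f x \<in> f ` (- (U \<inter> O'))" using that by blast
    then show ?thesis using f(3) by blast
  qed
  have "continuous_on UNIV h"
    unfolding h_def using f(1) by (auto intro!: continuous_intros)
  moreover have "h x = 0" if "x \<notin> K" for x
  proof -
    have "x \<notin> U \<inter> O'" using that OK(4) by blast
    from 0[OF this] show ?thesis by (simp add: h_def)
  qed
  ultimately have "compactly_supported h"
    unfolding compactly_supported_def using OK(2) by blast
  then show ?thesis using that[of h] f(2) 0 by (auto simp: h_def)
qed

lemma compact_symmetric_neighbourhood:
  assumes lc: "locally_compact_space (euclidean :: 'a::{topological_group_add,t2_space} topology)"
  obtains V U :: "'a::{topological_group_add,t2_space} set" where "compact V" "open U" "0 \<in> U" "U \<subseteq> V" "uminus ` V = V"
proof -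
  obtain O' K where OK: "open O'" "compact K" "(0::'a) \<in> O'" "O' \<subseteq> K"
    by (rule compact_neighbourhood[OF lc])
  have "compact (K \<union> uminus ` K)"
    by (intro compact_Un compact_continuous_image continuous_intros OK)
  moreover have "uminus ` (K \<union> uminus ` K) = K \<union> uminus ` K"
    by (simp add: image_Un image_image Un_commute)
  moreover have "O' \<subseteq> K \<union> uminus ` K" using OK by auto
  ultimately show ?thesis using that OK(1,3) by metis
qed

lemma finite_translate_cover:
  fixes Q :: "'a::topological_group_add set"
  assumes "compact Q" "open U" "0 \<in> U"
  obtains A where "finite A" "Q \<subseteq> (\<Union>a\<in>A. translates U a)"
  using assms(1)
proof (rule compactE_image[where C = Q and f = "translates U"])
  show "open (translates U t)" for t by (rule open_translates[OF assms(2)])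
  show "Q \<subseteq> (\<Union>t\<in>Q. translates U t)" using assms(3) by (auto simp: in_translates_iff)
qed (use that in blast)

text \<open>
  Right translates of \<open>V\<close> are used because the kernel
  \<open>(z, t) \<mapsto> b(z t\<inverse>)\<close> of a multiplication operator is invariant under simultaneous right translation.
\<close>

definition separated :: "'a::group_add set \<Rightarrow> 'a set \<Rightarrow> bool" where
  "separated V T \<longleftrightarrow> (\<forall>s\<in>T. \<forall>t\<in>T. s \<noteq> t \<longrightarrow> t \<notin> translates V s)"

lemma maximal_separated_set:
  fixes V :: "'a::group_add set"
  assumes V: "0 \<in> V" "uminus ` V = V"
  obtains T where "separated V T" "(\<Union>t\<in>T. translates V t) = UNIV"
proof -
  have "\<exists>T\<in>{T. separated V T}. \<forall>X\<in>{T. separated V T}. T \<subseteq> X \<longrightarrow> X = T"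
  proof (rule subset_Zorn')
    fix C assume C: "subset.chain {T. separated V T} C"
    show "\<Union>C \<in> {T. separated V T}"
      unfolding separated_def mem_Collect_eq
    proof (intro ballI impI)
      fix s t assume "s \<in> \<Union>C" "t \<in> \<Union>C" "s \<noteq> t"
      then obtain A B where "A \<in> C" "B \<in> C" "s \<in> A" "t \<in> B" by blast
      moreover have "A \<subseteq> B \<or> B \<subseteq> A"
        using C \<open>A \<in> C\<close> \<open>B \<in> C\<close> by (auto simp: subset_chain_def)
      ultimately have "\<exists>Z\<in>C. s \<in> Z \<and> t \<in> Z" by blast
      then show "t \<notin> translates V s"
        using C \<open>s \<noteq> t\<close> by (auto simp: subset_chain_def separated_def)
    qed
  qed
  then obtain T where T: "separated V T" and max: "\<And>X. separated V X \<Longrightarrow> T \<subseteq> X \<Longrightarrow> X = T" by auto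
  have "x \<in> (\<Union>t\<in>T. translates V t)" for x
  proof (rule ccontr)
    assume x: "x \<notin> (\<Union>t\<in>T. translates V t)"
    have "t \<notin> translates V x" if "t \<in> T" for t
    proof
      assume "t \<in> translates V x"
      then have "- (t - x) \<in> uminus ` V" by (simp only: in_translates_iff imageI)
      then have "x - t \<in> V" unfolding V(2) by simp
      then show False using x that by (auto simp: in_translates_iff)
    qed
    then have "separated V (insert x T)"
      using x T by (auto simp: separated_def)
    with max have "x \<in> T" by blast
    then show False using x V(1) by (auto simp: in_translates_iff)
  qed
  then show ?thesis using that T by blast
qed

text \<open>
  Cover the compact set \<open>Q\<close> by finitely many right translates of a small neighbourhood; each of them meets \<open>Tx\<inverse>\<close> in
  at most one point. The bound is uniform in \<open>x\<close>, and this is what makes the sums over \<open>T\<close> below converge on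
  groups that need not be unimodular.
\<close>

lemma separated_card_bound:
  fixes V :: "'a::topological_group_add set"
  assumes T: "separated V T" and U: "open U" "0 \<in> U" "U \<subseteq> V" and Q: "compact Q"
  obtains m :: nat where "\<And>x. finite (T \<inter> translates Q x)" "\<And>x. card (T \<inter> translates Q x) \<le> m"
proof -
  obtain O' where O': "open O'" "0 \<in> O'" "\<And>x y. x \<in> O' \<Longrightarrow> y \<in> O' \<Longrightarrow> x - y \<in> U"
    using diff_neighbourhood[OF U(1,2)] by metis
  obtain A where A: "finite A" "Q \<subseteq> (\<Union>a\<in>A. translates O' a)"
    using finite_translate_cover[OF Q O'(1,2)] by metis
  have *: "\<exists>f. inj_on f (T \<inter> translates Q x) \<and> f ` (T \<inter> translates Q x) \<subseteq> A" for x
  proof -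
    have "\<forall>s\<in>T \<inter> translates Q x. \<exists>a\<in>A. s - x \<in> translates O' a"
      using A(2) by (force simp: in_translates_iff)
    then obtain f where f: "\<And>s. s \<in> T \<inter> translates Q x \<Longrightarrow> f s \<in> A \<and> s - x \<in> translates O' (f s)"
      by metis
    have "inj_on f (T \<inter> translates Q x)"
    proof (rule inj_onI, rule ccontr)
      fix s t assume st: "s \<in> T \<inter> translates Q x" "t \<in> T \<inter> translates Q x" "f s = f t" "s \<noteq> t"
      have "(t - x - f t) - (s - x - f s) \<in> U"
        proof (rule O'(3))
        show "t - x - f t \<in> O'" using f[OF st(2)] by (simp only: in_translates_iff)
        show "s - x - f s \<in> O'" using f[OF st(1)] by (simp only: in_translates_iff)
      qed
      moreover have "(t - x - f t) - (s - x - f s) = t - s"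
        using st(3) by (simp add: diff_conv_add_uminus minus_add add.assoc del: add_uminus_conv_diff)
      ultimately show False
        using T st U(3) by (auto simp: separated_def in_translates_iff)
    qed
    then show ?thesis using f by blast
  qed
  have "finite (T \<inter> translates Q x)" "card (T \<inter> translates Q x) \<le> card A" for x
    using *[of x] A(1) by (metis finite_imageD finite_subset, metis card_inj_on_le)
  then show ?thesis using that by blast
qed

section \<open>Haar measure and Lebesgue spaces\<close>

lemma conjugate_exponent_gt_1: "1 < p \<Longrightarrow> 1 < conjugate_exponent p"
  by (simp add: conjugate_exponent_def field_simps)

lemma borel_measurable_cnj [measurable (raw)]:
  "f \<in> borel_measurable M \<Longrightarrow> (\<lambda>x. cnj (f x)) \<in> borel_measurable M"
  by (rule borel_measurable_continuous_on[where f = cnj]) (auto intro!: continuous_intros)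

lemma integrable_dominated:
  fixes f :: "'a \<Rightarrow> 'b::{banach,second_countable_topology}"
  assumes "integrable M g" "f \<in> borel_measurable M" "\<And>x. norm (f x) \<le> (g x :: real)"
  shows "integrable M f"
proof (rule Bochner_Integration.integrable_bound[OF assms(1,2)])
  have "norm (f x) \<le> norm (g x)" for x using assms(3)[of x] by simp
  then show "AE x in M. norm (f x) \<le> norm (g x)" by simp
qed

locale haar_group =
  fixes M :: "'a::{topological_group_add,t2_space} measure"
  assumes locally_compact: "locally_compact_space (euclidean :: 'a topology)"
    and haar: "left_haar_measure M"
begin

lemmas sets_M [simp, measurable_cong] = haar[unfolded left_haar_measure_def, THEN conjunct1]
  and emeasure_compact = haar[unfolded left_haar_measure_def, THEN conjunct2, THEN conjunct1, rule_format]
  and outer_regular = haar[unfolded left_haar_measure_def, THEN conjunct2, THEN conjunct2, THEN conjunct1, rule_format]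
  and inner_regular = haar[unfolded left_haar_measure_def, THEN conjunct2, THEN conjunct2, THEN conjunct2, THEN conjunct1, rule_format]
  and emeasure_translation = haar[unfolded left_haar_measure_def, THEN conjunct2, THEN conjunct2, THEN conjunct2, THEN conjunct2, THEN conjunct1, rule_format]
  and emeasure_UNIV = haar[unfolded left_haar_measure_def, THEN conjunct2, THEN conjunct2, THEN conjunct2, THEN conjunct2, THEN conjunct2]

lemma space_M [simp]: "space M = UNIV"
  using sets_eq_imp_space_eq[OF sets_M] by simp

lemma continuous_imp_measurable:
  fixes f :: "'a \<Rightarrow> 'b::topological_space"
  assumes "continuous_on UNIV f" shows "f \<in> borel_measurable M"
  using borel_measurable_continuous_onI[OF assms] by simp

lemma translation_measurable [measurable]: "(\<lambda>y. x + y) \<in> measurable M M"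
proof -
  have "(\<lambda>y. x + y) \<in> borel_measurable (borel :: 'a measure)"
    by (intro borel_measurable_continuous_onI continuous_intros)
  then show ?thesis by simp
qed

lemma right_translation_measurable [measurable]: "(\<lambda>y. y - x) \<in> measurable M M"
proof -
  have "(\<lambda>y. y - x) \<in> borel_measurable (borel :: 'a measure)"
    by (intro borel_measurable_continuous_onI continuous_intros)
  then show ?thesis by simp
qed

lemma distr_translation: "distr M M (\<lambda>y. x + y) = M"
proof (rule measure_eqI)
  fix A assume "A \<in> sets (distr M M ((+) x))"
  then have A: "A \<in> sets borel" by simp
  have "(+) x -` A = (\<lambda>y. - x + y) ` A"
    by (force simp: image_iff add.assoc[symmetric])
  then have "emeasure M ((+) x -` A) = emeasure M A"
    using emeasure_translation[OF A, of "- x"] by simp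
  then show "emeasure (distr M M ((+) x)) A = emeasure M A"
    using A by (simp add: emeasure_distr)
qed simp

lemma integral_translation:
  fixes f :: "'a \<Rightarrow> 'b::{banach,second_countable_topology}"
  assumes "f \<in> borel_measurable M"
  shows "(LINT y|M. f (x + y)) = (LINT y|M. f y)"
  using integral_distr[of "\<lambda>y. x + y" M M f] assms translation_measurable
  by (simp add: distr_translation)

lemma integrable_translation:
  fixes f :: "'a \<Rightarrow> 'b::{banach,second_countable_topology}"
  assumes "integrable M f"
  shows "integrable M (\<lambda>y. f (x + y))"
  using integrable_distr[of "\<lambda>y. x + y" M M f] assms translation_measurable
  by (simp add: distr_translation)

lemma compact_in_sets: "compact K \<Longrightarrow> K \<in> sets borel" for K :: "'a set"
  by (intro borel_closed compact_imp_closed)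

text \<open>
  If an open set is null, so are its translates, hence all compact sets and by inner regularity the whole group.
\<close>

lemma emeasure_open_pos:
  assumes U: "open U" "u \<in> U"
  shows "emeasure M U \<noteq> 0"
proof
  assume 0: "emeasure M U = 0"
  have "emeasure M K = 0" if K: "compact K" for K
  proof -
    have op: "open ((+) x ` U)" for x
    proof -
      have "(+) x ` U = (\<lambda>y. - x + y) -` U"
        by (force simp: image_iff add.assoc[symmetric])
      then show ?thesis by (auto intro!: open_vimage U continuous_intros)
    qed
    have "x \<in> (+) (x - u) ` U" for x using U by (auto simp: image_iff intro!: bexI[of _ u])
    then have "K \<subseteq> (\<Union>x\<in>UNIV. (+) x ` U)" by blast
    then obtain A where A: "finite A" "K \<subseteq> (\<Union>x\<in>A. (+) x ` U)"
      using K op by (metis compactE_image)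
    have "emeasure M ((+) x ` U) = 0" for x
      using emeasure_translation[of U x] 0 U by simp
    then have "(\<Union>x\<in>A. (+) x ` U) \<in> null_sets M"
      using A op by (intro null_sets_UN') (auto simp: null_sets_def countable_finite)
    then have "emeasure M K \<le> 0"
      using A op by (intro order_trans[OF emeasure_mono[of K "\<Union>x\<in>A. (+) x ` U" M]]) (auto dest: null_setsD1)
    then show ?thesis by simp
  qed
  then have "(SUP K\<in>{K. compact K \<and> K \<subseteq> UNIV}. emeasure M K) = 0"
    by (auto intro!: antisym SUP_least)
  then show False using inner_regular[of UNIV] emeasure_UNIV by simp
qed

text \<open>
  The Haar measure need not be \<open>\<sigma>\<close>-finite, but outer regularity on Borel sets and inner regularity on open sets
  put every set of finite measure inside a \<open>\<sigma>\<close>-compact set, up to a null set.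
\<close>

lemma finite_measure_sigma_compact:
  assumes B: "B \<in> sets borel" "emeasure M B < \<infinity>"
  obtains K :: "nat \<Rightarrow> 'a set" where "\<And>n. compact (K n)" "AE z in M. z \<in> B \<longrightarrow> z \<in> (\<Union>n. K n)"
proof -
  have "(INF U\<in>{U. open U \<and> B \<subseteq> U}. emeasure M U) < \<infinity>"
    using outer_regular[OF B(1)] B(2) by metis
  then obtain U where U: "open U" "B \<subseteq> U" "emeasure M U < \<infinity>" by (auto simp: INF_less_iff)
  have "emeasure M U = (SUP K\<in>{K. compact K \<and> K \<subseteq> U}. emeasure M K)"
    by (rule inner_regular[OF U(1)])
  moreover have "\<exists>f::nat \<Rightarrow> ennreal. range f \<subseteq> emeasure M ` {K. compact K \<and> K \<subseteq> U} \<and>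
      (SUP K\<in>{K. compact K \<and> K \<subseteq> U}. emeasure M K) = (SUP n. f n)"
    using ennreal_Sup_countable_SUP[of "emeasure M ` {K. compact K \<and> K \<subseteq> U}"]
    by (metis (mono_tags, lifting) compact_empty empty_iff empty_subsetI image_is_empty mem_Collect_eq)
  ultimately obtain f :: "nat \<Rightarrow> ennreal" where
    f: "range f \<subseteq> emeasure M ` {K. compact K \<and> K \<subseteq> U}" "emeasure M U = (SUP n. f n)" by auto
  then have "\<forall>n. \<exists>K. compact K \<and> K \<subseteq> U \<and> f n = emeasure M K" by blast
  then obtain K where K: "\<And>n. compact (K n)" "\<And>n. K n \<subseteq> U" "\<And>n. f n = emeasure M (K n)" by metis
  have Ks: "(\<Union>n. K n) \<in> sets M" using K compact_in_sets by auto
  have "f n \<le> emeasure M (\<Union>n. K n)" for n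
    unfolding K(3) using Ks by (intro emeasure_mono) auto
  then have "emeasure M U \<le> emeasure M (\<Union>n. K n)" unfolding f(2) by (rule SUP_least)
  then have "emeasure M (U - (\<Union>n. K n)) = 0"
  proof (subst emeasure_Diff)
    have "emeasure M (\<Union>n. K n) \<le> emeasure M U"
      using K(2) U(1) by (intro emeasure_mono) auto
    then show "emeasure M (\<Union>n. K n) \<noteq> \<infinity>" using U(3) by (auto simp: top_unique)
  qed (use U Ks K(2) in \<open>auto simp: diff_eq_0_iff_ennreal\<close>)
  then have "U - (\<Union>n. K n) \<in> null_sets M" using U Ks by (auto simp: null_sets_def)
  then have "AE z in M. z \<notin> U - (\<Union>n. K n)" by (rule AE_not_in)
  then have "AE z in M. z \<in> B \<longrightarrow> z \<in> (\<Union>n. K n)" by eventually_elim (use U in auto)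
  then show ?thesis using that K by blast
qed

lemma Lp_norm_nonneg: "0 \<le> Lp_norm M p f"
  by (simp add: Lp_norm_def)

lemma Lp_norm_powr: "0 < p \<Longrightarrow> Lp_norm M p f powr p = (LINT x|M. norm (f x) powr p)"
  by (simp add: Lp_norm_def powr_powr)

lemma Lp_measurable: "f \<in> Lp_space M p \<Longrightarrow> f \<in> borel_measurable M"
  by (simp add: Lp_space_def)

lemma Lp_zero: "(\<lambda>x. 0) \<in> Lp_space M p" "Lp_norm M p (\<lambda>x. 0) = 0"
  by (simp_all add: Lp_space_def Lp_norm_def)

lemma Lp_dominated:
  assumes h: "h \<in> Lp_space M p" and f: "f \<in> borel_measurable M" and p: "0 < p" and B: "0 \<le> B"
    and le: "\<And>x. norm (f x) \<le> B * norm (h x)"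
  shows "f \<in> Lp_space M p" "Lp_norm M p f \<le> B * Lp_norm M p h"
proof -
  have hi: "integrable M (\<lambda>x. norm (h x) powr p)" and hm: "h \<in> borel_measurable M"
    using h by (auto simp: Lp_space_def)
  have *: "norm (f x) powr p \<le> B powr p * norm (h x) powr p" for x
    using le[of x] p B by (simp add: powr_mono2 flip: powr_mult)
  have fi: "integrable M (\<lambda>x. norm (f x) powr p)"
  proof (rule integrable_dominated)
    show "integrable M (\<lambda>x. B powr p * norm (h x) powr p)" using hi by simp
    show "(\<lambda>x. norm (f x) powr p) \<in> borel_measurable M" using f by measurable
  qed (use * in simp)
  then show "f \<in> Lp_space M p" using f by (simp add: Lp_space_def)
  have "(LINT x|M. norm (f x) powr p) \<le> (LINT x|M. B powr p * norm (h x) powr p)"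
    using * fi hi by (intro integral_mono) auto
  then have "Lp_norm M p f \<le> (B powr p * (LINT x|M. norm (h x) powr p)) powr (1 / p)"
    unfolding Lp_norm_def using p by (intro powr_mono2) auto
  also have "\<dots> = B * Lp_norm M p h"
    using B p by (simp add: powr_mult powr_powr Lp_norm_def)
  finally show "Lp_norm M p f \<le> B * Lp_norm M p h" .
qed

lemma Lp_add:
  assumes f: "f \<in> Lp_space M p" and g: "g \<in> Lp_space M p" and p: "0 < p"
  shows "(\<lambda>x. f x + g x) \<in> Lp_space M p"
proof -
  have [measurable]: "f \<in> borel_measurable M" "g \<in> borel_measurable M"
    using f g by (auto simp: Lp_space_def)
  have "norm (f x + g x) powr p \<le> 2 powr p * (norm (f x) powr p + norm (g x) powr p)" for x
  proof -
    have "norm (f x + g x) \<le> 2 * max (norm (f x)) (norm (g x))"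
      using norm_triangle_ineq[of "f x" "g x"] by linarith
    then have "norm (f x + g x) powr p \<le> 2 powr p * max (norm (f x)) (norm (g x)) powr p"
      using p by (simp add: powr_mono2 flip: powr_mult)
    also have "max (norm (f x)) (norm (g x)) powr p \<le> norm (f x) powr p + norm (g x) powr p"
      by (auto simp: max_def)
    finally show ?thesis by simp
  qed
  then have le: "norm (norm (f x + g x) powr p) \<le> 2 powr p * (norm (f x) powr p + norm (g x) powr p)" for x
    by simp
  have "(\<lambda>x. norm (f x + g x) powr p) \<in> borel_measurable M" by measurable
  moreover have "integrable M (\<lambda>x. 2 powr p * (norm (f x) powr p + norm (g x) powr p))"
    using f g by (simp add: Lp_space_def)
  ultimately have "integrable M (\<lambda>x. norm (f x + g x) powr p)"
    using integrable_dominated le by blast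
  then show ?thesis by (simp add: Lp_space_def)
qed

lemma Lp_translation:
  assumes "f \<in> Lp_space M p"
  shows "(\<lambda>y. f (x + y)) \<in> Lp_space M p" "Lp_norm M p (\<lambda>y. f (x + y)) = Lp_norm M p f"
proof -
  have m: "f \<in> borel_measurable M" and i: "integrable M (\<lambda>x. norm (f x) powr p)"
    using assms by (auto simp: Lp_space_def)
  have "(\<lambda>y. f (x + y)) \<in> borel_measurable M"
    using measurable_compose[OF translation_measurable m] by simp
  then show "(\<lambda>y. f (x + y)) \<in> Lp_space M p"
    using integrable_translation[OF i] by (simp add: Lp_space_def)
  show "Lp_norm M p (\<lambda>y. f (x + y)) = Lp_norm M p f"
    unfolding Lp_norm_def using m integral_translation[of "\<lambda>y. norm (f y) powr p" x] by simp
qed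

lemma Lp_norm_eq_0:
  assumes "f \<in> Lp_space M p" "0 < p" "Lp_norm M p f = 0"
  shows "AE x in M. f x = 0"
proof -
  have "(LINT x|M. norm (f x) powr p) = 0" using assms Lp_norm_powr[of p f] by simp
  then have "AE x in M. norm (f x) powr p = 0"
    using assms by (subst (asm) integral_nonneg_eq_0_iff_AE) (auto simp: Lp_space_def)
  then show ?thesis by eventually_elim simp
qed

lemma finite_level_set:
  fixes g :: "'a \<Rightarrow> real"
  assumes g: "integrable M g" and c: "0 < c"
  shows "emeasure M {x. c \<le> g x} < \<infinity>"
proof -
  have [measurable]: "g \<in> borel_measurable M" using g by auto
  have "{x \<in> space M. c \<le> g x} \<in> sets M" by measurable
  then have "emeasure M {x. c \<le> g x} = (\<integral>\<^sup>+x. indicator {x. c \<le> g x} x \<partial>M)" by simp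
  also have "\<dots> \<le> (\<integral>\<^sup>+x. ennreal (norm (g x) / c) \<partial>M)"
  proof (intro nn_integral_mono)
    fix x
    have "ennreal 1 \<le> ennreal (norm (g x) / c)" if "c \<le> g x"
      using that c by (intro ennreal_leI) (simp add: pos_le_divide_eq)
    then show "indicator {x. c \<le> g x} x \<le> ennreal (norm (g x) / c)" by (auto simp: indicator_def)
  qed
  also have "\<dots> < \<infinity>"
    using nn_integral_eq_integral[of M "\<lambda>x. norm (g x) / c"] g c by simp
  finally show ?thesis .
qed

lemma Lp_sigma_compact_support:
  assumes f: "f \<in> Lp_space M p" and p: "0 < p"
  obtains K :: "nat \<Rightarrow> 'a set" where "\<And>n. compact (K n)" "AE z in M. f z \<noteq> 0 \<longrightarrow> z \<in> (\<Union>n. K n)"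
proof -
  have [measurable]: "f \<in> borel_measurable M" and i: "integrable M (\<lambda>x. norm (f x) powr p)"
    using f by (auto simp: Lp_space_def)
  define B where "B n = {x. norm (f x) powr p \<ge> 1 / Suc n}" for n
  have Bm: "B n \<in> sets borel" for n
  proof -
    have "{x \<in> space M. norm (f x) powr p \<ge> 1 / Suc n} \<in> sets M" by measurable
    then show ?thesis by (simp add: B_def)
  qed
  have "\<exists>K. (\<forall>m. compact (K m)) \<and> (AE z in M. z \<in> B n \<longrightarrow> z \<in> (\<Union>m::nat. K m))" for n
  proof -
    have "emeasure M (B n) < \<infinity>"
      using finite_level_set[OF i, of "1 / Suc n"] by (simp add: B_def)
    then show ?thesis using finite_measure_sigma_compact[OF Bm, of n] by metis
  qed
  then obtain K where K: "\<And>n m. compact (K n m)" "\<And>n. AE z in M. z \<in> B n \<longrightarrow> z \<in> (\<Union>m::nat. K n m)"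
    by metis
  have "AE z in M. \<forall>n. z \<in> B n \<longrightarrow> z \<in> (\<Union>m. K n m)" using K(2) by (simp add: AE_all_countable)
  then have "AE z in M. f z \<noteq> 0 \<longrightarrow> z \<in> (\<Union>i. K (fst (prod_decode i)) (snd (prod_decode i)))"
  proof eventually_elim
    case (elim z)
    show ?case
    proof
      assume "f z \<noteq> 0"
      then have "0 < norm (f z) powr p" by simp
      then obtain n where "1 / Suc n < norm (f z) powr p" by (metis nat_approx_posE)
      then have "z \<in> B n" by (simp add: B_def)
      then obtain m where "z \<in> K n m" using elim by auto
      then show "z \<in> (\<Union>i. K (fst (prod_decode i)) (snd (prod_decode i)))"
        by (auto intro!: exI[of _ "prod_encode (n, m)"])
    qed
  qed
  then show ?thesis using that[of "\<lambda>i. K (fst (prod_decode i)) (snd (prod_decode i))"] K(1) by blast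
qed

text \<open>
  Integrate Young's inequality for the normalised functions; a factor of norm zero vanishes almost everywhere.
\<close>

lemma Holder_inequality:
  assumes p: "1 < p" and h: "h \<in> Lp_space M p" and k: "k \<in> Lp_space M (conjugate_exponent p)"
  shows "integrable M (\<lambda>x. norm (h x) * norm (k x))"
    and "(LINT x|M. norm (h x) * norm (k x)) \<le> Lp_norm M p h * Lp_norm M (conjugate_exponent p) k"
proof -
  define q where "q = conjugate_exponent p"
  have q: "1 < q" "1 / p + 1 / q = 1"
    using p conjugate_exponent conjugate_exponent_gt_1 by (auto simp: q_def)
  have [measurable]: "h \<in> borel_measurable M" "k \<in> borel_measurable M"
    and hi: "integrable M (\<lambda>x. norm (h x) powr p)" and ki: "integrable M (\<lambda>x. norm (k x) powr q)"
    using h k by (auto simp: Lp_space_def q_def)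
  have "norm (h x) * norm (k x) \<le> norm (h x) powr p / p + norm (k x) powr q / q" for x
    using p q by (intro Youngs_inequality) auto
  then have le: "norm (norm (h x) * norm (k x)) \<le> norm (h x) powr p / p + norm (k x) powr q / q" for x
    by simp
  have "(\<lambda>x. norm (h x) * norm (k x)) \<in> borel_measurable M" by measurable
  moreover have "integrable M (\<lambda>x. norm (h x) powr p / p + norm (k x) powr q / q)"
    using hi ki by simp
  ultimately show int: "integrable M (\<lambda>x. norm (h x) * norm (k x))"
    using integrable_dominated le by blast
  let ?a = "Lp_norm M p h" and ?b = "Lp_norm M q k"
  consider "?a = 0" | "?b = 0" | "0 < ?a" "0 < ?b"
    using Lp_norm_nonneg[of p h] Lp_norm_nonneg[of q k] by linarith
  then show "(LINT x|M. norm (h x) * norm (k x)) \<le> ?a * Lp_norm M (conjugate_exponent p) k"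
    unfolding q_def[symmetric]
  proof cases
    case 1
    then have "AE x in M. norm (h x) * norm (k x) = 0" using Lp_norm_eq_0[OF h] p by auto
    then have "(LINT x|M. norm (h x) * norm (k x)) = (LINT x|M. 0)" by (intro integral_cong_AE) auto
    then show "(LINT x|M. norm (h x) * norm (k x)) \<le> ?a * ?b" using 1 by simp
  next
    case 2
    then have "AE x in M. norm (h x) * norm (k x) = 0" using Lp_norm_eq_0[OF k] q by (auto simp: q_def)
    then have "(LINT x|M. norm (h x) * norm (k x)) = (LINT x|M. 0)" by (intro integral_cong_AE) auto
    then show "(LINT x|M. norm (h x) * norm (k x)) \<le> ?a * ?b" using 2 by simp
  next
    case 3
    have le: "norm (h x) * norm (k x) \<le>
        ?a * ?b * (norm (h x) powr p / (p * ?a powr p) + norm (k x) powr q / (q * ?b powr q))" for x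
    proof -
      have "(norm (h x) / ?a) * (norm (k x) / ?b) \<le> (norm (h x) / ?a) powr p / p + (norm (k x) / ?b) powr q / q"
        using p q 3 by (intro Youngs_inequality) auto
      also have "\<dots> = norm (h x) powr p / (p * ?a powr p) + norm (k x) powr q / (q * ?b powr q)"
        using 3 by (simp add: powr_divide mult.commute)
      finally have "?a * ?b * ((norm (h x) / ?a) * (norm (k x) / ?b)) \<le>
          ?a * ?b * (norm (h x) powr p / (p * ?a powr p) + norm (k x) powr q / (q * ?b powr q))"
        using 3 by (intro mult_left_mono) auto
      then show ?thesis using 3 by simp
    qed
    have "(LINT x|M. norm (h x) * norm (k x)) \<le>
        (LINT x|M. ?a * ?b * (norm (h x) powr p / (p * ?a powr p) + norm (k x) powr q / (q * ?b powr q)))"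
      using hi ki int le by (intro integral_mono) auto
    also have "\<dots> = ?a * ?b * (?a powr p / (p * ?a powr p) + ?b powr q / (q * ?b powr q))"
      using hi ki p q by (simp add: Lp_norm_powr)
    also have "\<dots> = ?a * ?b" using 3 q by simp
    finally show "(LINT x|M. norm (h x) * norm (k x)) \<le> ?a * ?b" .
  qed
qed

lemma convolution_tilde: "convolution M h (tilde k) x = (LINT y|M. h y * cnj (k (- x + y)))"
  by (simp add: convolution_def tilde_def minus_add)

lemma
  assumes p: "1 < p" and h: "h \<in> Lp_space M p" and k: "k \<in> Lp_space M (conjugate_exponent p)"
  shows convolution_integrable: "integrable M (\<lambda>y. h y * cnj (k (- x + y)))"
    and norm_convolution_le: "norm (convolution M h (tilde k) x) \<le> Lp_norm M p h * Lp_norm M (conjugate_exponent p) k"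
proof -
  have [measurable]: "h \<in> borel_measurable M" "k \<in> borel_measurable M"
    using h k by (auto simp: Lp_space_def)
  have [measurable]: "(\<lambda>y. k (- x + y)) \<in> borel_measurable M"
    by (rule Lp_measurable[OF Lp_translation(1)[OF k]])
  note * = Holder_inequality[OF p h Lp_translation(1)[OF k, of "- x"]] Lp_translation(2)[OF k, of "- x"]
  show 1: "integrable M (\<lambda>y. h y * cnj (k (- x + y)))"
    using *(1) by (rule Bochner_Integration.integrable_bound) (auto simp: norm_mult)
  have 2: "(LINT y|M. norm (h y * cnj (k (- x + y)))) \<le> Lp_norm M p h * Lp_norm M (conjugate_exponent p) k"
    using *(2,3) by (simp add: norm_mult)
  have "norm (convolution M h (tilde k) x) \<le> (LINT y|M. norm (h y * cnj (k (- x + y))))"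
    unfolding convolution_tilde by (rule integral_norm_bound)
  with 2 show "norm (convolution M h (tilde k) x) \<le> Lp_norm M p h * Lp_norm M (conjugate_exponent p) k"
    by linarith
qed

end

section \<open>Functions with a controlled representation\<close>

lemma double_series:
  fixes a :: "nat \<Rightarrow> nat \<Rightarrow> 'b::banach"
  assumes a: "\<And>i. summable (\<lambda>j. norm (a i j))" and le: "\<And>i. (\<Sum>j. norm (a i j)) \<le> c i" and c: "summable c"
  shows "summable (\<lambda>n. norm (a (fst (prod_decode n)) (snd (prod_decode n))))"
    and "(\<lambda>n. a (fst (prod_decode n)) (snd (prod_decode n))) sums (\<Sum>i. \<Sum>j. a i j)"
proof -
  define f where "f z = a (fst z) (snd z)" for z
  have hs: "((\<lambda>j. norm (a i j)) has_sum (\<Sum>j. norm (a i j))) UNIV" for i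
    using norm_summable_imp_has_sum[of "\<lambda>j. norm (a i j)"] a by (simp add: summable_sums)
  have nn: "0 \<le> (\<Sum>j. norm (a i j))" for i by (intro suminf_nonneg a) simp
  have sn: "summable (\<lambda>i. \<Sum>j. norm (a i j))"
    using c le nn by (intro summable_comparison_test'[OF c, of 0]) simp
  have "(\<lambda>z. norm (f z)) summable_on (SIGMA i:UNIV. UNIV)"
  proof (rule Infinite_Sum.abs_summable_on_Sigma_iff[THEN iffD2], unfold f_def fst_conv snd_conv, intro conjI ballI)
    show "(\<lambda>j. norm (a i j)) summable_on UNIV" for i
      using hs has_sum_imp_summable by blast
    have "infsum (\<lambda>j. norm (a i j)) UNIV = (\<Sum>j. norm (a i j))" for i using hs by (rule infsumI)
    then show "(\<lambda>i. norm (infsum (\<lambda>j. norm (a i j)) UNIV)) summable_on UNIV"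
      using sn nn by (simp add: summable_on_UNIV_nonneg_real_iff)
  qed
  then have abs: "(\<lambda>z. norm (f z)) summable_on UNIV" by simp
  have bij: "bij_betw prod_decode UNIV UNIV" by (rule bij_prod_decode)
  have "(\<lambda>n. norm (f (prod_decode n))) summable_on UNIV"
    using abs summable_on_reindex_bij_betw[OF bij, of "\<lambda>z. norm (f z)"] by simp
  then show "summable (\<lambda>n. norm (a (fst (prod_decode n)) (snd (prod_decode n))))"
    unfolding f_def by (rule summable_on_imp_summable)
  have "(f has_sum (\<Sum>i. \<Sum>j. a i j)) (SIGMA i:UNIV. UNIV)"
  proof (rule has_sum_SigmaI)
    show "((\<lambda>j. f (i, j)) has_sum (\<Sum>j. a i j)) UNIV" for i
      unfolding f_def fst_conv snd_conv
      by (intro norm_summable_imp_has_sum a summable_sums summable_norm_cancel[OF a])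
    have "norm (\<Sum>j. a i j) \<le> (\<Sum>j. norm (a i j))" for i by (rule summable_norm[OF a])
    then have "summable (\<lambda>i. norm (\<Sum>j. a i j))"
      using sn by (intro summable_comparison_test'[OF sn, of 0]) simp
    then show "((\<lambda>i. \<Sum>j. a i j) has_sum (\<Sum>i. \<Sum>j. a i j)) UNIV"
      by (intro norm_summable_imp_has_sum summable_sums) (auto intro: summable_norm_cancel)
    show "f summable_on (SIGMA i:UNIV. UNIV)"
      using abs_summable_summable[OF abs] by simp
  qed
  then have "((\<lambda>n. f (prod_decode n)) has_sum (\<Sum>i. \<Sum>j. a i j)) UNIV"
    using has_sum_reindex_bij_betw[OF bij, of f] by simp
  then show "(\<lambda>n. a (fst (prod_decode n)) (snd (prod_decode n))) sums (\<Sum>i. \<Sum>j. a i j)"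
    unfolding f_def by (rule has_sum_imp_sums)
qed

text \<open>
  \<open>Ap_bounded_by M p u c\<close> is a form of \<open>\<parallel>u\<parallel> \<le> c\<close> that is meaningful before \<open>u\<close> is known to belong to \<open>A\<^sub>p(G)\<close>. It
  does not ask for \<open>u \<in> C\<^sub>0(G)\<close>, and it demands a representation that attains the bound.
\<close>

definition Ap_bounded_by ::
  "'a::{topological_group_add,t2_space} measure \<Rightarrow> real \<Rightarrow> ('a \<Rightarrow> complex) \<Rightarrow> real \<Rightarrow> bool" where
  "Ap_bounded_by M p u c \<longleftrightarrow>
     (\<exists>f g. Ap_representation M p u f g \<and>
            (\<Sum>i. Lp_norm M p (f i) * Lp_norm M (conjugate_exponent p) (g i)) \<le> c)"

locale Lp_group = haar_group M
  for M :: "'a::{topological_group_add,t2_space} measure" +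
  fixes p q :: real
  assumes p: "1 < p" and q_def: "q = conjugate_exponent p"
begin

lemma q: "1 < q" "1 / p + 1 / q = 1"
  using p conjugate_exponent conjugate_exponent_gt_1 by (auto simp: q_def)

lemma Ap_bounded_by_convolution:
  assumes h: "h \<in> Lp_space M p" and k: "k \<in> Lp_space M q"
  shows "Ap_bounded_by M p (convolution M h (tilde k)) (Lp_norm M p h * Lp_norm M q k)"
proof -
  define f where "f i = (if i = 0 then h else (\<lambda>x. 0))" for i :: nat
  define g where "g i = (if i = 0 then k else (\<lambda>x. 0))" for i :: nat
  have z: "convolution M (\<lambda>x. 0) v x = 0" for v x by (simp add: convolution_def)
  have "(\<lambda>i. Lp_norm M p (f i) * Lp_norm M q (g i)) = (\<lambda>i. if i = 0 then Lp_norm M p h * Lp_norm M q k else 0)"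
    by (auto simp: f_def g_def Lp_zero)
  then have s: "(\<lambda>i. Lp_norm M p (f i) * Lp_norm M q (g i)) sums (Lp_norm M p h * Lp_norm M q k)"
    using sums_single[of 0 "\<lambda>_. Lp_norm M p h * Lp_norm M q k"] by (simp add: if_distrib)
  have "(\<lambda>i. convolution M (f i) (tilde (g i)) x) = (\<lambda>i. if i = 0 then convolution M h (tilde k) x else 0)" for x
    by (auto simp: f_def g_def z)
  then have "(\<lambda>i. convolution M (f i) (tilde (g i)) x) sums convolution M h (tilde k) x" for x
    using sums_single[of 0 "\<lambda>_. convolution M h (tilde k) x"] by (simp add: if_distrib)
  then have "Ap_representation M p (convolution M h (tilde k)) f g"
    unfolding Ap_representation_def q_def[symmetric] using h k s
    by (auto simp: f_def g_def Lp_zero sums_iff)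
  then show ?thesis
    unfolding Ap_bounded_by_def q_def[symmetric] using s
    by (intro exI[of _ f] exI[of _ g]) (simp add: sums_iff)
qed

lemma Ap_bounded_by_mono: "Ap_bounded_by M p u c \<Longrightarrow> c \<le> d \<Longrightarrow> Ap_bounded_by M p u d"
  unfolding Ap_bounded_by_def by (meson order_trans)

lemma Ap_representation_summable_norm:
  assumes "Ap_representation M p u f g"
  shows "summable (\<lambda>i. norm (convolution M (f i) (tilde (g i)) x))"
    and "(\<Sum>i. norm (convolution M (f i) (tilde (g i)) x)) \<le> (\<Sum>i. Lp_norm M p (f i) * Lp_norm M q (g i))"
proof -
  have le: "norm (convolution M (f i) (tilde (g i)) x) \<le> Lp_norm M p (f i) * Lp_norm M q (g i)" for i
    using assms p by (auto simp: q_def Ap_representation_def intro!: norm_convolution_le)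
  have s: "summable (\<lambda>i. Lp_norm M p (f i) * Lp_norm M q (g i))"
    using assms by (simp add: Ap_representation_def q_def)
  show 1: "summable (\<lambda>i. norm (convolution M (f i) (tilde (g i)) x))"
    by (rule summable_comparison_test'[OF s, of 0]) (simp add: le)
  show "(\<Sum>i. norm (convolution M (f i) (tilde (g i)) x)) \<le> (\<Sum>i. Lp_norm M p (f i) * Lp_norm M q (g i))"
    by (intro suminf_le le 1 s)
qed

lemma Ap_bounded_by_norm_le:
  assumes "Ap_bounded_by M p u c" shows "norm (u x) \<le> c"
proof -
  from assms obtain f g where fg: "Ap_representation M p u f g"
    and c: "(\<Sum>i. Lp_norm M p (f i) * Lp_norm M q (g i)) \<le> c"
    by (auto simp: Ap_bounded_by_def q_def)
  have "u x = (\<Sum>i. convolution M (f i) (tilde (g i)) x)"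
    using fg by (auto simp: Ap_representation_def sums_iff)
  then have "norm (u x) \<le> (\<Sum>i. norm (convolution M (f i) (tilde (g i)) x))"
    using summable_norm[OF Ap_representation_summable_norm(1)[OF fg]] by simp
  with Ap_representation_summable_norm(2)[OF fg, of x] c show ?thesis by linarith
qed

lemma Ap_bounded_by_nonneg: "Ap_bounded_by M p u c \<Longrightarrow> 0 \<le> c"
  using Ap_bounded_by_norm_le[of u c 0] norm_ge_zero[of "u 0"] by linarith

text \<open>
  Completeness of \<open>A\<^sub>p(G)\<close> in the form needed here: representations of the terms are merged along a pairing of
  \<open>\<nat> \<times> \<nat>\<close> with \<open>\<nat>\<close>.
\<close>

lemma Ap_bounded_by_sums:
  assumes u: "\<And>i. Ap_bounded_by M p (u i) (c i)" and c: "summable c"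
    and U: "\<And>x. (\<lambda>i. u i x) sums U x"
  shows "Ap_bounded_by M p U (\<Sum>i. c i)"
proof -
  have "\<forall>i. \<exists>f g. Ap_representation M p (u i) f g \<and> (\<Sum>j. Lp_norm M p (f j) * Lp_norm M q (g j)) \<le> c i"
    using u by (auto simp: Ap_bounded_by_def q_def)
  then obtain F G where FG: "\<And>i. Ap_representation M p (u i) (F i) (G i)"
    and le: "\<And>i. (\<Sum>j. Lp_norm M p (F i j) * Lp_norm M q (G i j)) \<le> c i" by metis
  define f where "f n = F (fst (prod_decode n)) (snd (prod_decode n))" for n
  define g where "g n = G (fst (prod_decode n)) (snd (prod_decode n))" for n
  define a where "a i j = Lp_norm M p (F i j) * Lp_norm M q (G i j)" for i j
  have a_nn: "0 \<le> a i j" for i j by (simp add: a_def Lp_norm_nonneg)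
  have a: "summable (\<lambda>j. a i j)" for i using FG by (simp add: a_def Ap_representation_def q_def)
  have ale: "(\<Sum>j. a i j) \<le> c i" for i using le by (simp add: a_def)
  have sa: "(\<lambda>n. a (fst (prod_decode n)) (snd (prod_decode n))) sums (\<Sum>i. \<Sum>j. a i j)"
    using a a_nn ale c by (intro double_series(2)[where c = c]) auto
  have "summable (\<lambda>i. \<Sum>j. a i j)"
    using ale a_nn a by (intro summable_comparison_test'[OF c, of 0]) (simp add: suminf_nonneg)
  then have "(\<Sum>i. \<Sum>j. a i j) \<le> (\<Sum>i. c i)"
    using ale c by (intro suminf_le) auto
  moreover have "(\<lambda>n. Lp_norm M p (f n) * Lp_norm M q (g n)) sums (\<Sum>i. \<Sum>j. a i j)"
    using sa by (simp add: a_def f_def g_def)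
  moreover have "(\<lambda>n. convolution M (f n) (tilde (g n)) x) sums U x" for x
  proof -
    have "(\<lambda>n. convolution M (f n) (tilde (g n)) x) sums (\<Sum>i. \<Sum>j. convolution M (F i j) (tilde (G i j)) x)"
      unfolding f_def g_def
    proof (intro double_series(2)[where c = c] c)
      show "summable (\<lambda>j. norm (convolution M (F i j) (tilde (G i j)) x))" for i
        by (rule Ap_representation_summable_norm(1)[OF FG])
      show "(\<Sum>j. norm (convolution M (F i j) (tilde (G i j)) x)) \<le> c i" for i
        using Ap_representation_summable_norm(2)[OF FG[of i], of x] le[of i] by linarith
    qed
    moreover have "(\<Sum>j. convolution M (F i j) (tilde (G i j)) x) = u i x" for i
      using FG[of i] by (auto simp: Ap_representation_def sums_iff)
    ultimately show ?thesis using U[of x] by (simp add: sums_iff)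
  qed
  ultimately show ?thesis
    unfolding Ap_bounded_by_def Ap_representation_def q_def[symmetric]
    using FG by (intro exI[of _ f] exI[of _ g])
      (auto simp: sums_iff f_def g_def Ap_representation_def q_def)
qed

lemma Ap_bounded_by_zero: "Ap_bounded_by M p (\<lambda>x. 0) 0"
proof -
  have "convolution M (\<lambda>x. 0) (tilde (\<lambda>x. 0)) = (\<lambda>x. 0)" by (simp add: convolution_def fun_eq_iff)
  then show ?thesis using Ap_bounded_by_convolution[OF Lp_zero(1) Lp_zero(1)] by (simp add: Lp_zero)
qed

lemma Ap_bounded_by_add:
  assumes u: "Ap_bounded_by M p u c" and v: "Ap_bounded_by M p v d"
  shows "Ap_bounded_by M p (\<lambda>x. u x + v x) (c + d)"
proof -
  define w where "w i = (if i = 0 then u else if i = Suc 0 then v else (\<lambda>x. 0))" for i :: nat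
  define e where "e i = (if i = 0 then c else if i = Suc 0 then d else 0)" for i :: nat
  have "e sums (\<Sum>i\<in>{0, Suc 0}. e i)" by (rule sums_finite) (auto simp: e_def)
  then have e: "e sums (c + d)" by (simp add: e_def)
  have "(\<lambda>i. w i x) sums (\<Sum>i\<in>{0, Suc 0}. w i x)" for x by (rule sums_finite) (auto simp: w_def)
  then have w: "(\<lambda>i. w i x) sums (u x + v x)" for x by (simp add: w_def)
  have "Ap_bounded_by M p (w i) (e i)" for i using u v Ap_bounded_by_zero by (simp add: w_def e_def)
  from Ap_bounded_by_sums[OF this _ w] e show ?thesis by (simp add: sums_iff)
qed

lemma Ap_bounded_by_sum:
  assumes "finite A" "\<And>a. a \<in> A \<Longrightarrow> Ap_bounded_by M p (u a) (c a)"
  shows "Ap_bounded_by M p (\<lambda>x. \<Sum>a\<in>A. u a x) (\<Sum>a\<in>A. c a)"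
  using assms by (induction A rule: finite_induct) (auto simp: Ap_bounded_by_zero intro!: Ap_bounded_by_add)

lemma Ap_bounded_by_uminus:
  assumes u: "Ap_bounded_by M p u c" shows "Ap_bounded_by M p (\<lambda>x. - u x) c"
proof -
  from u obtain f g where fg: "Ap_representation M p u f g" "(\<Sum>i. Lp_norm M p (f i) * Lp_norm M q (g i)) \<le> c"
    by (auto simp: Ap_bounded_by_def q_def)
  have "Lp_norm M p (\<lambda>x. - h x) = Lp_norm M p h" for h by (simp add: Lp_norm_def)
  moreover have "(\<lambda>x. - h x) \<in> Lp_space M p" if "h \<in> Lp_space M p" for h
    using that by (simp add: Lp_space_def)
  moreover have "convolution M (\<lambda>x. - h x) v x = - convolution M h v x" for h v x
    by (simp add: convolution_def)
  ultimately have "Ap_representation M p (\<lambda>x. - u x) (\<lambda>i x. - f i x) g"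
    "(\<Sum>i. Lp_norm M p (\<lambda>x. - f i x) * Lp_norm M q (g i)) \<le> c"
    using fg by (auto simp: Ap_representation_def sums_minus)
  then show ?thesis by (auto simp: Ap_bounded_by_def q_def)
qed

lemma norm_le_Ap_norm:
  assumes "u \<in> Ap_space M p" shows "norm (u x) \<le> Ap_norm M p u"
  unfolding Ap_norm_def
proof (rule cInf_greatest)
  show "{(\<Sum>i. Lp_norm M p (f i) * Lp_norm M (conjugate_exponent p) (g i)) | f g. Ap_representation M p u f g} \<noteq> {}"
    using assms by (auto simp: Ap_space_def)
  fix c assume "c \<in> {(\<Sum>i. Lp_norm M p (f i) * Lp_norm M (conjugate_exponent p) (g i)) | f g. Ap_representation M p u f g}"
  then show "norm (u x) \<le> c" by (intro Ap_bounded_by_norm_le) (auto simp: Ap_bounded_by_def)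
qed

lemma Ap_norm_less_imp_Ap_bounded_by:
  assumes "u \<in> Ap_space M p" "Ap_norm M p u < c" shows "Ap_bounded_by M p u c"
proof -
  have "{(\<Sum>i. Lp_norm M p (f i) * Lp_norm M (conjugate_exponent p) (g i)) | f g. Ap_representation M p u f g} \<noteq> {}"
    using assms by (auto simp: Ap_space_def)
  from cInf_lessD[OF this assms(2)[unfolded Ap_norm_def]] show ?thesis
    by (force simp: Ap_bounded_by_def)
qed

end

section \<open>Multiplication by a coefficient function\<close>

text \<open>
  Simple functions with values in an arbitrary type; here the values will be functions on the group.
\<close>

definition finitely_valued :: "'a::topological_space set \<Rightarrow> ('a \<Rightarrow> 'b) \<Rightarrow> bool" where
  "finitely_valued W \<phi> \<longleftrightarrow> finite (\<phi> ` W) \<and> (\<forall>a. {w \<in> W. \<phi> w = a} \<in> sets borel)"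

lemma finitely_valued_compose2:
  assumes \<phi>: "finitely_valued W \<phi>" and \<psi>: "finitely_valued W \<psi>"
  shows "finitely_valued W (\<lambda>w. F (\<phi> w) (\<psi> w))"
  unfolding finitely_valued_def
proof (intro conjI allI)
  have "(\<lambda>w. F (\<phi> w) (\<psi> w)) ` W \<subseteq> (\<lambda>(b, c). F b c) ` (\<phi> ` W \<times> \<psi> ` W)" by force
  moreover have "finite ((\<lambda>(b, c). F b c) ` (\<phi> ` W \<times> \<psi> ` W))"
    using \<phi> \<psi> by (auto simp: finitely_valued_def)
  ultimately show "finite ((\<lambda>w. F (\<phi> w) (\<psi> w)) ` W)" by (rule finite_subset)
  fix a
  define P where "P = {z \<in> \<phi> ` W \<times> \<psi> ` W. F (fst z) (snd z) = a}"
  have "finite P"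
    unfolding P_def using \<phi> \<psi> by (intro finite_Collect_conjI disjI1) (simp add: finitely_valued_def)
  have "{w \<in> W. F (\<phi> w) (\<psi> w) = a} = (\<Union>z\<in>P. {w \<in> W. \<phi> w = fst z} \<inter> {w \<in> W. \<psi> w = snd z})"
  proof (intro set_eqI iffI)
    fix w assume w: "w \<in> {w \<in> W. F (\<phi> w) (\<psi> w) = a}"
    then have "(\<phi> w, \<psi> w) \<in> P" by (simp add: P_def)
    then show "w \<in> (\<Union>z\<in>P. {w \<in> W. \<phi> w = fst z} \<inter> {w \<in> W. \<psi> w = snd z})"
      using w by (intro UN_I) auto
  qed (auto simp: P_def)
  moreover have "\<dots> \<in> sets borel"
    using \<open>finite P\<close> \<phi> \<psi> by (intro sets.finite_UN sets.Int) (auto simp: finitely_valued_def)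
  ultimately show "{w \<in> W. F (\<phi> w) (\<psi> w) = a} \<in> sets borel" by simp
qed

text \<open>
  By right uniform continuity, \<open>y \<mapsto> f(yw)\<close> varies little, uniformly in \<open>y\<close>, as long as \<open>w\<close> stays in a small left
  translate \<open>aN\<close>. Finitely many of these cover \<open>W\<close>; each \<open>w\<close> uses the first one that contains it.
\<close>

lemma right_translates_finitely_valued_approximation:
  fixes f :: "'a::{topological_group_add,t2_space} \<Rightarrow> complex"
  assumes f: "compactly_supported f" and W: "compact W" and "0 < \<epsilon>"
  obtains \<phi> where "finitely_valued W \<phi>" "\<And>w. continuous_on UNIV (\<phi> w)"
    "\<And>w y. w \<in> W \<Longrightarrow> norm (\<phi> w y - f (y + w)) \<le> \<epsilon>"
proof -
  obtain N where N: "open N" "0 \<in> N" "\<And>m y. m \<in> N \<Longrightarrow> norm (f (y + m) - f y) < \<epsilon>"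
    using right_uniformly_continuous[OF f \<open>0 < \<epsilon>\<close>] by metis
  define U where "U a = {w. - a + w \<in> N}" for a
  have opU: "open (U a)" for a
  proof -
    have "U a = (\<lambda>w. - a + w) -` N" by (auto simp: U_def)
    then show ?thesis using N(1) by (auto intro!: open_vimage continuous_intros)
  qed
  have "W \<subseteq> (\<Union>a\<in>W. U a)" using N(2) by (auto simp: U_def)
  then obtain A where A: "finite A" "W \<subseteq> (\<Union>a\<in>A. U a)"
    using W opU by (metis compactE_image)
  obtain e :: "nat \<Rightarrow> 'a" and n where e: "A = e ` {i. i < n}"
    using finite_imp_nat_seg_image_inj_on[OF A(1)] by metis
  define idx where "idx w = (LEAST i. w \<in> U (e i))" for w
  have idx: "idx w < n" "w \<in> U (e (idx w))" if w: "w \<in> W" for w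
  proof -
    from w A e obtain i where i: "i < n" "w \<in> U (e i)" by auto
    show "w \<in> U (e (idx w))" unfolding idx_def using i(2) by (rule LeastI)
    have "idx w \<le> i" unfolding idx_def using i(2) by (rule Least_le)
    then show "idx w < n" using i by simp
  qed
  have fin: "finite (idx ` W)" using idx by (auto intro: finite_subset[of _ "{..<n}"])
  have "{w \<in> W. idx w = i} \<in> sets borel" for i
  proof -
    have "idx w = i \<longleftrightarrow> w \<in> U (e i) \<and> (\<forall>j<i. w \<notin> U (e j))" if "w \<in> W" for w
    proof
      assume "idx w = i"
      then show "w \<in> U (e i) \<and> (\<forall>j<i. w \<notin> U (e j))"
        using idx(2)[OF that] not_less_Least unfolding idx_def by blast
    next
      assume "w \<in> U (e i) \<and> (\<forall>j<i. w \<notin> U (e j))"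
      then show "idx w = i" unfolding idx_def by (intro Least_equality) (auto simp: not_less[symmetric])
    qed
    then have "{w \<in> W. idx w = i} = W \<inter> U (e i) - (\<Union>j<i. U (e j))" by auto
    also have "\<dots> \<in> sets borel"
      using opU W by (intro sets.Diff sets.Int sets.finite_UN) (auto intro: borel_closed compact_imp_closed)
    finally show ?thesis .
  qed
  with fin have fv: "finitely_valued W idx" by (simp add: finitely_valued_def)
  show ?thesis
  proof (rule that)
    show "finitely_valued W (\<lambda>w y. f (y + e (idx w)))"
      using finitely_valued_compose2[OF fv fv, of "\<lambda>i _ y. f (y + e i)"] .
    show "continuous_on UNIV (\<lambda>y. f (y + e (idx w)))" for w
      using f by (auto simp: compactly_supported_def intro!: continuous_on_compose2[of UNIV f] continuous_intros)
    fix w y assume "w \<in> W"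
    then have "- e (idx w) + w \<in> N" using idx by (simp add: U_def)
    from N(3)[OF this, of "y + e (idx w)"] show "norm (f (y + e (idx w)) - f (y + w)) \<le> \<epsilon>"
      by (simp add: add.assoc norm_minus_commute)
  qed
qed

text \<open>
  The approximations to \<open>w \<mapsto> (y \<mapsto> f(yw))\<close> are arranged as a telescoping series with geometric decay, so that
  integrals over \<open>w\<close> become absolutely convergent series of convolutions.
\<close>

lemma right_translates_finitely_valued_series:
  fixes f :: "'a::{topological_group_add,t2_space} \<Rightarrow> complex"
  assumes f: "compactly_supported f" and W: "compact W"
  obtains D and C :: real where "0 \<le> C" "\<And>n. finitely_valued W (D n)" "\<And>n w. continuous_on UNIV (D n w)"
    "\<And>n w y. w \<in> W \<Longrightarrow> norm (D n w y) \<le> C / 2 ^ n"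
    "\<And>w y. w \<in> W \<Longrightarrow> (\<lambda>n. D n w y) sums f (y + w)"
proof -
  obtain B where B: "0 < B" "\<And>x. norm (f x) \<le> B" using compactly_supported_bounded[OF f] by metis
  have "\<exists>\<phi>. finitely_valued W \<phi> \<and> (\<forall>w. continuous_on UNIV (\<phi> w)) \<and>
      (\<forall>w\<in>W. \<forall>y. norm (\<phi> w y - f (y + w)) \<le> 1 / 2 ^ n)" for n :: nat
    using right_translates_finitely_valued_approximation[OF f W, of "1 / 2 ^ n"] by (metis zero_less_divide_1_iff zero_less_numeral zero_less_power)
  then obtain \<phi> where \<phi>: "\<And>n. finitely_valued W (\<phi> n)" "\<And>n w. continuous_on UNIV (\<phi> n w)"
    "\<And>n w y. w \<in> W \<Longrightarrow> norm (\<phi> n w y - f (y + w)) \<le> 1 / 2 ^ n" by metis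
  \<comment> \<open>The initial value \<open>0\<close> makes the partial sums of the differences below equal to \<open>\<psi>\<close>.\<close>
  define \<psi> :: "nat \<Rightarrow> 'a \<Rightarrow> 'a \<Rightarrow> complex" where "\<psi> n = (case n of 0 \<Rightarrow> \<lambda>w y. 0 | Suc m \<Rightarrow> \<phi> m)" for n
  have fv: "finitely_valued W (\<psi> n)" for n
  proof (cases n)
    case 0
    have "finitely_valued W (\<lambda>w y. 0)"
      using finitely_valued_compose2[OF \<phi>(1) \<phi>(1), of "\<lambda>_ _ y. 0" 0 0] .
    then show ?thesis using 0 by (simp add: \<psi>_def)
  qed (simp add: \<psi>_def \<phi>(1))
  have cont: "continuous_on UNIV (\<psi> n w)" for n w
    by (cases n) (auto simp: \<psi>_def \<phi>(2))
  have err: "norm (\<psi> n w y - f (y + w)) \<le> (B + 2) / 2 ^ n" if w: "w \<in> W" for n w y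
  proof (cases n)
    case 0 then show ?thesis using B(2)[of "y + w"] by (simp add: \<psi>_def)
  next
    case (Suc m)
    have "1 / 2 ^ m \<le> (B + 2) / 2 ^ Suc m" using B(1) by (simp add: field_simps)
    then show ?thesis using \<phi>(3)[OF w, of m y] Suc by (simp add: \<psi>_def)
  qed
  define D where "D n w y = \<psi> (Suc n) w y - \<psi> n w y" for n w y
  show ?thesis
  proof (rule that[of "2 * (B + 2)" D])
    show "0 \<le> 2 * (B + 2)" using B by simp
    show "finitely_valued W (D n)" for n
      using finitely_valued_compose2[OF fv[of "Suc n"] fv[of n], of "\<lambda>b c y. b y - c y"]
      by (simp add: D_def[abs_def])
    show "continuous_on UNIV (D n w)" for n w
      using cont unfolding D_def[abs_def] by (intro continuous_intros) auto
    fix w y assume w: "w \<in> W"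
    show "norm (D n w y) \<le> 2 * (B + 2) / 2 ^ n" for n
    proof -
      have "norm (D n w y) \<le> norm (\<psi> (Suc n) w y - f (y + w)) + norm (\<psi> n w y - f (y + w))"
        unfolding D_def using norm_triangle_ineq4[of "\<psi> (Suc n) w y - f (y + w)" "\<psi> n w y - f (y + w)"] by simp
      also have "\<dots> \<le> (B + 2) / 2 ^ Suc n + (B + 2) / 2 ^ n" using err[OF w] by (intro add_mono)
      also have "\<dots> \<le> 2 * (B + 2) / 2 ^ n" using B(1) by (simp add: field_simps)
      finally show ?thesis .
    qed
    have "(\<lambda>n. (B + 2) * (1 / 2) ^ n) \<longlonglongrightarrow> 0"
      by (intro tendsto_mult_right_zero LIMSEQ_realpow_zero) auto
    then have lim: "(\<lambda>n. (B + 2) / 2 ^ n) \<longlonglongrightarrow> 0" by (simp add: power_divide)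
    have ev: "eventually (\<lambda>n. norm (\<psi> n w y - f (y + w)) \<le> (B + 2) / 2 ^ n) sequentially"
      using err[OF w] by (intro always_eventually allI)
    have "(\<lambda>n. \<psi> n w y - f (y + w)) \<longlonglongrightarrow> 0"
      by (rule Lim_null_comparison[OF ev lim])
    then have "(\<lambda>n. \<psi> n w y) \<longlonglongrightarrow> f (y + w)" by (simp add: LIM_zero_iff)
    from telescope_sums[OF this] show "(\<lambda>n. D n w y) sums f (y + w)"
      by (simp add: D_def \<psi>_def)
  qed
qed

context haar_group
begin

lemma continuous_integral_translates:
  fixes g :: "'a \<Rightarrow> complex" and \<phi> :: "'a \<Rightarrow> complex"
  assumes g: "compactly_supported g" and \<phi>: "integrable M \<phi>"
  shows "integrable M (\<lambda>w. \<phi> w * g (s + w))"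
    and "continuous_on UNIV (\<lambda>s. LINT w|M. \<phi> w * g (s + w))"
proof -
  obtain B where B: "0 < B" "\<And>x. norm (g x) \<le> B" using compactly_supported_bounded[OF g] by metis
  have [measurable]: "(\<lambda>w. g (s + w)) \<in> borel_measurable M" for s
    using compactly_supported_add_left[OF g, of s]
    by (intro continuous_imp_measurable) (simp add: compactly_supported_def)
  have [measurable]: "\<phi> \<in> borel_measurable M" using \<phi> by auto
  show int: "integrable M (\<lambda>w. \<phi> w * g (s + w))" for s
  proof (rule integrable_dominated)
    show "integrable M (\<lambda>w. norm (\<phi> w) * B)" using \<phi> by simp
    show "norm (\<phi> w * g (s + w)) \<le> norm (\<phi> w) * B" for w
      using B(2) by (simp add: norm_mult mult_left_mono)
  qed measurable
  define I where "I = (LINT w|M. norm (\<phi> w))"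
  have I: "0 \<le> I" by (simp add: I_def)
  show "continuous_on UNIV (\<lambda>s. LINT w|M. \<phi> w * g (s + w))"
    unfolding continuous_on_def
  proof (intro ballI tendstoI)
    fix s :: 'a and \<epsilon> :: real assume "0 < \<epsilon>"
    then have "0 < \<epsilon> / (I + 1)" using I by simp
    then obtain N where N: "open N" "0 \<in> N" "\<And>m y. m \<in> N \<Longrightarrow> norm (g (m + y) - g y) < \<epsilon> / (I + 1)"
      using left_uniformly_continuous[OF g] by metis
    have "open ((\<lambda>x. x - s) -` N)" using N(1) by (intro open_vimage continuous_intros) auto
    then have "eventually (\<lambda>x. x \<in> (\<lambda>x. x - s) -` N) (at s)"
      using N(2) by (intro eventually_at_topological[THEN iffD2]) auto
    then show "eventually (\<lambda>x. dist (LINT w|M. \<phi> w * g (x + w)) (LINT w|M. \<phi> w * g (s + w)) < \<epsilon>) (at s)"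
    proof eventually_elim
      case (elim x)
      then have m: "x - s \<in> N" by simp
      have le: "norm (\<phi> w * g (x + w) - \<phi> w * g (s + w)) \<le> norm (\<phi> w) * (\<epsilon> / (I + 1))" for w
      proof -
        have "norm (g ((x - s) + (s + w)) - g (s + w)) < \<epsilon> / (I + 1)" using N(3)[OF m] .
        then have "norm (g (x + w) - g (s + w)) \<le> \<epsilon> / (I + 1)" by (simp add: add.assoc[symmetric])
        from mult_left_mono[OF this norm_ge_zero[of "\<phi> w"]] show ?thesis
          by (simp add: right_diff_distrib[symmetric] norm_mult)
      qed
      have "norm ((LINT w|M. \<phi> w * g (x + w)) - (LINT w|M. \<phi> w * g (s + w))) =
          norm (LINT w|M. \<phi> w * g (x + w) - \<phi> w * g (s + w))"
        using int by simp
      also have "\<dots> \<le> (LINT w|M. norm (\<phi> w * g (x + w) - \<phi> w * g (s + w)))"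
        by (rule integral_norm_bound)
      also have "\<dots> \<le> (LINT w|M. norm (\<phi> w) * (\<epsilon> / (I + 1)))"
        using int \<phi> le by (intro integral_mono) auto
      also have "\<dots> = I * (\<epsilon> / (I + 1))" by (simp add: I_def)
      also have "\<dots> < \<epsilon>" using \<open>0 < \<epsilon>\<close> I by (simp add: field_simps)
      finally show ?case by (simp add: dist_norm)
    qed
  qed
qed

text \<open>
  With \<open>D w y\<close> in place of \<open>f(yw)\<close>, this is \<open>\<integral>\<^sub>W f(yw) g(y'w)\<^sup>- dw\<close>, which equals \<open>(f * g~)(y y'\<inverse>)\<close> when
  \<open>W\<close> contains the support of \<open>w \<mapsto> f(yw)\<close>.
\<close>

definition kernel :: "'a set \<Rightarrow> ('a \<Rightarrow> 'a \<Rightarrow> complex) \<Rightarrow> ('a \<Rightarrow> complex) \<Rightarrow> 'a \<Rightarrow> 'a \<Rightarrow> complex" where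
  "kernel W D g y y' = (LINT w|M. indicator W w * D w y * cnj (g (y' + w)))"

definition cell_integral :: "'a set \<Rightarrow> ('a \<Rightarrow> 'b) \<Rightarrow> ('a \<Rightarrow> complex) \<Rightarrow> 'b \<Rightarrow> 'a \<Rightarrow> complex" where
  "cell_integral W D g a y = (LINT w|M. indicator {w \<in> W. D w = a} w * g (y + w))"

lemma integrable_indicator_compact:
  assumes "E \<in> sets borel" "E \<subseteq> W" "compact W"
  shows "integrable M (indicator E :: 'a \<Rightarrow> real)" "integrable M (indicator E :: 'a \<Rightarrow> complex)"
proof -
  have "emeasure M E \<le> emeasure M W" using assms by (intro emeasure_mono) (auto simp: compact_in_sets)
  then have "emeasure M E < \<infinity>" using emeasure_compact[OF assms(3)] by (rule le_less_trans)
  then show i: "integrable M (indicator E :: 'a \<Rightarrow> real)"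
    using assms(1) by (intro integrable_real_indicator) auto
  have "(indicator E :: 'a \<Rightarrow> complex) = (\<lambda>x. complex_of_real (indicator E x))"
    by (simp add: fun_eq_iff indicator_def)
  then show "integrable M (indicator E :: 'a \<Rightarrow> complex)"
    using integrable_of_real[OF i] by metis
qed

lemma cell_integral_props:
  assumes g: "compactly_supported g" and W: "compact W" and D: "finitely_valued W D"
    and B: "\<And>x. norm (g x) \<le> B"
  shows "continuous_on UNIV (cell_integral W D g a)"
    and "norm (cell_integral W D g a y) \<le> B * measure M {w \<in> W. D w = a}"
    and "integrable M (\<lambda>w. indicator {w \<in> W. D w = a} w * g (y + w))"
proof -
  let ?E = "{w \<in> W. D w = a}"
  have E: "?E \<in> sets borel" using D by (simp add: finitely_valued_def)
  have i: "integrable M (indicator ?E :: 'a \<Rightarrow> complex)" by (rule integrable_indicator_compact(2)[OF E _ W]) auto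
  note * = continuous_integral_translates[OF g i]
  show "continuous_on UNIV (cell_integral W D g a)"
    unfolding cell_integral_def[abs_def] by (rule *(2))
  show int: "integrable M (\<lambda>w. indicator ?E w * g (y + w))" by (rule *(1))
  have ir: "integrable M (indicator ?E :: 'a \<Rightarrow> real)"
    by (rule integrable_indicator_compact(1)[OF E _ W]) auto
  have "norm (cell_integral W D g a y) \<le> (LINT w|M. norm (indicator ?E w * g (y + w)))"
    unfolding cell_integral_def by (rule integral_norm_bound)
  also have "\<dots> \<le> (LINT w|M. indicator ?E w * B)"
  proof (rule integral_mono)
    show "norm (indicator ?E w * g (y + w)) \<le> indicator ?E w * B" for w
      using B by (simp add: indicator_def)
  qed (use int ir in \<open>simp_all only: integrable_norm integrable_mult_left\<close>)
  also have "\<dots> = B * measure M ?E" using E by simp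
  finally show "norm (cell_integral W D g a y) \<le> B * measure M ?E" .
qed

text \<open>
  A finitely valued \<open>D\<close> makes the kernel a finite sum of products of a function of \<open>y\<close> and a function of \<open>y'\<close>.
\<close>

lemma kernel_eq_sum:
  assumes g: "compactly_supported g" and W: "compact W" and D: "finitely_valued W D"
  shows "kernel W D g y y' = (\<Sum>a\<in>D ` W. a y * cnj (cell_integral W D g a y'))"
proof -
  obtain B where B: "\<And>x. norm (g x) \<le> B" using compactly_supported_bounded[OF g] by metis
  note int = cell_integral_props(3)[OF g W D B]
  have "indicator W w * D w y * cnj (g (y' + w)) =
      (\<Sum>a\<in>D ` W. a y * cnj (indicator {w \<in> W. D w = a} w * g (y' + w)))" for w
  proof (cases "w \<in> W")
    case True
    have "(\<Sum>a\<in>D ` W. a y * cnj (indicator {w \<in> W. D w = a} w * g (y' + w))) =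
        (\<Sum>a\<in>D ` W. if a = D w then D w y * cnj (g (y' + w)) else 0)"
      using True by (intro sum.cong) auto
    also have "\<dots> = D w y * cnj (g (y' + w))"
      using True D by (simp add: finitely_valued_def)
    finally show ?thesis using True by simp
  qed simp
  then have "kernel W D g y y' = (\<Sum>a\<in>D ` W. LINT w|M. a y * cnj (indicator {w \<in> W. D w = a} w * g (y' + w)))"
    unfolding kernel_def using int
    by (simp only:) (intro Bochner_Integration.integral_sum integrable_mult_right integrable_cnj)
  also have "\<dots> = (\<Sum>a\<in>D ` W. a y * cnj (cell_integral W D g a y'))"
    unfolding cell_integral_def by (simp only: integral_mult_right_zero Bochner_Integration.integral_cnj)
  finally show ?thesis .
qed

end

context Lp_group
begin

text \<open>
  Splitting the kernel into its product terms writes the function as a finite sum of convolutions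
  \<open>h' * k'~\<close>. The measures of the cells of \<open>D\<close> add up to the measure of \<open>W\<close>, so the bound depends on \<open>D\<close> only
  through its supremum.
\<close>

lemma Ap_bounded_by_kernel:
  assumes g: "compactly_supported g" and B: "\<And>x. norm (g x) \<le> B"
    and W: "compact W" and D: "finitely_valued W D"
    and D_meas: "\<And>w. D w \<in> borel_measurable M" and \<delta>: "0 \<le> \<delta>" "\<And>w y. w \<in> W \<Longrightarrow> norm (D w y) \<le> \<delta>"
    and h: "h \<in> Lp_space M p" and k: "k \<in> Lp_space M q"
  shows "Ap_bounded_by M p (\<lambda>x. LINT z|M. h z * cnj (k (- x + z)) * kernel W D g (z - t) (- x + z - t))
      (\<delta> * B * measure M W * (Lp_norm M p h * Lp_norm M q k))"
    and "integrable M (\<lambda>z. h z * cnj (k (- x + z)) * kernel W D g (z - t) (- x + z - t))"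
    and "norm (kernel W D g y y') \<le> \<delta> * B * measure M W"
proof -
  have B0: "0 \<le> B" using B[of 0] norm_ge_zero[of "g 0"] by linarith
  note avg = cell_integral_props[OF g W D B]
  let ?E = "\<lambda>a. {w \<in> W. D w = a}"
  have fin: "finite (D ` W)" and E: "\<And>a. ?E a \<in> sets borel" using D by (auto simp: finitely_valued_def)
  define h' where "h' a z = h z * a (z - t)" for a z
  \<comment> \<open>The cell of \<open>a\<close> contributes the convolution of these two functions.\<close>
  define k' where "k' a z = k z * cell_integral W D g a (z - t)" for a z
  have measW: "(\<Sum>a\<in>D ` W. measure M (?E a)) = measure M W"
  proof -
    have "measure M (\<Union>a\<in>D ` W. ?E a) = (\<Sum>a\<in>D ` W. measure M (?E a))"
    proof (rule measure_finite_Union[OF fin])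
      have "emeasure M (?E a) \<le> emeasure M W" for a
        using W by (intro emeasure_mono) (auto simp: compact_in_sets)
      then show "emeasure M (?E a) \<noteq> \<infinity>" for a
        using emeasure_compact[OF W] by (metis less_irrefl infinity_ennreal_def neq_top_trans top.not_eq_extremum)
    qed (use E in \<open>auto simp: disjoint_family_on_def\<close>)
    moreover have "(\<Union>a\<in>D ` W. ?E a) = W" by auto
    ultimately show ?thesis by simp
  qed
  have hm: "h \<in> borel_measurable M" and km: "k \<in> borel_measurable M" using h k by (auto intro: Lp_measurable)
  have D_meas': "(\<lambda>z. a (z - t)) \<in> borel_measurable M" if "a \<in> D ` W" for a
    using measurable_compose[OF right_translation_measurable[of t], of a borel] D_meas that by auto
  have avg_meas: "(\<lambda>z. cell_integral W D g a (z - t)) \<in> borel_measurable M" for a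
    using measurable_compose[OF right_translation_measurable[of t] continuous_imp_measurable[OF avg(1)[of a]]] .
  have h': "h' a \<in> Lp_space M p" "Lp_norm M p (h' a) \<le> \<delta> * Lp_norm M p h" if a: "a \<in> D ` W" for a
  proof -
    have m: "h' a \<in> borel_measurable M"
      unfolding h'_def[abs_def] by (intro borel_measurable_times hm D_meas' a)
    have le: "norm (h' a z) \<le> \<delta> * norm (h z)" for z
    proof -
      have "norm (a (z - t)) \<le> \<delta>" using \<delta>(2)[of _ "z - t"] a by auto
      from mult_right_mono[OF this norm_ge_zero[of "h z"]] show ?thesis
        by (simp add: h'_def norm_mult mult.commute)
    qed
    have "0 < p" using p by simp
    from Lp_dominated[OF h m this \<delta>(1) le]
    show "h' a \<in> Lp_space M p" "Lp_norm M p (h' a) \<le> \<delta> * Lp_norm M p h" by auto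
  qed
  have k': "k' a \<in> Lp_space M q" "Lp_norm M q (k' a) \<le> B * measure M (?E a) * Lp_norm M q k" for a
  proof -
    have m: "k' a \<in> borel_measurable M"
      unfolding k'_def[abs_def] by (intro borel_measurable_times km avg_meas)
    have le: "norm (k' a z) \<le> B * measure M (?E a) * norm (k z)" for z
      using mult_right_mono[OF avg(2)[of a "z - t"] norm_ge_zero[of "k z"]]
      by (simp add: k'_def norm_mult mult.commute)
    have "0 < q" "0 \<le> B * measure M (?E a)" using q B0 by auto
    from Lp_dominated[OF k m this le]
    show "k' a \<in> Lp_space M q" "Lp_norm M q (k' a) \<le> B * measure M (?E a) * Lp_norm M q k" by auto
  qed
  have eq: "h z * cnj (k (- x + z)) * kernel W D g (z - t) (- x + z - t) =
      (\<Sum>a\<in>D ` W. h' a z * cnj (k' a (- x + z)))" for x z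
    unfolding kernel_eq_sum[OF g W D] sum_distrib_left h'_def k'_def
    by (intro sum.cong refl) (simp add: algebra_simps)
  have int: "integrable M (\<lambda>z. h' a z * cnj (k' a (- x + z)))" if "a \<in> D ` W" for a x
    using convolution_integrable[OF p h'(1)[OF that]] k'(1) by (simp add: q_def)
  show "integrable M (\<lambda>z. h z * cnj (k (- x + z)) * kernel W D g (z - t) (- x + z - t))"
    unfolding eq by (intro Bochner_Integration.integrable_sum int)
  have *: "(LINT z|M. h z * cnj (k (- x + z)) * kernel W D g (z - t) (- x + z - t)) =
      (\<Sum>a\<in>D ` W. convolution M (h' a) (tilde (k' a)) x)" for x
    unfolding eq convolution_tilde by (intro Bochner_Integration.integral_sum int)
  have "Ap_bounded_by M p (convolution M (h' a) (tilde (k' a)))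
      (\<delta> * B * measure M (?E a) * (Lp_norm M p h * Lp_norm M q k))" if a: "a \<in> D ` W" for a
  proof (rule Ap_bounded_by_mono[OF Ap_bounded_by_convolution[OF h'(1)[OF a] k'(1)]])
    have "Lp_norm M p (h' a) * Lp_norm M q (k' a) \<le>
        (\<delta> * Lp_norm M p h) * (B * measure M (?E a) * Lp_norm M q k)"
      by (intro mult_mono h'(2)[OF a] k'(2) mult_nonneg_nonneg Lp_norm_nonneg \<delta>(1))
    then show "Lp_norm M p (h' a) * Lp_norm M q (k' a) \<le>
        \<delta> * B * measure M (?E a) * (Lp_norm M p h * Lp_norm M q k)"
      by (simp only: mult_ac)
  qed
  then have "Ap_bounded_by M p (\<lambda>x. \<Sum>a\<in>D ` W. convolution M (h' a) (tilde (k' a)) x)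
      (\<Sum>a\<in>D ` W. \<delta> * B * measure M (?E a) * (Lp_norm M p h * Lp_norm M q k))"
    by (intro Ap_bounded_by_sum fin)
  also have "(\<Sum>a\<in>D ` W. \<delta> * B * measure M (?E a) * (Lp_norm M p h * Lp_norm M q k)) =
      \<delta> * B * measure M W * (Lp_norm M p h * Lp_norm M q k)"
    unfolding measW[symmetric] sum_distrib_left sum_distrib_right by (simp add: mult_ac)
  finally show "Ap_bounded_by M p (\<lambda>x. LINT z|M. h z * cnj (k (- x + z)) * kernel W D g (z - t) (- x + z - t))
      (\<delta> * B * measure M W * (Lp_norm M p h * Lp_norm M q k))" unfolding * .
  have "norm (kernel W D g y y') \<le> (\<Sum>a\<in>D ` W. norm (a y * cnj (cell_integral W D g a y')))"
    unfolding kernel_eq_sum[OF g W D] by (rule norm_sum)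
  also have "\<dots> \<le> (\<Sum>a\<in>D ` W. \<delta> * (B * measure M (?E a)))"
  proof (rule sum_mono)
    fix a assume a: "a \<in> D ` W"
    have "norm (a y) \<le> \<delta>" using \<delta>(2) a by auto
    then show "norm (a y * cnj (cell_integral W D g a y')) \<le> \<delta> * (B * measure M (?E a))"
      unfolding norm_mult complex_mod_cnj by (intro mult_mono avg(2) \<delta>(1)) auto
  qed
  also have "\<dots> = \<delta> * B * measure M W"
    unfolding measW[symmetric] sum_distrib_left by (simp add: mult_ac)
  finally show "norm (kernel W D g y y') \<le> \<delta> * B * measure M W" .
qed

text \<open>
  The substitution by \<open>y\<close> in the integral defining \<open>(f * g~)(x)\<close>, followed by expanding \<open>f(yw)\<close> into the
  series of finitely valued functions.
\<close>

lemma coefficient_kernel_series: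
  assumes f: "compactly_supported f" and g: "compactly_supported g" and W: "compact W"
    and supp: "\<And>w. f (y + w) \<noteq> 0 \<Longrightarrow> w \<in> W"
    and D: "\<And>n. finitely_valued W (D n)" "\<And>n w. D n w \<in> borel_measurable M" "0 \<le> C"
      "\<And>n w y. w \<in> W \<Longrightarrow> norm (D n w y) \<le> C / 2 ^ n"
      "\<And>w y. w \<in> W \<Longrightarrow> (\<lambda>n. D n w y) sums f (y + w)"
  shows "(\<lambda>n. kernel W (D n) g y (- x + y)) sums convolution M f (tilde g) x"
proof -
  obtain B where B: "0 < B" "\<And>x. norm (g x) \<le> B" using compactly_supported_bounded[OF g] by metis
  let ?I = "\<lambda>n w. indicator W w * D n w y * cnj (g (- x + y + w))"
  have iW: "integrable M (indicator W :: 'a \<Rightarrow> real)"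
    by (rule integrable_indicator_compact(1)[OF compact_in_sets[OF W] subset_refl W])
  have le: "norm (?I n w) \<le> indicator W w * (C / 2 ^ n * B)" for n w
  proof (cases "w \<in> W")
    case True
    then show ?thesis
      using mult_mono[OF D(4)[OF True, of n y] B(2)[of "- x + y + w"]] D(3)
      by (simp add: norm_mult)
  qed simp
  have gm: "(\<lambda>w. g (- x + y + w)) \<in> borel_measurable M"
    using compactly_supported_add_left[OF g, of "- x + y"]
    by (intro continuous_imp_measurable) (simp add: compactly_supported_def)
  have m: "?I n \<in> borel_measurable M" for n
  proof -
    have "indicator W w * D n w y = (\<Sum>a\<in>D n ` W. indicator {w \<in> W. D n w = a} w * a y)" for w
    proof (cases "w \<in> W")
      case True
      have "(\<Sum>a\<in>D n ` W. indicator {w \<in> W. D n w = a} w * a y) = (\<Sum>a\<in>D n ` W. if a = D n w then D n w y else 0)"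
        using True by (intro sum.cong) auto
      then show ?thesis using True D(1)[of n] by (simp add: finitely_valued_def)
    qed simp
    moreover have "(\<lambda>w. \<Sum>a\<in>D n ` W. indicator {w \<in> W. D n w = a} w * a y) \<in> borel_measurable M"
      using D(1)[of n] by (intro borel_measurable_sum borel_measurable_times borel_measurable_indicator)
        (auto simp: finitely_valued_def)
    ultimately have "(\<lambda>w. indicator W w * D n w y) \<in> borel_measurable M" by simp
    from borel_measurable_times[OF this borel_measurable_cnj[OF gm]] show ?thesis .
  qed
  have int: "integrable M (?I n)" for n
    by (rule integrable_dominated[OF integrable_mult_left[OF iW] m[of n]]) (rule le)
  have geo: "summable (\<lambda>n. C / 2 ^ n * B)"
    using summable_mult[OF summable_geometric[of "1 / 2 :: real"], of "C * B"] by (simp add: power_divide mult_ac)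
  have sn: "summable (\<lambda>n. norm (?I n w))" for w
  proof (rule summable_comparison_test'[OF geo, of 0])
    fix n :: nat
    have 1: "norm (?I n w) \<le> indicator W w * (C / 2 ^ n * B)" by (rule le)
    have "indicator W w * (C / 2 ^ n * B) \<le> C / 2 ^ n * B" using B D(3) by (auto simp: indicator_def)
    then show "norm (norm (?I n w)) \<le> C / 2 ^ n * B" using order_trans[OF 1] by (simp only: real_norm_def abs_norm_cancel)
  qed
  have sI: "summable (\<lambda>n. LINT w|M. norm (?I n w))"
  proof (rule summable_comparison_test'[OF summable_mult[OF geo, of "measure M W"], of 0])
    fix n
    have "(LINT w|M. norm (?I n w)) \<le> (LINT w|M. indicator W w * (C / 2 ^ n * B))"
      by (intro integral_mono integrable_norm int le integrable_mult_left iW)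
    also have "\<dots> = measure M W * (C / 2 ^ n * B)" using compact_in_sets[OF W] by simp
    finally show "norm (LINT w|M. norm (?I n w)) \<le> measure M W * (C / 2 ^ n * B)" by simp
  qed
  have "(\<lambda>n. integral\<^sup>L M (?I n)) sums (LINT w|M. (\<Sum>n. ?I n w))"
    by (intro sums_integral int sI AE_I2 sn)
  moreover have "(\<Sum>n. ?I n w) = f (y + w) * cnj (g (- x + y + w))" for w
  proof (cases "w \<in> W")
    case True
    have "(\<lambda>n. ?I n w) sums (f (y + w) * cnj (g (- x + y + w)))"
      using sums_mult2[OF D(5)[OF True, of y]] True by simp
    then show ?thesis by (simp add: sums_iff)
  next
    case False
    then have "f (y + w) = 0" using supp by blast
    then show ?thesis using False by simp
  qed
  moreover have "(LINT w|M. f (y + w) * cnj (g (- x + y + w))) = convolution M f (tilde g) x"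
  proof -
    have "f \<in> borel_measurable M" using f by (intro continuous_imp_measurable) (simp add: compactly_supported_def)
    moreover have "(\<lambda>w. g (- x + w)) \<in> borel_measurable M"
      using compactly_supported_add_left[OF g, of "- x"]
      by (intro continuous_imp_measurable) (simp add: compactly_supported_def)
    ultimately show ?thesis
      using integral_translation[of "\<lambda>w. f w * cnj (g (- x + w))" y]
      by (simp add: convolution_tilde add.assoc)
  qed
  ultimately show ?thesis by (simp add: kernel_def)
qed

text \<open>
  Multiplication by \<open>f * g~\<close> on convolutions \<open>h * k~\<close> with \<open>h\<close> supported in \<open>Vt\<close>. For \<open>z \<in> Vt\<close> the
  substitution by \<open>z t\<inverse> \<in> V\<close> confines \<open>w\<close> to a compact set that does not depend on \<open>t\<close>, so the constant is uniform
  in \<open>t\<close>.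
\<close>

lemma Ap_bounded_by_local_product:
  assumes f: "compactly_supported f" and g: "compactly_supported g" and V: "compact V"
  obtains C where "0 \<le> C" "\<And>t h k. h \<in> Lp_space M p \<Longrightarrow> k \<in> Lp_space M q \<Longrightarrow>
      (\<And>z. z \<notin> translates V t \<Longrightarrow> h z = 0) \<Longrightarrow>
      Ap_bounded_by M p (\<lambda>x. convolution M f (tilde g) x * convolution M h (tilde k) x)
        (C * (Lp_norm M p h * Lp_norm M q k))"
proof -
  obtain K where K: "compact K" "\<And>x. x \<notin> K \<Longrightarrow> f x = 0" using f by (auto simp: compactly_supported_def)
  \<comment> \<open>\<open>f(vw) \<noteq> 0\<close> with \<open>v \<in> V\<close> forces \<open>w \<in> V\<inverse>K\<close>.\<close>
  define W where "W = (\<lambda>(v, y). - v + y) ` (V \<times> K)"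
  have W: "compact W" unfolding W_def by (rule compact_diff[OF V K(1)])
  obtain B where B: "0 < B" "\<And>x. norm (g x) \<le> B" using compactly_supported_bounded[OF g] by metis
  obtain D and C :: real where C: "0 \<le> C" and D: "\<And>n. finitely_valued W (D n)"
    "\<And>n w. continuous_on UNIV (D n w)" "\<And>n w y. w \<in> W \<Longrightarrow> norm (D n w y) \<le> C / 2 ^ n"
    "\<And>w y. w \<in> W \<Longrightarrow> (\<lambda>n. D n w y) sums f (y + w)"
    using right_translates_finitely_valued_series[OF f W] by metis
  have Dm: "D n w \<in> borel_measurable M" for n w by (rule continuous_imp_measurable[OF D(2)])
  show ?thesis
  proof (rule that)
    define C' where "C' = 2 * (C * B * measure M W)"
    show "0 \<le> C'" using B C by (simp add: C'_def)
    fix t h k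
    assume h: "h \<in> Lp_space M p" and k: "k \<in> Lp_space M q"
      and supp: "\<And>z. z \<notin> translates V t \<Longrightarrow> h z = 0"
    have Cn: "0 \<le> C / 2 ^ n" for n using C by simp
    note ker = Ap_bounded_by_kernel[OF g B(2) W D(1) Dm Cn D(3) h k]
    define u where "u n x = (LINT z|M. h z * cnj (k (- x + z)) * kernel W (D n) g (z - t) (- x + z - t))" for n x
    define c where "c n = C / 2 ^ n * B * measure M W * (Lp_norm M p h * Lp_norm M q k)" for n :: nat
    have c: "c sums (C' * (Lp_norm M p h * Lp_norm M q k))"
    proof -
      have "(\<lambda>n. (C * B * measure M W * (Lp_norm M p h * Lp_norm M q k)) * (1 / 2) ^ n) sums
          ((C * B * measure M W * (Lp_norm M p h * Lp_norm M q k)) * (1 / (1 - 1 / 2)))"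
        by (intro sums_mult geometric_sums) simp
      then show ?thesis by (simp add: c_def[abs_def] C'_def power_divide mult_ac)
    qed
    have "(\<lambda>n. u n x) sums (convolution M f (tilde g) x * convolution M h (tilde k) x)" for x
    proof -
      let ?J = "\<lambda>n z. h z * cnj (k (- x + z)) * kernel W (D n) g (z - t) (- x + z - t)"
      let ?h = "\<lambda>z. h z * cnj (k (- x + z))"
      have ih: "integrable M ?h" using convolution_integrable[OF p h] k by (simp add: q_def)
      have le: "norm (?J n z) \<le> norm (?h z) * (C / 2 ^ n * B * measure M W)" for n z
        unfolding norm_mult[of "?h z"] by (intro mult_left_mono ker(3) norm_ge_zero)
      have geo: "summable (\<lambda>n. C / 2 ^ n * B * measure M W)"
        using summable_mult[OF summable_geometric[of "1 / 2 :: real"], of "C * B * measure M W"]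
        by (simp add: power_divide mult_ac)
      have "(\<lambda>n. integral\<^sup>L M (?J n)) sums (LINT z|M. (\<Sum>n. ?J n z))"
      proof (rule sums_integral[OF ker(2)])
        show "AE z in M. summable (\<lambda>n. norm (?J n z))"
          using le by (intro AE_I2 summable_comparison_test'[OF summable_mult[OF geo], of 0]) simp
        show "summable (\<lambda>n. LINT z|M. norm (?J n z))"
        proof (rule summable_comparison_test'[OF summable_mult[OF geo, of "LINT z|M. norm (?h z)"], of 0])
          fix n
          have "(LINT z|M. norm (?J n z)) \<le> (LINT z|M. norm (?h z) * (C / 2 ^ n * B * measure M W))"
            by (intro integral_mono integrable_norm ker(2) le integrable_mult_left ih)
          also have "\<dots> = (LINT z|M. norm (?h z)) * (C / 2 ^ n * B * measure M W)" by simp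
          finally show "norm (LINT z|M. norm (?J n z)) \<le> (LINT z|M. norm (?h z)) * (C / 2 ^ n * B * measure M W)"
            by simp
        qed
      qed
      moreover have "(\<Sum>n. ?J n z) = convolution M f (tilde g) x * ?h z" for z
      proof (cases "z \<in> translates V t")
        case True
        have "w \<in> W" if "f (z - t + w) \<noteq> 0" for w
        proof -
          have "z - t \<in> V" "z - t + w \<in> K" using True K(2) that by (auto simp: in_translates_iff)
          then have "- (z - t) + (z - t + w) \<in> W" unfolding W_def by force
          then show ?thesis by (simp only: minus_add_cancel)
        qed
        from coefficient_kernel_series[OF f g W this D(1) Dm C D(3,4), of "z - t" x]
        have "(\<lambda>n. kernel W (D n) g (z - t) (- x + z - t)) sums convolution M f (tilde g) x"
          by (simp add: add_diff_eq)
        from sums_mult[OF this, of "?h z"] show ?thesis by (simp add: sums_iff mult.commute)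
      qed (simp add: supp)
      moreover have "(LINT z|M. convolution M f (tilde g) x * ?h z) =
          convolution M f (tilde g) x * convolution M h (tilde k) x"
        by (simp only: integral_mult_right_zero convolution_tilde[of h k x])
      ultimately show ?thesis by (simp only: u_def)
    qed
    moreover have "Ap_bounded_by M p (u n) (c n)" for n
      unfolding u_def c_def by (rule ker(1))
    ultimately show "Ap_bounded_by M p (\<lambda>x. convolution M f (tilde g) x * convolution M h (tilde k) x)
        (C' * (Lp_norm M p h * Lp_norm M q k))"
      using Ap_bounded_by_sums[of u c] c by (simp add: sums_iff)
  qed
qed

end

context Lp_group
begin

lemma sum_Lp_norm_powr_overlap:
  assumes k: "k \<in> Lp_space M r" and r: "0 < r" and R: "\<And>j. R j \<in> sets borel"
    and overlap: "\<And>z. (\<Sum>j<n. indicator (R j) z) \<le> (m :: real)"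
  shows "(\<Sum>j<n. Lp_norm M r (\<lambda>z. indicator (R j) z * k z) powr r) \<le> m * Lp_norm M r k powr r"
proof -
  have i: "integrable M (\<lambda>z. norm (k z) powr r)" using k by (simp add: Lp_space_def)
  have eq: "norm (indicator (R j) z * k z) powr r = indicator (R j) z * norm (k z) powr r" for j z
    by (simp add: indicator_def)
  have int: "integrable M (\<lambda>z. indicator (R j) z * norm (k z) powr r)" for j
    using integrable_mult_indicator[OF _ i, of "R j"] R by simp
  have "(\<Sum>j<n. Lp_norm M r (\<lambda>z. indicator (R j) z * k z) powr r) =
      (LINT z|M. (\<Sum>j<n. indicator (R j) z * norm (k z) powr r))"
    using int by (simp only: Lp_norm_powr[OF r] eq Bochner_Integration.integral_sum)
  also have "\<dots> \<le> (LINT z|M. m * norm (k z) powr r)"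
    using int i overlap
    by (intro integral_mono Bochner_Integration.integrable_sum integrable_mult_right)
      (simp_all add: sum_distrib_right[symmetric] mult_right_mono)
  also have "\<dots> = m * Lp_norm M r k powr r" using i by (simp add: Lp_norm_powr[OF r])
  finally show ?thesis .
qed

text \<open>
  Discrete Hoelder inequality for pieces of \<open>h\<close> and \<open>k\<close>, obtained from Young's inequality after normalisation; the
  constant \<open>1 + m\<close> is cruder than the optimal one and suffices.
\<close>

lemma sum_mult_Lp_norms_le:
  assumes h: "h \<in> Lp_space M p" and k: "k \<in> Lp_space M q"
    and E: "\<And>j. E j \<in> sets borel" and R: "\<And>j. R j \<in> sets borel"
    and E_overlap: "\<And>z. (\<Sum>j<n. indicator (E j) z) \<le> (1 :: real)"
    and R_overlap: "\<And>z. (\<Sum>j<n. indicator (R j) z) \<le> (m :: real)"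
  shows "(\<Sum>j<n. Lp_norm M p (\<lambda>z. indicator (E j) z * h z) * Lp_norm M q (\<lambda>z. indicator (R j) z * k z))
      \<le> (1 + m) * (Lp_norm M p h * Lp_norm M q k)"
proof -
  let ?a = "\<lambda>j. Lp_norm M p (\<lambda>z. indicator (E j) z * h z)"
  let ?b = "\<lambda>j. Lp_norm M q (\<lambda>z. indicator (R j) z * k z)"
  let ?\<alpha> = "Lp_norm M p h" and ?\<beta> = "Lp_norm M q k"
  have p0: "0 < p" "0 < q" using p q by auto
  have a: "?a j \<le> ?\<alpha>" for j
  proof -
    have "(\<lambda>z. indicator (E j) z * h z) \<in> borel_measurable M"
      using E Lp_measurable[OF h] by (intro borel_measurable_times) auto
    from Lp_dominated(2)[OF h this p0(1), of 1] show ?thesis by (simp add: indicator_def)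
  qed
  have b: "?b j \<le> ?\<beta>" for j
  proof -
    have "(\<lambda>z. indicator (R j) z * k z) \<in> borel_measurable M"
      using R Lp_measurable[OF k] by (intro borel_measurable_times) auto
    from Lp_dominated(2)[OF k this p0(2), of 1] show ?thesis by (simp add: indicator_def)
  qed
  have nn: "0 \<le> ?a j" "0 \<le> ?b j" "0 \<le> ?\<alpha>" "0 \<le> ?\<beta>" for j by (simp_all add: Lp_norm_nonneg)
  show ?thesis
  proof (cases "?\<alpha> = 0 \<or> ?\<beta> = 0")
    case True
    then have "?a j * ?b j = 0" for j using a[of j] b[of j] nn(1,2)[of j] by auto
    then have "(\<Sum>j<n. ?a j * ?b j) = 0" by (intro sum.neutral ballI)
    then show ?thesis using True by auto
  next
    case False
    then have pos: "0 < ?\<alpha>" "0 < ?\<beta>" using nn by auto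
    have "?a j * ?b j \<le> ?\<alpha> * ?\<beta> * (?a j powr p / ?\<alpha> powr p + ?b j powr q / ?\<beta> powr q)" for j
    proof -
      have "(?a j / ?\<alpha>) * (?b j / ?\<beta>) \<le> (?a j / ?\<alpha>) powr p / p + (?b j / ?\<beta>) powr q / q"
        using p q pos nn by (intro Youngs_inequality) auto
      also have "\<dots> \<le> (?a j / ?\<alpha>) powr p / 1 + (?b j / ?\<beta>) powr q / 1"
        using p q by (intro add_mono divide_left_mono) auto
      also have "\<dots> = ?a j powr p / ?\<alpha> powr p + ?b j powr q / ?\<beta> powr q"
        using pos nn by (simp add: powr_divide)
      finally have "?\<alpha> * ?\<beta> * ((?a j / ?\<alpha>) * (?b j / ?\<beta>)) \<le> ?\<alpha> * ?\<beta> * (?a j powr p / ?\<alpha> powr p + ?b j powr q / ?\<beta> powr q)"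
        using nn by (intro mult_left_mono) auto
      then show ?thesis using pos by simp
    qed
    then have "(\<Sum>j<n. ?a j * ?b j) \<le> (\<Sum>j<n. ?\<alpha> * ?\<beta> * (?a j powr p / ?\<alpha> powr p + ?b j powr q / ?\<beta> powr q))"
      by (intro sum_mono)
    also have "\<dots> = ?\<alpha> * ?\<beta> * ((\<Sum>j<n. ?a j powr p) / ?\<alpha> powr p + (\<Sum>j<n. ?b j powr q) / ?\<beta> powr q)"
      by (simp add: sum_distrib_left[symmetric] sum.distrib sum_divide_distrib)
    also have "\<dots> \<le> ?\<alpha> * ?\<beta> * (1 + m)"
    proof (intro mult_left_mono add_mono)
      show "(\<Sum>j<n. ?a j powr p) / ?\<alpha> powr p \<le> 1"
        using sum_Lp_norm_powr_overlap[OF h p0(1) E E_overlap] pos by (simp add: divide_le_eq)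
      show "(\<Sum>j<n. ?b j powr q) / ?\<beta> powr q \<le> m"
        using sum_Lp_norm_powr_overlap[OF k p0(2) R R_overlap] pos by (simp add: divide_le_eq)
    qed (use nn in auto)
    finally show ?thesis by (simp add: mult_ac)
  qed
qed

lemma integral_disjoint_sums:
  fixes F :: "'a \<Rightarrow> complex"
  assumes F: "integrable M F" and E: "disjoint_family E" "\<And>j. E j \<in> sets borel"
    and supp: "AE z in M. F z \<noteq> 0 \<longrightarrow> z \<in> (\<Union>j. E j)"
  shows "(\<lambda>j::nat. LINT z|M. indicator (E j) z * F z) sums (LINT z|M. F z)"
  unfolding sums_def
proof -
  have [measurable]: "F \<in> borel_measurable M" using F by auto
  have int: "integrable M (\<lambda>z. indicator (E j) z * F z)" for j
    using F E(2) by (intro Bochner_Integration.integrable_bound[OF F] borel_measurable_times) (auto simp: indicator_def)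
  have part: "(\<Sum>j<n. indicator (E j) z * F z) = indicator (\<Union>j<n. E j) z * F z" for n z
  proof -
    have "disjoint_family_on E {..<n}" using E(1) by (auto simp: disjoint_family_on_def)
    then have "(\<Sum>j<n. indicator (E j) z :: complex) = indicator (\<Union>j<n. E j) z"
      by (subst indicator_UN_disjoint) auto
    then show ?thesis by (simp add: sum_distrib_right[symmetric])
  qed
  have "(\<lambda>n. LINT z|M. indicator (\<Union>j<n. E j) z * F z) \<longlonglongrightarrow> (LINT z|M. F z)"
  proof (rule integral_dominated_convergence[where w = "\<lambda>z. norm (F z)"])
    show "(\<lambda>z. indicator (\<Union>j<n. E j) z * F z) \<in> borel_measurable M" for n
      using E(2) by (intro borel_measurable_times borel_measurable_indicator) auto
    show "AE z in M. (\<lambda>n. indicator (\<Union>j<n. E j) z * F z) \<longlonglongrightarrow> F z"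
      using supp
    proof eventually_elim
      case (elim z)
      show ?case
      proof (cases "F z = 0")
        case False
        then obtain j where j: "z \<in> E j" using elim by auto
        have "eventually (\<lambda>n. indicator (\<Union>j<n. E j) z * F z = F z) sequentially"
          using eventually_gt_at_top[of j]
        proof eventually_elim
          case (elim n)
          then have "z \<in> (\<Union>j<n. E j)" using j by blast
          then show ?case by simp
        qed
        then show ?thesis by (rule tendsto_eventually)
      qed simp
    qed
  qed (use F in \<open>auto simp: indicator_def\<close>)
  then show "(\<lambda>n. \<Sum>j<n. LINT z|M. indicator (E j) z * F z) \<longlonglongrightarrow> (LINT z|M. F z)"
    using int by (simp add: part flip: Bochner_Integration.integral_sum)
qed

lemma compactly_supported_convolution:
  assumes f: "compactly_supported f" and g: "compactly_supported g"
  obtains S where "compact S" "\<And>x. x \<notin> S \<Longrightarrow> convolution M f (tilde g) x = 0"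
proof -
  obtain K where K: "compact K" "\<And>x. x \<notin> K \<Longrightarrow> f x = 0" using f by (auto simp: compactly_supported_def)
  obtain L where L: "compact L" "\<And>x. x \<notin> L \<Longrightarrow> g x = 0" using g by (auto simp: compactly_supported_def)
  define S where "S = (\<lambda>(x, y). x - y) ` (K \<times> L)"
  have "convolution M f (tilde g) x = 0" if "x \<notin> S" for x
  proof -
    have "f y * cnj (g (- x + y)) = 0" for y
    proof (rule ccontr)
      assume "f y * cnj (g (- x + y)) \<noteq> 0"
      then have "y \<in> K" "- x + y \<in> L" using K(2) L(2) by fastforce+
      then have "y - (- x + y) \<in> S" unfolding S_def by force
      then show False using that by (simp add: diff_conv_add_uminus minus_add add.assoc[symmetric] del: add_uminus_conv_diff)
    qed
    then show ?thesis by (simp only: convolution_tilde Bochner_Integration.integral_zero)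
  qed
  moreover have "compact S" unfolding S_def by (rule compact_diff(2)[OF K(1) L(1)])
  ultimately show ?thesis using that by blast
qed

text \<open>
  Let \<open>S\<close> contain the support of \<open>b = f * g~\<close>. Cut \<open>h\<close> into disjoint pieces \<open>h\<^sub>j\<close> supported in \<open>V t\<^sub>j\<close>, with
  \<open>t\<^sub>j\<close> from a maximal separated set. In \<open>b (h\<^sub>j * k~)\<close> only the restriction \<open>k\<^sub>j\<close> of \<open>k\<close> to \<open>S\<inverse>V t\<^sub>j\<close> matters,
  and these sets overlap boundedly often, so \<open>\<Sum> \<parallel>h\<^sub>j\<parallel> \<parallel>k\<^sub>j\<parallel>\<close> is at most a constant times \<open>\<parallel>h\<parallel> \<parallel>k\<parallel>\<close>.
\<close>

lemma Ap_bounded_by_product_convolution: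
  assumes f: "compactly_supported f" and g: "compactly_supported g"
  obtains C where "0 \<le> C" "\<And>h k. h \<in> Lp_space M p \<Longrightarrow> k \<in> Lp_space M q \<Longrightarrow>
      Ap_bounded_by M p (\<lambda>x. convolution M f (tilde g) x * convolution M h (tilde k) x)
        (C * (Lp_norm M p h * Lp_norm M q k))"
proof -
  define b where "b = convolution M f (tilde g)"
  obtain S where S: "compact S" "\<And>x. x \<notin> S \<Longrightarrow> b x = 0"
    unfolding b_def using compactly_supported_convolution[OF f g] by metis
  obtain V U :: "'a set" where V: "compact V" and U: "open U" "0 \<in> U" "U \<subseteq> V" and sym: "uminus ` V = V"
    using compact_symmetric_neighbourhood[OF locally_compact] by metis
  obtain T where T: "separated V T" "(\<Union>t\<in>T. translates V t) = UNIV"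
    using maximal_separated_set[of V] U sym by blast
  obtain C where C: "0 \<le> C" "\<And>t h k. h \<in> Lp_space M p \<Longrightarrow> k \<in> Lp_space M q \<Longrightarrow>
      (\<And>z. z \<notin> translates V t \<Longrightarrow> h z = 0) \<Longrightarrow>
      Ap_bounded_by M p (\<lambda>x. b x * convolution M h (tilde k) x) (C * (Lp_norm M p h * Lp_norm M q k))"
    unfolding b_def using Ap_bounded_by_local_product[OF f g V] by metis
  define Q where "Q = (\<lambda>(x, y). - x + y) ` (S \<times> V)"
  have Q: "compact Q" unfolding Q_def by (rule compact_diff(1)[OF S(1) V])
  then have "compact (uminus ` Q)" by (intro compact_continuous_image continuous_intros)
  then obtain m :: nat where m: "\<And>x. finite (T \<inter> translates (uminus ` Q) x)"
    "\<And>x. card (T \<inter> translates (uminus ` Q) x) \<le> m"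
    using separated_card_bound[OF T(1) U] by metis
  show ?thesis
  proof (rule that)
    show "0 \<le> C * (1 + real m)" using C by simp
    fix h k assume h: "h \<in> Lp_space M p" and k: "k \<in> Lp_space M q"
    have p0: "0 < p" "0 < q" using p q by auto
    obtain K :: "nat \<Rightarrow> 'a set" where K: "\<And>n. compact (K n)" "AE z in M. h z \<noteq> 0 \<longrightarrow> z \<in> (\<Union>n. K n)"
      using Lp_sigma_compact_support[OF h p0(1)] by metis
    \<comment> \<open>The \<open>t \<in> T\<close> whose translate \<open>Vt\<close> meets one of the \<open>K n\<close>; there are finitely many for each \<open>n\<close>.\<close>
    define A where "A = (\<Union>n. T \<inter> translates ((\<lambda>(x, y). - x + y) ` (V \<times> K n)) 0)"
    have "countable A"
      unfolding A_def
    proof (rule countable_UN)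
      show "countable (T \<inter> translates ((\<lambda>(x, y). - x + y) ` (V \<times> K n)) 0)" for n
        by (rule separated_card_bound[OF T(1) U compact_diff(1)[OF V K(1)]]) (rule countable_finite)
    qed simp
    define J where "J = to_nat_on A ` A"
    define \<tau> where "\<tau> = from_nat_into A"
    have \<tau>: "\<tau> j \<in> A" "to_nat_on A (\<tau> j) = j" if "j \<in> J" for j
      using that \<open>countable A\<close> by (auto simp: J_def \<tau>_def)
    have A_T: "A \<subseteq> T" by (auto simp: A_def)
    define P where "P j = (if j \<in> J then translates V (\<tau> j) else {})" for j
    \<comment> \<open>\<open>P\<close> and \<open>R\<close> are empty at indices outside \<open>J\<close>, so each point of \<open>A\<close> is counted once.\<close>
    define R where "R j = (if j \<in> J then translates Q (\<tau> j) else {})" for j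
    have P: "P j \<in> sets borel" and R: "R j \<in> sets borel" for j
      using compact_in_sets compact_translates V Q by (auto simp: P_def R_def)
    define E where "E = disjointed P"
    have E: "E j \<in> sets borel" for j
      using sets.range_disjointed_sets[of P borel] P unfolding E_def by blast
    have E_disj: "disjoint_family E" unfolding E_def by (rule disjoint_family_disjointed)
    have E_P: "E j \<subseteq> P j" for j unfolding E_def by (rule disjointed_subset)
    have cover: "AE z in M. h z \<noteq> 0 \<longrightarrow> z \<in> (\<Union>j. E j)"
      using K(2)
    proof eventually_elim
      case (elim z)
      show ?case
      proof
        assume "h z \<noteq> 0"
        then obtain n where n: "z \<in> K n" using elim by auto
        obtain t where t: "t \<in> T" "z \<in> translates V t" using T(2) by blast
        have "z - t \<in> V" using t(2) by (simp add: in_translates_iff)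
        then have "- (z - t) + z \<in> (\<lambda>(x, y). - x + y) ` (V \<times> K n)" using n by force
        then have "t \<in> (\<lambda>(x, y). - x + y) ` (V \<times> K n)"
          by (simp add: diff_conv_add_uminus minus_add add.assoc del: add_uminus_conv_diff)
        then have "t \<in> A" using t(1) by (auto simp: A_def in_translates_iff)
        then have "to_nat_on A t \<in> J" "\<tau> (to_nat_on A t) = t"
          using \<open>countable A\<close> by (auto simp: J_def \<tau>_def)
        then have "z \<in> P (to_nat_on A t)" using t(2) by (simp add: P_def)
        then show "z \<in> (\<Union>j. E j)" unfolding E_def UN_disjointed_eq by blast
      qed
    qed
    have E_overlap: "(\<Sum>j<n. indicator (E j) z) \<le> (1 :: real)" for n z
    proof -
      have "disjoint_family_on E {..<n}" using E_disj by (auto simp: disjoint_family_on_def)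
      then have "(\<Sum>j<n. indicator (E j) z :: real) = indicator (\<Union>j<n. E j) z"
        by (subst indicator_UN_disjoint) auto
      then show ?thesis by (simp add: indicator_def)
    qed
    have R_overlap: "(\<Sum>j<n. indicator (R j) z) \<le> real m" for n z
    proof -
      have "(\<Sum>j<n. indicator (R j) z :: real) = real (card {j. j < n \<and> z \<in> R j})"
        by (simp add: indicator_def sum.If_cases lessThan_def Collect_conj_eq)
      also have "card {j. j < n \<and> z \<in> R j} \<le> card (T \<inter> translates (uminus ` Q) z)"
      proof (rule card_inj_on_le[of \<tau>])
        have J: "j \<in> J" if "z \<in> R j" for j using that by (auto simp: R_def split: if_splits)
        show "inj_on \<tau> {j. j < n \<and> z \<in> R j}"
        proof (rule inj_onI)
          fix i j assume i: "i \<in> {j. j < n \<and> z \<in> R j}" and j: "j \<in> {j. j < n \<and> z \<in> R j}"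
            and eq: "\<tau> i = \<tau> j"
          have "i = to_nat_on A (\<tau> i)" using i by (intro \<tau>(2)[OF J, symmetric]) blast
          also have "\<dots> = to_nat_on A (\<tau> j)" by (simp only: eq)
          also have "\<dots> = j" using j by (intro \<tau>(2)[OF J]) blast
          finally show "i = j" .
        qed
        show "\<tau> ` {j. j < n \<and> z \<in> R j} \<subseteq> T \<inter> translates (uminus ` Q) z"
        proof (rule image_subsetI)
          fix j assume j: "j \<in> {j. j < n \<and> z \<in> R j}"
          have jJ: "j \<in> J" using j by (intro J) blast
          with j have "z - \<tau> j \<in> Q" by (simp add: R_def in_translates_iff)
          then have "- (z - \<tau> j) \<in> uminus ` Q" by (rule imageI)
          then show "\<tau> j \<in> T \<inter> translates (uminus ` Q) z"
            using \<tau>(1)[OF jJ] A_T by (auto simp: in_translates_iff)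
        qed
      qed (rule m(1))
      also have "\<dots> \<le> m" by (rule m(2))
      finally show ?thesis by simp
    qed
    define h' where "h' j z = indicator (E j) z * h z" for j z
    define k' where "k' j z = indicator (R j) z * k z" for j z
    have h': "h' j \<in> Lp_space M p" for j
    proof (rule Lp_dominated(1)[OF h _ p0(1), of _ 1])
      show "h' j \<in> borel_measurable M"
        unfolding h'_def[abs_def] using E Lp_measurable[OF h] by (intro borel_measurable_times) auto
    qed (auto simp: h'_def indicator_def)
    have k': "k' j \<in> Lp_space M q" for j
    proof (rule Lp_dominated(1)[OF k _ p0(2), of _ 1])
      show "k' j \<in> borel_measurable M"
        unfolding k'_def[abs_def] using R Lp_measurable[OF k] by (intro borel_measurable_times) auto
    qed (auto simp: k'_def indicator_def)
    define c where "c j = C * (Lp_norm M p (h' j) * Lp_norm M q (k' j))" for j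
    have c0: "0 \<le> c j" for j using C by (simp add: c_def Lp_norm_nonneg)
    have c_le: "(\<Sum>j<n. c j) \<le> C * (1 + real m) * (Lp_norm M p h * Lp_norm M q k)" for n
      using mult_left_mono[OF sum_mult_Lp_norms_le[where n = n and E = E and R = R and m = "real m",
          OF h k E R E_overlap R_overlap] C(1)]
      by (simp add: c_def sum_distrib_left[symmetric] h'_def[abs_def] k'_def[abs_def] mult_ac)
    have c_sum: "summable c" by (rule summableI_nonneg_bounded[OF c0 c_le])
    have "Ap_bounded_by M p (\<lambda>x. b x * convolution M (h' j) (tilde (k' j)) x) (c j)" for j
      unfolding c_def
    proof (rule C(2)[OF h' k'])
      show "h' j z = 0" if "z \<notin> translates V (\<tau> j)" for z
        using that E_P[of j] by (auto simp: h'_def P_def indicator_def split: if_splits)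
    qed
    moreover have "(\<lambda>j. b x * convolution M (h' j) (tilde (k' j)) x) sums (b x * convolution M h (tilde k) x)" for x
    proof (cases "x \<in> S")
      case True
      have "h' j z * cnj (k' j (- x + z)) = indicator (E j) z * (h z * cnj (k (- x + z)))" for j z
      proof (cases "z \<in> E j")
        case z: True
        then have "j \<in> J" "z - \<tau> j \<in> V" using E_P[of j] by (auto simp: P_def in_translates_iff split: if_splits)
        then have "- x + (z - \<tau> j) \<in> Q" using True unfolding Q_def by force
        then have "- x + z \<in> R j" using \<open>j \<in> J\<close> by (simp add: R_def in_translates_iff add_diff_eq)
        then show ?thesis using z by (simp add: h'_def k'_def)
      qed (simp add: h'_def)
      moreover have "integrable M (\<lambda>z. h z * cnj (k (- x + z)))"
        using convolution_integrable[OF p h] k by (simp add: q_def)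
      moreover have "AE z in M. h z * cnj (k (- x + z)) \<noteq> 0 \<longrightarrow> z \<in> (\<Union>j. E j)"
        using cover by eventually_elim auto
      ultimately have "(\<lambda>j. convolution M (h' j) (tilde (k' j)) x) sums convolution M h (tilde k) x"
        unfolding convolution_tilde using integral_disjoint_sums[OF _ E_disj E] by simp
      then show ?thesis by (rule sums_mult)
    qed (simp add: S(2))
    ultimately have "Ap_bounded_by M p (\<lambda>x. b x * convolution M h (tilde k) x) (\<Sum>j. c j)"
      by (rule Ap_bounded_by_sums[OF _ c_sum])
    moreover have "(\<Sum>j. c j) \<le> C * (1 + real m) * (Lp_norm M p h * Lp_norm M q k)"
      by (rule suminf_le_const[OF c_sum c_le])
    ultimately show "Ap_bounded_by M p (\<lambda>x. convolution M f (tilde g) x * convolution M h (tilde k) x)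
        (C * (1 + real m) * (Lp_norm M p h * Lp_norm M q k))"
      unfolding b_def by (rule Ap_bounded_by_mono)
  qed
qed

lemma Ap_bounded_by_product:
  assumes f: "compactly_supported f" and g: "compactly_supported g" and v: "Ap_bounded_by M p v c"
  obtains d where "Ap_bounded_by M p (\<lambda>x. convolution M f (tilde g) x * v x) d"
proof -
  obtain C where C: "0 \<le> C" "\<And>h k. h \<in> Lp_space M p \<Longrightarrow> k \<in> Lp_space M q \<Longrightarrow>
      Ap_bounded_by M p (\<lambda>x. convolution M f (tilde g) x * convolution M h (tilde k) x)
        (C * (Lp_norm M p h * Lp_norm M q k))"
    using Ap_bounded_by_product_convolution[OF f g] by metis
  obtain F G where FG: "Ap_representation M p v F G" using v by (auto simp: Ap_bounded_by_def)
  have "Ap_bounded_by M p (\<lambda>x. convolution M f (tilde g) x * v x) (\<Sum>i. C * (Lp_norm M p (F i) * Lp_norm M q (G i)))"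
    using FG by (intro Ap_bounded_by_sums[OF C(2)] summable_mult sums_mult)
      (auto simp: Ap_representation_def q_def)
  then show ?thesis by (rule that)
qed

lemma compactly_supported_Lp:
  fixes f :: "'a \<Rightarrow> complex"
  assumes f: "compactly_supported f" and r: "0 < r" shows "f \<in> Lp_space M r"
proof -
  obtain K where K: "compact K" "\<And>x. x \<notin> K \<Longrightarrow> f x = 0" using f by (auto simp: compactly_supported_def)
  obtain B where B: "0 < B" "\<And>x. norm (f x) \<le> B" using compactly_supported_bounded[OF f] by metis
  have m: "f \<in> borel_measurable M" using f by (intro continuous_imp_measurable) (simp add: compactly_supported_def)
  have "integrable M (\<lambda>x. norm (f x) powr r)"
  proof (rule integrable_dominated)
    show "integrable M (\<lambda>x. indicator K x * B powr r)"
      by (intro integrable_mult_left integrable_indicator_compact(1)[OF compact_in_sets[OF K(1)] subset_refl K(1)])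
    show "norm (norm (f x) powr r) \<le> indicator K x * B powr r" for x
      using K(2)[of x] B(2)[of x] r by (cases "x \<in> K") (auto intro: powr_mono2)
    show "(\<lambda>x. norm (f x) powr r) \<in> borel_measurable M" using m by measurable
  qed
  then show ?thesis using m by (simp add: Lp_space_def)
qed

lemma compactly_supported_integrable:
  fixes f :: "'a \<Rightarrow> complex"
  assumes f: "compactly_supported f" shows "integrable M f"
proof (rule integrable_dominated)
  show "integrable M (\<lambda>x. norm (f x) powr 1)" "f \<in> borel_measurable M"
    using compactly_supported_Lp[OF f, of 1] by (auto simp: Lp_space_def)
qed simp

lemma convolution_continuous:
  assumes f: "compactly_supported f" and g: "compactly_supported g"
  shows "continuous_on UNIV (convolution M f (tilde g))"
proof -
  have i: "integrable M (\<lambda>w. cnj (f w))" using compactly_supported_integrable[OF f] by simp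
  have "continuous_on UNIV (\<lambda>x. LINT w|M. cnj (f w) * g (- x + w))"
    by (rule continuous_on_compose2[OF continuous_integral_translates(2)[OF g i]]) (auto intro!: continuous_intros)
  then have "continuous_on UNIV (\<lambda>x. cnj (LINT w|M. cnj (f w) * g (- x + w)))"
    by (intro continuous_intros)
  moreover have "cnj (LINT w|M. cnj (f w) * g (- x + w)) = convolution M f (tilde g) x" for x
    by (simp add: convolution_tilde flip: Bochner_Integration.integral_cnj)
  ultimately show ?thesis by simp
qed

lemma C0_compact_support:
  fixes u :: "'a \<Rightarrow> complex"
  assumes "continuous_on UNIV u" "compact S" "\<And>x. x \<notin> S \<Longrightarrow> u x = 0" shows "u \<in> C0_space"
  unfolding C0_space_def
proof (intro CollectI conjI allI impI assms(1))
  fix \<epsilon> :: real assume "0 < \<epsilon>"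
  then show "\<exists>K. compact K \<and> (\<forall>x. x \<notin> K \<longrightarrow> norm (u x) < \<epsilon>)"
    using assms(2,3) by (intro exI[of _ S]) auto
qed

lemma convolution_in_Ap:
  assumes f: "compactly_supported f" and g: "compactly_supported g"
  shows "convolution M f (tilde g) \<in> Ap_space M p"
proof -
  obtain S where S: "compact S" "\<And>x. x \<notin> S \<Longrightarrow> convolution M f (tilde g) x = 0"
    using compactly_supported_convolution[OF f g] by metis
  have "Ap_bounded_by M p (convolution M f (tilde g)) (Lp_norm M p f * Lp_norm M q g)"
    using f g p q by (intro Ap_bounded_by_convolution compactly_supported_Lp) auto
  then show ?thesis
    using C0_compact_support[OF convolution_continuous[OF f g] S] by (auto simp: Ap_space_def Ap_bounded_by_def)
qed

lemma product_minus_in_Ap: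
  assumes f: "compactly_supported f" and g: "compactly_supported g" and v: "v \<in> Ap_space M p"
  shows "(\<lambda>x. convolution M f (tilde g) x * v x - convolution M f (tilde g) x) \<in> Ap_space M p"
proof -
  define b where "b = convolution M f (tilde g)"
  obtain S where S: "compact S" "\<And>x. x \<notin> S \<Longrightarrow> b x = 0"
    unfolding b_def using compactly_supported_convolution[OF f g] by metis
  have vc: "continuous_on UNIV v" using v by (simp add: Ap_space_def C0_space_def)
  have bc: "continuous_on UNIV b" unfolding b_def by (rule convolution_continuous[OF f g])
  obtain c where "Ap_bounded_by M p v c" using v by (auto simp: Ap_space_def Ap_bounded_by_def)
  then obtain d where d: "Ap_bounded_by M p (\<lambda>x. b x * v x) d"
    unfolding b_def using Ap_bounded_by_product[OF f g] by metis
  obtain c' where "Ap_bounded_by M p b c'"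
    unfolding b_def using convolution_in_Ap[OF f g] by (auto simp: Ap_space_def Ap_bounded_by_def)
  from Ap_bounded_by_add[OF d Ap_bounded_by_uminus[OF this]]
  have "Ap_bounded_by M p (\<lambda>x. b x * v x - b x) (d + c')" by simp
  moreover have "(\<lambda>x. b x * v x - b x) \<in> C0_space"
    using S vc bc by (intro C0_compact_support[of _ S] continuous_intros) auto
  ultimately show ?thesis unfolding b_def by (auto simp: Ap_space_def Ap_bounded_by_def)
qed

end

section \<open>Almost invariant vectors\<close>

definition left_sum :: "'a::group_add set \<Rightarrow> ('a \<Rightarrow> complex) \<Rightarrow> 'a \<Rightarrow> complex" where
  "left_sum F k y = (\<Sum>s\<in>F. k (- s + y))"

definition right_sum :: "'a::group_add set \<Rightarrow> ('a \<Rightarrow> complex) \<Rightarrow> 'a \<Rightarrow> complex" where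
  "right_sum F v x = (\<Sum>s\<in>F. v (x + s))"

fun words :: "'a::group_add set \<Rightarrow> nat \<Rightarrow> 'a set" where
  "words F 0 = {0}"
| "words F (Suc n) = (\<lambda>(s, w). s + w) ` (F \<times> words F n)"

lemma finite_words: "finite F \<Longrightarrow> finite (words F n)"
  by (induction n) auto

lemma right_sum_power_lower_bound:
  assumes "finite F" "\<And>w. w \<in> words F n \<Longrightarrow> \<delta> \<le> Re (v (x + w))"
  shows "\<delta> * real (card F) ^ n \<le> Re ((right_sum F ^^ n) v x)"
  using assms(2)
proof (induction n arbitrary: x)
  case 0
  then show ?case by simp
next
  case (Suc n)
  have "\<delta> * real (card F) ^ n \<le> Re ((right_sum F ^^ n) v (x + s))" if "s \<in> F" for s
  proof (rule Suc.IH)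
    fix w assume "w \<in> words F n"
    then have "s + w \<in> words F (Suc n)" using that by force
    from Suc.prems[OF this] show "\<delta> \<le> Re (v (x + s + w))" by (simp add: add.assoc)
  qed
  then have "(\<Sum>s\<in>F. \<delta> * real (card F) ^ n) \<le> (\<Sum>s\<in>F. Re ((right_sum F ^^ n) v (x + s)))"
    by (rule sum_mono)
  moreover have "(right_sum F ^^ Suc n) v x = (\<Sum>s\<in>F. (right_sum F ^^ n) v (x + s))"
    by (simp only: funpow.simps comp_def right_sum_def[of F "(right_sum F ^^ n) v"])
  ultimately show ?case by (simp add: mult_ac)
qed

lemma right_sum_power_sums:
  assumes "\<And>x. (\<lambda>i. u i x) sums v x"
  shows "(\<lambda>i. (right_sum F ^^ n) (u i) x) sums (right_sum F ^^ n) v x"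
proof (induction n arbitrary: x)
  case (Suc n)
  have "(\<lambda>i. right_sum F ((right_sum F ^^ n) (u i)) x) sums right_sum F ((right_sum F ^^ n) v) x"
    unfolding right_sum_def[of F "(right_sum F ^^ n) w" for w] by (intro sums_sum Suc)
  then show ?case by simp
qed (simp add: assms)

text \<open>
  The deficit in Young's inequality controls the distance of the square roots: expanding the square reduces the claim
  to Young's inequality for \<open>\<surd>(AB)\<close> and \<open>B\<close> with weights \<open>2\<theta>\<close> and \<open>1 - 2\<theta>\<close>.
\<close>

lemma refined_Young_aux:
  fixes A B \<theta> :: real
  assumes A: "0 \<le> A" and B: "0 \<le> B" and \<theta>: "0 < \<theta>" "\<theta> \<le> 1 / 2"
  shows "\<theta> * (sqrt A - sqrt B)\<^sup>2 \<le> \<theta> * A + (1 - \<theta>) * B - A powr \<theta> * B powr (1 - \<theta>)"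
proof (cases "A = 0 \<or> B = 0")
  case True
  then show ?thesis
  proof
    assume "A = 0"
    moreover have "\<theta> * B \<le> (1 - \<theta>) * B" using \<theta> B by (intro mult_right_mono) auto
    ultimately show ?thesis using \<theta> B by simp
  next
    assume "B = 0" then show ?thesis using \<theta> A by simp
  qed
next
  case False
  then have pos: "0 < A" "0 < B" using A B by auto
  have "sqrt (A * B) powr (2 * \<theta>) * B powr (1 - 2 * \<theta>) \<le> (2 * \<theta>) * sqrt (A * B) + (1 - 2 * \<theta>) * B"
    using \<theta> pos by (intro Youngs_inequality_0) auto
  also have "sqrt (A * B) powr (2 * \<theta>) = A powr \<theta> * B powr \<theta>"
    using pos by (simp add: powr_half_sqrt[symmetric] powr_powr powr_mult)
  also have "A powr \<theta> * B powr \<theta> * B powr (1 - 2 * \<theta>) = A powr \<theta> * B powr (1 - \<theta>)"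
    using pos by (simp add: mult.assoc flip: powr_add)
  finally have "A powr \<theta> * B powr (1 - \<theta>) \<le> (2 * \<theta>) * sqrt (A * B) + (1 - 2 * \<theta>) * B" .
  moreover have "(sqrt A - sqrt B)\<^sup>2 = A + B - 2 * sqrt (A * B)"
    using pos by (simp add: power2_diff real_sqrt_mult)
  then have "\<theta> * (sqrt A - sqrt B)\<^sup>2 = \<theta> * A + \<theta> * B - (2 * \<theta>) * sqrt (A * B)"
    by (simp only: right_diff_distrib distrib_left)
  ultimately show ?thesis by (simp add: algebra_simps)
qed

lemma refined_Young:
  fixes A B p q :: real
  assumes A: "0 \<le> A" and B: "0 \<le> B" and pq: "1 < p" "1 < q" "1 / p + 1 / q = 1"
  shows "min (1 / p) (1 / q) * (sqrt A - sqrt B)\<^sup>2 \<le> A / p + B / q - A powr (1 / p) * B powr (1 / q)"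
proof (cases "1 / p \<le> 1 / q")
  case True
  have 1: "1 - 1 / p = 1 / q" "1 / p \<le> 1 / 2" using pq True by linarith+
  have "0 < 1 / p" using pq by simp
  from refined_Young_aux[OF A B this 1(2), unfolded 1(1)] True show ?thesis
    by simp
next
  case False
  have 1: "1 - 1 / q = 1 / p" "1 / q \<le> 1 / 2" using pq False by linarith+
  have "0 < 1 / q" using pq by simp
  from refined_Young_aux[OF B A this 1(2), unfolded 1(1)] False show ?thesis
    by (simp add: power2_commute[of "sqrt B"] mult.commute)
qed

text \<open>
  Substitute for the Cauchy-Schwarz inequality when passing from square roots to \<open>L\<^sup>1\<close> distances: factor \<open>A - B\<close> and
  apply the inequality between arithmetic and geometric means with weight \<open>t\<close>.
\<close>

lemma abs_diff_le_sqrt: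
  fixes A B t :: real
  assumes "0 \<le> A" "0 \<le> B" "0 < t"
  shows "\<bar>A - B\<bar> \<le> (sqrt A - sqrt B)\<^sup>2 / t + t * (A + B)"
proof -
  define x where "x = \<bar>sqrt A - sqrt B\<bar>"
  define y where "y = sqrt A + sqrt B"
  have "A - B = (sqrt A - sqrt B) * (sqrt A + sqrt B)"
    using assms by (simp add: algebra_simps)
  then have 1: "\<bar>A - B\<bar> = x * y" using assms by (simp add: abs_mult x_def y_def)
  have "0 \<le> (x / sqrt t - sqrt t * y)\<^sup>2" by simp
  also have "\<dots> = x\<^sup>2 / t - 2 * (x * y) + t * y\<^sup>2"
    using assms by (simp add: power2_diff power_divide power_mult_distrib)
  finally have "2 * (x * y) \<le> x\<^sup>2 / t + t * y\<^sup>2" by simp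
  moreover have "y\<^sup>2 \<le> 2 * (A + B)"
  proof -
    have "0 \<le> (sqrt A - sqrt B)\<^sup>2" by simp
    then show ?thesis using assms by (simp add: y_def power2_sum power2_diff)
  qed
  then have "t * y\<^sup>2 \<le> t * (2 * (A + B))" using assms(3) by (intro mult_left_mono) auto
  ultimately have "2 * (x * y) \<le> x\<^sup>2 / t + 2 * (t * (A + B))" by (simp add: algebra_simps)
  moreover have "0 \<le> x\<^sup>2 / t" using assms by simp
  ultimately have "x * y \<le> x\<^sup>2 / t + t * (A + B)" by linarith
  then show ?thesis using 1 by (simp add: x_def)
qed

context Lp_group
begin

lemma Lp_sum:
  assumes "finite F" "0 < r" "\<And>s. s \<in> F \<Longrightarrow> u s \<in> Lp_space M r"
  shows "(\<lambda>y. \<Sum>s\<in>F. u s y) \<in> Lp_space M r"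
  using assms(1,3) by (induction F rule: finite_induct) (auto simp: Lp_zero intro!: Lp_add assms(2))

lemma left_sum_Lp:
  assumes "finite F" "k \<in> Lp_space M q" shows "left_sum F k \<in> Lp_space M q"
  unfolding left_sum_def[abs_def] using assms q by (intro Lp_sum Lp_translation) auto

lemma right_sum_convolution:
  assumes F: "finite F" and h: "h \<in> Lp_space M p" and k: "k \<in> Lp_space M q"
  shows "right_sum F (convolution M h (tilde k)) = convolution M h (tilde (left_sum F k))"
proof
  fix x
  have eq: "- (x + s) + y = - s + (- x + y)" for s y :: 'a
    by (simp add: minus_add add.assoc del: add_uminus_conv_diff)
  have int: "integrable M (\<lambda>y. h y * cnj (k (- s + (- x + y))))" for s
    using convolution_integrable[OF p h, of "\<lambda>y. k (- s + y)" x] Lp_translation(1)[OF k] by (simp add: q_def)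
  have "right_sum F (convolution M h (tilde k)) x = (\<Sum>s\<in>F. LINT y|M. h y * cnj (k (- s + (- x + y))))"
    unfolding right_sum_def convolution_tilde eq ..
  also have "\<dots> = (LINT y|M. (\<Sum>s\<in>F. h y * cnj (k (- s + (- x + y)))))"
    using int by (intro Bochner_Integration.integral_sum[symmetric])
  also have "\<dots> = convolution M h (tilde (left_sum F k)) x"
    by (simp add: convolution_tilde left_sum_def sum_distrib_left)
  finally show "right_sum F (convolution M h (tilde k)) x = convolution M h (tilde (left_sum F k)) x" .
qed

lemma right_sum_power_convolution:
  assumes F: "finite F" and h: "h \<in> Lp_space M p" and k: "k \<in> Lp_space M q"
    and \<rho>: "0 \<le> \<rho>" "\<And>k. k \<in> Lp_space M q \<Longrightarrow> Lp_norm M q (left_sum F k) \<le> \<rho> * Lp_norm M q k"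
  shows "norm ((right_sum F ^^ n) (convolution M h (tilde k)) x) \<le> \<rho> ^ n * (Lp_norm M p h * Lp_norm M q k)"
proof -
  have k': "(left_sum F ^^ n) k \<in> Lp_space M q" for n
    by (induction n) (auto simp: k intro: left_sum_Lp[OF F])
  have "(right_sum F ^^ n) (convolution M h (tilde k)) = convolution M h (tilde ((left_sum F ^^ n) k))"
    by (induction n) (simp_all add: right_sum_convolution[OF F h k'])
  moreover have "Lp_norm M q ((left_sum F ^^ n) k) \<le> \<rho> ^ n * Lp_norm M q k"
  proof (induction n)
    case (Suc n)
    have "Lp_norm M q ((left_sum F ^^ Suc n) k) \<le> \<rho> * Lp_norm M q ((left_sum F ^^ n) k)"
      using \<rho>(2)[OF k'] by simp
    also have "\<dots> \<le> \<rho> * (\<rho> ^ n * Lp_norm M q k)" using Suc \<rho>(1) by (intro mult_left_mono)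
    finally show ?case by (simp add: mult_ac)
  qed simp
  then have "Lp_norm M p h * Lp_norm M q ((left_sum F ^^ n) k) \<le> Lp_norm M p h * (\<rho> ^ n * Lp_norm M q k)"
    by (intro mult_left_mono Lp_norm_nonneg)
  moreover have "norm (convolution M h (tilde ((left_sum F ^^ n) k)) x) \<le> Lp_norm M p h * Lp_norm M q ((left_sum F ^^ n) k)"
    using norm_convolution_le[OF p h] k' by (simp add: q_def)
  ultimately show ?thesis by (simp add: mult_ac)
qed

lemma right_sum_power_Ap_bounded_by:
  assumes F: "finite F" and v: "Ap_bounded_by M p v c"
    and \<rho>: "0 \<le> \<rho>" "\<And>k. k \<in> Lp_space M q \<Longrightarrow> Lp_norm M q (left_sum F k) \<le> \<rho> * Lp_norm M q k"
  shows "norm ((right_sum F ^^ n) v x) \<le> \<rho> ^ n * c"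
proof -
  from v obtain f g where fg: "Ap_representation M p v f g"
    and c: "(\<Sum>i. Lp_norm M p (f i) * Lp_norm M q (g i)) \<le> c"
    by (auto simp: Ap_bounded_by_def q_def)
  let ?c = "\<lambda>i. \<rho> ^ n * (Lp_norm M p (f i) * Lp_norm M q (g i))"
  let ?u = "\<lambda>i. (right_sum F ^^ n) (convolution M (f i) (tilde (g i))) x"
  have s: "summable (\<lambda>i. Lp_norm M p (f i) * Lp_norm M q (g i))"
    using fg by (simp add: Ap_representation_def q_def)
  have le: "norm (?u i) \<le> ?c i" for i
    using fg by (intro right_sum_power_convolution F \<rho>) (auto simp: Ap_representation_def q_def)
  have sn: "summable (\<lambda>i. norm (?u i))"
    by (rule summable_comparison_test'[OF summable_mult[OF s], of 0]) (use le in simp)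
  have "?u sums (right_sum F ^^ n) v x"
    using fg by (intro right_sum_power_sums) (auto simp: Ap_representation_def)
  then have "(right_sum F ^^ n) v x = (\<Sum>i. ?u i)" by (simp add: sums_iff)
  then have "norm ((right_sum F ^^ n) v x) \<le> (\<Sum>i. norm (?u i))"
    using summable_norm[OF sn] by simp
  also have "\<dots> \<le> (\<Sum>i. ?c i)" by (intro suminf_le le sn summable_mult s)
  also have "\<dots> = \<rho> ^ n * (\<Sum>i. Lp_norm M p (f i) * Lp_norm M q (g i))" by (rule suminf_mult[OF s])
  also have "\<dots> \<le> \<rho> ^ n * c" using c \<rho>(1) by (intro mult_left_mono) auto
  finally show ?thesis .
qed

lemma Ap_bounded_by_left_translate:
  assumes v: "Ap_bounded_by M p v c"
  shows "Ap_bounded_by M p (\<lambda>x. v (- a + x)) c"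
proof -
  from v obtain f g where fg: "Ap_representation M p v f g"
    and c: "(\<Sum>i. Lp_norm M p (f i) * Lp_norm M q (g i)) \<le> c"
    by (auto simp: Ap_bounded_by_def q_def)
  have "convolution M (\<lambda>y. f i (- a + y)) (tilde (g i)) x = convolution M (f i) (tilde (g i)) (- a + x)" for i x
  proof -
    have fi: "f i \<in> Lp_space M p" and gi: "g i \<in> Lp_space M q"
      using fg by (auto simp: Ap_representation_def q_def)
    have [measurable]: "f i \<in> borel_measurable M" "(\<lambda>y. g i (- (- a + x) + y)) \<in> borel_measurable M"
      by (rule Lp_measurable[OF fi], rule Lp_measurable[OF Lp_translation(1)[OF gi]])
    have "(LINT y|M. f i y * cnj (g i (- (- a + x) + y))) =
        (LINT y|M. f i (- a + y) * cnj (g i (- (- a + x) + (- a + y))))"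
      by (rule integral_translation[symmetric]) measurable
    moreover have "- (- a + x) + (- a + y) = - x + y" for y
      by (simp add: minus_add add.assoc)
    ultimately show ?thesis by (simp only: convolution_tilde)
  qed
  then have "Ap_representation M p (\<lambda>x. v (- a + x)) (\<lambda>i y. f i (- a + y)) g"
    using fg by (auto simp: Ap_representation_def Lp_translation)
  moreover have "(\<Sum>i. Lp_norm M p (\<lambda>y. f i (- a + y)) * Lp_norm M q (g i)) \<le> c"
    using c fg by (auto simp: Ap_representation_def Lp_translation)
  ultimately show ?thesis by (auto simp: Ap_bounded_by_def q_def)
qed

text \<open>
  What remains of the approximate identity once \<open>H\<close> is eliminated: a bounded family in \<open>A\<^sub>p(G)\<close> that is bounded away
  from zero on finite sets.
\<close>

definition bounded_locally_large :: "real \<Rightarrow> bool" where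
  "bounded_locally_large C \<longleftrightarrow>
     (\<forall>X. finite X \<longrightarrow> (\<exists>v. Ap_bounded_by M p v C \<and> (\<forall>x\<in>X. 1 / 2 \<le> Re (v x))))"

text \<open>
  If \<open>\<parallel>T k\<parallel> \<le> \<rho> \<parallel>k\<parallel>\<close> for all \<open>k\<close>, with \<open>T\<close> the operator \<open>left_sum F\<close> and \<open>\<rho> < |F|\<close>, then summing a function that is at
  least \<open>1/2\<close> on the words of length \<open>n\<close> gives \<open>|F|\<^sup>n/2 \<le> C \<rho>\<^sup>n\<close>, which fails for large \<open>n\<close>.
\<close>

lemma almost_norming_vector:
  assumes C: "bounded_locally_large C" and F: "finite F" and \<rho>: "0 \<le> \<rho>" "\<rho> < real (card F)"
  shows "\<exists>k\<in>Lp_space M q. \<rho> * Lp_norm M q k < Lp_norm M q (left_sum F k)"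
proof (rule ccontr)
  assume "\<not> ?thesis"
  then have le: "Lp_norm M q (left_sum F k) \<le> \<rho> * Lp_norm M q k" if "k \<in> Lp_space M q" for k
    using that by (force simp: not_less)
  have card: "0 < real (card F)" using \<rho> by linarith
  have C0: "0 \<le> C" using C Ap_bounded_by_nonneg by (auto simp: bounded_locally_large_def)
  obtain n where n: "(\<rho> / card F) ^ n < 1 / (2 * (C + 1))"
    using real_arch_pow_inv[of "1 / (2 * (C + 1))" "\<rho> / card F"] C0 \<rho> card by (auto simp: divide_less_eq)
  obtain v where v: "Ap_bounded_by M p v C" "\<And>x. x \<in> words F n \<Longrightarrow> 1 / 2 \<le> Re (v x)"
    using C finite_words[OF F] by (metis bounded_locally_large_def)
  have "1 / 2 * real (card F) ^ n \<le> Re ((right_sum F ^^ n) v 0)"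
    using v(2) by (intro right_sum_power_lower_bound[OF F]) simp
  also have "\<dots> \<le> norm ((right_sum F ^^ n) v 0)" by (rule complex_Re_le_cmod)
  also have "\<dots> \<le> \<rho> ^ n * C" by (rule right_sum_power_Ap_bounded_by[OF F v(1) \<rho>(1) le])
  also have "\<dots> \<le> \<rho> ^ n * (C + 1)" using \<rho>(1) by (intro mult_left_mono) auto
  finally have "1 / (2 * (C + 1)) \<le> (\<rho> / card F) ^ n"
    using card C0 by (simp add: power_divide field_simps)
  with n show False by linarith
qed

end

context Lp_group
begin

text \<open>
  Let \<open>k \<ge> 0\<close> nearly attain the norm \<open>|F|\<close> of the operator \<open>left_sum F\<close> on \<open>L\<^sup>q\<close>, put \<open>T = \<Sum>\<^sub>s L\<^sub>s k\<close>, and let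
  \<open>h = T\<^bsup>q-1\<^esup>\<close>, the equality case of Hoelder's inequality. Then \<open>\<Sum>\<^sub>s \<integral> h L\<^sub>s k\<close> is nearly \<open>|F| \<parallel>h\<parallel> \<parallel>k\<parallel>\<close>; as each
  summand is at most \<open>\<parallel>h\<parallel> \<parallel>k\<parallel>\<close>, each is nearly equal to it. The refined form of Young's inequality then shows that the
  normalised \<open>(L\<^sub>s k)\<^sup>q\<close> are all close in \<open>L\<^sup>1\<close> to the normalised \<open>T\<^sup>q\<close>, so \<open>k\<^sup>q\<close> is almost invariant.
\<close>

lemma almost_invariant_density:
  assumes C: "bounded_locally_large C" and F: "finite F" and \<eta>: "0 < \<eta>"
  obtains \<phi> :: "'a \<Rightarrow> real" where "\<And>y. 0 \<le> \<phi> y" "integrable M \<phi>" "(LINT y|M. \<phi> y) = 1"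
    "\<And>s. s \<in> F \<Longrightarrow> (LINT y|M. \<bar>\<phi> (- s + y) - \<phi> y\<bar>) < \<eta>"
proof -
  define F' where "F' = insert 0 F"
  have F': "finite F'" "0 \<in> F'" using F by (auto simp: F'_def)
  define c where "c = min (1 / p) (1 / q)"
  have c: "0 < c" using p q by (simp add: c_def)
  \<comment> \<open>Each \<open>(L\<^sub>s k)\<^sup>q\<close> will be within \<open>3t\<close> of a common density, hence any two of them within \<open>6t < \<eta>\<close>.\<close>
  define t where "t = \<eta> / 12"
  have t: "0 < t" using \<eta> by (simp add: t_def)
  define \<delta> where "\<delta> = min (1 / 2) (c * t * t)"
  have \<delta>: "0 < \<delta>" "\<delta> \<le> 1 / 2" "\<delta> \<le> c * t * t" using c t by (auto simp: \<delta>_def)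
  have card: "1 \<le> card F'" using F' by (metis One_nat_def Suc_leI card_gt_0_iff empty_iff)
  have "0 \<le> card F' - \<delta>" "card F' - \<delta> < card F'" using card \<delta> by linarith+
  from almost_norming_vector[OF C F'(1) this] obtain k0 where k0: "k0 \<in> Lp_space M q"
    and large0: "(card F' - \<delta>) * Lp_norm M q k0 < Lp_norm M q (left_sum F' k0)" by blast
  have p0: "0 < p" "0 < q" using p q by auto
  \<comment> \<open>Passing to absolute values does not decrease the norm of the sum of translates.\<close>
  define k where "k y = complex_of_real (norm (k0 y))" for y
  have k_eq: "norm (k y) = norm (k0 y)" for y by (simp add: k_def)
  have k: "k \<in> Lp_space M q"
  proof (rule Lp_dominated(1)[OF k0 _ p0(2), of _ 1])
    show "k \<in> borel_measurable M" unfolding k_def[abs_def] using Lp_measurable[OF k0] by measurable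
  qed (simp_all add: k_eq)
  define \<tau> where "\<tau> y = (\<Sum>s\<in>F'. norm (k (- s + y)))" for y
  have \<tau>0: "0 \<le> \<tau> y" for y by (auto simp: \<tau>_def intro: sum_nonneg)
  have \<tau>_eq: "left_sum F' k y = complex_of_real (\<tau> y)" for y
    by (simp add: left_sum_def \<tau>_def k_def)
  define T where "T = left_sum F' k"
  have T: "T \<in> Lp_space M q" unfolding T_def by (rule left_sum_Lp[OF F'(1) k])
  have T_norm: "norm (T y) = \<tau> y" for y using \<tau>0 by (simp add: T_def \<tau>_eq)
  define a where "a = Lp_norm M q k"
  define n where "n = Lp_norm M q T"
  have a_eq: "Lp_norm M q k0 = a" by (simp add: a_def Lp_norm_def k_eq)
  have "Lp_norm M q (left_sum F' k0) \<le> 1 * n"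
    unfolding n_def
  proof (rule Lp_dominated(2)[OF T Lp_measurable[OF left_sum_Lp[OF F'(1) k0]] p0(2)])
    show "norm (left_sum F' k0 y) \<le> 1 * norm (T y)" for y
      unfolding T_norm \<tau>_def left_sum_def k_eq by (simp add: norm_sum)
  qed simp
  with large0 have large: "(card F' - \<delta>) * a < n" by (simp add: a_eq)
  have a0: "0 \<le> a" by (simp add: a_def Lp_norm_nonneg)
  then have "0 \<le> (card F' - \<delta>) * a" using card \<delta> by simp
  then have n0: "0 < n" using large by linarith
  \<comment> \<open>\<open>h\<^sup>p = \<tau>\<^sup>q\<close>, since \<open>p (q - 1) = q\<close>.\<close>
  define h where "h y = complex_of_real (\<tau> y powr (q - 1))" for y
  have pq: "p * (q - 1) = q" using q p by (simp add: field_simps)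
  have h_norm: "norm (h y) = \<tau> y powr (q - 1)" for y by (simp add: h_def)
  have h_powr: "norm (h y) powr p = norm (T y) powr q" for y
    by (simp add: h_norm T_norm powr_powr mult.commute[of "q - 1"] pq)
  have \<tau>m: "\<tau> \<in> borel_measurable M"
  proof -
    have "(\<lambda>y. norm (T y)) \<in> borel_measurable M" using Lp_measurable[OF T] by measurable
    then show ?thesis by (simp add: T_norm)
  qed
  have h: "h \<in> Lp_space M p"
  proof -
    have "h \<in> borel_measurable M" unfolding h_def[abs_def] using \<tau>m by measurable
    then show ?thesis using T unfolding Lp_space_def mem_Collect_eq h_powr by simp
  qed
  have qp: "q / p = q - 1" using pq p0 by (simp add: field_simps)
  have hn: "Lp_norm M p h = n powr (q - 1)"
  proof -
    have "Lp_norm M p h = (n powr q) powr (1 / p)"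
      unfolding Lp_norm_def[of M p] h_powr n_def Lp_norm_powr[OF p0(2)] ..
    then show ?thesis using qp by (simp add: powr_powr)
  qed
  define I where "I s = (LINT y|M. norm (h y) * norm (k (- s + y)))" for s
  have int: "integrable M (\<lambda>y. norm (h y) * norm (k (- s + y)))" for s
    using Holder_inequality(1)[OF p h, of "\<lambda>y. k (- s + y)"] Lp_translation(1)[OF k] by (simp add: q_def)
  have I_le: "I s \<le> n powr (q - 1) * a" for s
    using Holder_inequality(2)[OF p h, of "\<lambda>y. k (- s + y)"] Lp_translation[OF k, of "- s"]
    unfolding I_def a_def hn by (simp add: q_def)
  have "(\<Sum>s\<in>F'. I s) = (LINT y|M. (\<Sum>s\<in>F'. norm (h y) * norm (k (- s + y))))"
    unfolding I_def using int by (intro Bochner_Integration.integral_sum[symmetric])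
  also have "(\<lambda>y. \<Sum>s\<in>F'. norm (h y) * norm (k (- s + y))) = (\<lambda>y. norm (T y) powr q)"
  proof
    fix y
    have "(\<Sum>s\<in>F'. norm (h y) * norm (k (- s + y))) = \<tau> y powr (q - 1) * \<tau> y"
      by (simp add: h_norm \<tau>_def sum_distrib_left)
    also have "\<dots> = \<tau> y powr q" using powr_mult_base[OF \<tau>0, of y "q - 1"] by (simp add: mult.commute)
    finally show "(\<Sum>s\<in>F'. norm (h y) * norm (k (- s + y))) = norm (T y) powr q" by (simp add: T_norm)
  qed
  finally have I_sum: "(\<Sum>s\<in>F'. I s) = n powr q" by (simp add: n_def Lp_norm_powr[OF p0(2)])
  have nq: "n powr q = n powr (q - 1) * n"
    using powr_mult_base[of n "q - 1"] n0 by (simp add: mult.commute)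
  have nq1: "0 < n powr (q - 1)" using n0 by simp
  have a_pos: "0 < a"
  proof (rule ccontr)
    assume "\<not> 0 < a"
    then have "a = 0" using a0 by simp
    then have "(\<Sum>s\<in>F'. I s) \<le> 0" using I_le by (intro sum_nonpos) simp
    then show False using I_sum n0 by (simp add: not_le[symmetric])
  qed
  have I_ge: "(1 - \<delta>) * (n powr (q - 1) * a) \<le> I s" if "s \<in> F'" for s
  proof -
    have "n powr q = I s + (\<Sum>s\<in>F' - {s}. I s)"
      unfolding I_sum[symmetric] by (rule sum.remove[OF F'(1) that])
    also have "(\<Sum>s\<in>F' - {s}. I s) \<le> (\<Sum>s\<in>F' - {s}. n powr (q - 1) * a)" by (intro sum_mono I_le)
    also have "\<dots> = (real (card F') - 1) * (n powr (q - 1) * a)"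
      using F' that card by (simp add: of_nat_diff)
    finally have 1: "n powr (q - 1) * n \<le> I s + (real (card F') - 1) * (n powr (q - 1) * a)"
      unfolding nq by simp
    have "n powr (q - 1) * ((card F' - \<delta>) * a) \<le> n powr (q - 1) * n"
      using large nq1 by (intro mult_left_mono) auto
    with 1 show ?thesis by (simp add: algebra_simps)
  qed
  define A where "A y = norm (T y) powr q / n powr q" for y
  define B where "B s y = norm (k (- s + y)) powr q / a powr q" for s y
  have A0: "0 \<le> A y" and B0: "0 \<le> B s y" for s y by (simp_all add: A_def B_def)
  have Ai: "integrable M A" "(LINT y|M. A y) = 1"
    using T n0 by (auto simp: A_def[abs_def] Lp_space_def n_def simp flip: Lp_norm_powr[OF p0(2)])
  have Bi: "integrable M (B s)" "(LINT y|M. B s y) = 1" for s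
    using Lp_translation[OF k, of "- s"] a_pos
    by (auto simp: B_def[abs_def] Lp_space_def a_def simp flip: Lp_norm_powr[OF p0(2)])
  have AB: "A y powr (1 / p) * B s y powr (1 / q) = norm (h y) * norm (k (- s + y)) / (n powr (q - 1) * a)" for s y
  proof -
    have "A y powr (1 / p) = norm (h y) / n powr (q - 1)"
      using n0 p0 by (simp add: A_def powr_divide powr_powr h_norm T_norm qp)
    moreover have "B s y powr (1 / q) = norm (k (- s + y)) / a"
      using a_pos p0 by (simp add: B_def powr_divide powr_powr)
    ultimately show ?thesis by simp
  qed
  have close: "(LINT y|M. \<bar>A y - B s y\<bar>) \<le> 3 * t" if s: "s \<in> F'" for s
  proof -
    \<comment> \<open>The deficit in Young's inequality has integral at most \<open>\<delta>\<close>.\<close>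
    let ?d = "\<lambda>y. A y / p + B s y / q - A y powr (1 / p) * B s y powr (1 / q)"
    have di: "integrable M ?d" using Ai Bi int unfolding AB by simp
    have "(LINT y|M. ?d y) = 1 / p + 1 / q - I s / (n powr (q - 1) * a)"
      using Ai Bi int unfolding AB I_def by simp
    moreover have "1 - \<delta> \<le> I s / (n powr (q - 1) * a)"
      using I_ge[OF s] nq1 a_pos by (simp add: le_divide_eq)
    ultimately have d: "(LINT y|M. ?d y) \<le> \<delta>" using q by linarith
    have le: "\<bar>A y - B s y\<bar> \<le> ?d y / (c * t) + t * (A y + B s y)" for y
    proof -
      have "c * (sqrt (A y) - sqrt (B s y))\<^sup>2 \<le> ?d y"
        unfolding c_def by (rule refined_Young[OF A0 B0 p q])
      then have "(sqrt (A y) - sqrt (B s y))\<^sup>2 \<le> ?d y / c" using c by (simp add: pos_le_divide_eq mult.commute)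
      then have "(sqrt (A y) - sqrt (B s y))\<^sup>2 / t \<le> ?d y / c / t" using t by (intro divide_right_mono) auto
      then show ?thesis using abs_diff_le_sqrt[OF A0 B0 t, of y s y] by simp
    qed
    have "(LINT y|M. \<bar>A y - B s y\<bar>) \<le> (LINT y|M. ?d y / (c * t) + t * (A y + B s y))"
    proof (rule integral_mono[OF _ _ le])
      show "integrable M (\<lambda>y. \<bar>A y - B s y\<bar>)"
        by (intro integrable_abs Bochner_Integration.integrable_diff Ai Bi)
      show "integrable M (\<lambda>y. ?d y / (c * t) + t * (A y + B s y))"
        by (intro Bochner_Integration.integrable_add integrable_mult_right Ai Bi integrable_divide di)
    qed
    also have "\<dots> = (LINT y|M. ?d y) / (c * t) + t * 2"
      using Ai Bi di by (simp del: Bochner_Integration.integral_diff)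
    also have "\<dots> \<le> \<delta> / (c * t) + t * 2"
      using d c t by (intro add_mono divide_right_mono) auto
    also have "\<delta> / (c * t) \<le> t" using \<delta>(3) c t by (simp add: pos_divide_le_eq mult_ac)
    finally show ?thesis by simp
  qed
  show ?thesis
  proof (rule that[of "B 0"])
    show "0 \<le> B 0 y" "integrable M (B 0)" "(LINT y|M. B 0 y) = 1" for y
      using B0 Bi by auto
    fix s assume "s \<in> F"
    then have s: "s \<in> F'" by (simp add: F'_def)
    have Bs: "B 0 (- s + y) = B s y" for y by (simp add: B_def)
    have "(LINT y|M. \<bar>B s y - B 0 y\<bar>) \<le> (LINT y|M. \<bar>A y - B s y\<bar> + \<bar>A y - B 0 y\<bar>)"
      using Ai Bi by (intro integral_mono Bochner_Integration.integrable_add integrable_abs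
          Bochner_Integration.integrable_diff) auto
    also have "\<dots> = (LINT y|M. \<bar>A y - B s y\<bar>) + (LINT y|M. \<bar>A y - B 0 y\<bar>)"
      using Ai Bi by (intro Bochner_Integration.integral_add integrable_abs Bochner_Integration.integrable_diff)
    also have "\<dots> \<le> 3 * t + 3 * t" using close[OF s] close[OF F'(2)] by linarith
    also have "\<dots> < \<eta>" using \<eta> by (simp add: t_def)
    finally show "(LINT y|M. \<bar>B 0 (- s + y) - B 0 y\<bar>) < \<eta>" by (simp add: Bs)
  qed
qed

end

section \<open>Invariant means\<close>

lemma closed_Collect_Ball:
  assumes "\<And>a. a \<in> A \<Longrightarrow> closed {m. P m a}" shows "closed {m. \<forall>a\<in>A. P m a}"
proof -
  have "{m. \<forall>a\<in>A. P m a} = (\<Inter>a\<in>A. {m. P m a})" by auto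
  then show ?thesis using assms by (simp add: closed_INT)
qed

context haar_group
begin

text \<open>
  An integrable function lives on a countable union of sets of finite measure, where locally null sets are null.
\<close>

lemma locally_ae_on_integrable:
  fixes \<phi> :: "'a \<Rightarrow> real"
  assumes \<phi>: "integrable M \<phi>" and P: "locally_ae M P"
  shows "AE y in M. \<phi> y \<noteq> 0 \<longrightarrow> P y"
proof -
  have "AE y in M. 1 / Suc n \<le> \<bar>\<phi> y\<bar> \<longrightarrow> P y" for n
  proof -
    let ?F = "{y \<in> space M. 1 / Suc n \<le> \<bar>\<phi> y\<bar>}"
    have m: "?F \<in> sets M" using \<phi> by measurable
    have "emeasure M ?F < \<infinity>"
      using finite_level_set[OF integrable_abs[OF \<phi>], of "1 / Suc n"] by simp
    then have "AE y in M. y \<in> ?F \<longrightarrow> P y" using P m unfolding locally_ae_def by blast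
    then show ?thesis by simp
  qed
  then have "AE y in M. \<forall>n. 1 / Suc n \<le> \<bar>\<phi> y\<bar> \<longrightarrow> P y"
    by (intro AE_all_countable[THEN iffD2] allI)
  then show ?thesis
  proof eventually_elim
    case (elim y)
    show ?case
    proof
      assume "\<phi> y \<noteq> 0"
      then obtain n where "1 / Suc n < \<bar>\<phi> y\<bar>" by (metis nat_approx_posE zero_less_abs_iff)
      then show "P y" using elim by (meson less_imp_le)
    qed
  qed
qed

lemma locally_ae_mono: "locally_ae M P \<Longrightarrow> (\<And>x. P x \<Longrightarrow> Q x) \<Longrightarrow> locally_ae M Q"
  unfolding locally_ae_def by (auto elim!: eventually_mono)

lemma locally_ae_conj:
  assumes "locally_ae M P" "locally_ae M Q" shows "locally_ae M (\<lambda>x. P x \<and> Q x)"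
  unfolding locally_ae_def
proof (intro ballI impI)
  fix F assume "F \<in> sets M" "emeasure M F < \<infinity>"
  then have "AE x in M. x \<in> F \<longrightarrow> P x" "AE x in M. x \<in> F \<longrightarrow> Q x"
    using assms by (auto simp: locally_ae_def)
  then show "AE x in M. x \<in> F \<longrightarrow> P x \<and> Q x" by eventually_elim auto
qed

lemma Linf_space_I: "f \<in> borel_measurable M \<Longrightarrow> locally_ae M (\<lambda>x. norm (f x) \<le> C) \<Longrightarrow> f \<in> Linf_space M"
  by (auto simp: Linf_space_def)

lemma Linf_space_E:
  assumes "f \<in> Linf_space M"
  obtains C where "f \<in> borel_measurable M" "0 \<le> C" "locally_ae M (\<lambda>x. norm (f x) \<le> C)"
proof -
  obtain C where "f \<in> borel_measurable M" "locally_ae M (\<lambda>x. norm (f x) \<le> C)"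
    using assms by (auto simp: Linf_space_def)
  moreover have "locally_ae M (\<lambda>x. norm (f x) \<le> max 0 C)"
    using calculation(2) by (rule locally_ae_mono) auto
  ultimately show ?thesis using that[of "max 0 C"] by auto
qed

lemma Linf_add:
  assumes f: "f \<in> Linf_space M" and g: "g \<in> Linf_space M"
  shows "(\<lambda>x. f x + g x) \<in> Linf_space M"
proof -
  obtain C where C: "f \<in> borel_measurable M" "locally_ae M (\<lambda>x. norm (f x) \<le> C)" using f by (rule Linf_space_E)
  obtain C' where C': "g \<in> borel_measurable M" "locally_ae M (\<lambda>x. norm (g x) \<le> C')" using g by (rule Linf_space_E)
  have "locally_ae M (\<lambda>x. norm (f x + g x) \<le> C + C')"
    using locally_ae_conj[OF C(2) C'(2)] by (rule locally_ae_mono) (auto intro: norm_triangle_le)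
  then show ?thesis using C(1) C'(1) by (intro Linf_space_I borel_measurable_add)
qed

lemma Linf_scale:
  assumes f: "f \<in> Linf_space M" shows "(\<lambda>x. c * f x) \<in> Linf_space M"
proof -
  obtain C where C: "f \<in> borel_measurable M" "locally_ae M (\<lambda>x. norm (f x) \<le> C)" using f by (rule Linf_space_E)
  have "locally_ae M (\<lambda>x. norm (c * f x) \<le> norm c * C)"
    using C(2) by (rule locally_ae_mono) (auto simp: norm_mult mult_left_mono)
  then show ?thesis using C(1) by (intro Linf_space_I borel_measurable_times) auto
qed

lemma Linf_one: "(\<lambda>x. 1) \<in> Linf_space M"
  by (rule Linf_space_I[of _ 1]) (auto simp: locally_ae_def)

lemma Linf_left_translate:
  assumes f: "f \<in> Linf_space M" shows "left_translate x f \<in> Linf_space M"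
proof -
  obtain C where fm [measurable]: "f \<in> borel_measurable M" and C: "locally_ae M (\<lambda>x. norm (f x) \<le> C)"
    using f by (rule Linf_space_E)
  have "locally_ae M (\<lambda>y. norm (f (- x + y)) \<le> C)"
    unfolding locally_ae_def
  proof (intro ballI impI)
    fix F assume F: "F \<in> sets M" "emeasure M F < \<infinity>"
    define F' where "F' = (\<lambda>y. x + y) -` F \<inter> space M"
    have F': "F' \<in> sets M" unfolding F'_def by (rule measurable_sets[OF translation_measurable F(1)])
    have "emeasure M F' = emeasure (distr M M (\<lambda>y. x + y)) F"
      unfolding F'_def by (rule emeasure_distr[OF translation_measurable F(1), symmetric])
    then have "emeasure M F' < \<infinity>" using F(2) by (simp add: distr_translation)
    then have "AE y in M. y \<in> F' \<longrightarrow> norm (f y) \<le> C" using C F' by (simp add: locally_ae_def)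
    then have "AE y in distr M M (\<lambda>y. - x + y). y \<in> F' \<longrightarrow> norm (f y) \<le> C"
      by (subst distr_translation)
    from AE_distrD[OF translation_measurable this]
    have "AE y in M. - x + y \<in> F' \<longrightarrow> norm (f (- x + y)) \<le> C" .
    then show "AE y in M. y \<in> F \<longrightarrow> norm (f (- x + y)) \<le> C"
      by eventually_elim (simp add: F'_def add.assoc[symmetric])
  qed
  moreover have "(\<lambda>y. f (- x + y)) \<in> borel_measurable M"
    using measurable_compose[OF translation_measurable fm] .
  ultimately show ?thesis unfolding left_translate_def[abs_def] by (intro Linf_space_I)
qed

lemma Linf_norm_nonneg:
  assumes "f \<in> Linf_space M" shows "0 \<le> Linf_norm M f"
  unfolding Linf_norm_def using assms by (intro cInf_greatest) (auto elim: Linf_space_E)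

lemma
  fixes \<phi> :: "'a \<Rightarrow> real"
  assumes \<phi>: "integrable M \<phi>" and f: "f \<in> Linf_space M"
  shows integrable_mult_Linf: "integrable M (\<lambda>y. of_real (\<phi> y) * f y)"
    and integral_mult_Linf_le: "norm (LINT y|M. of_real (\<phi> y) * f y) \<le> (LINT y|M. \<bar>\<phi> y\<bar>) * Linf_norm M f"
proof -
  have [measurable]: "f \<in> borel_measurable M" "\<phi> \<in> borel_measurable M"
    using f \<phi> by (auto simp: Linf_space_def)
  have bound: "AE y in M. norm (of_real (\<phi> y) * f y) \<le> \<bar>\<phi> y\<bar> * C" if "locally_ae M (\<lambda>x. norm (f x) \<le> C)" for C
    using locally_ae_on_integrable[OF \<phi> that]
  proof eventually_elim
    case (elim y)
    then show ?case by (cases "\<phi> y = 0") (auto simp: norm_mult intro: mult_left_mono)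
  qed
  obtain C0 where "0 \<le> C0" and C0: "locally_ae M (\<lambda>x. norm (f x) \<le> C0)" using f by (rule Linf_space_E)
  show int: "integrable M (\<lambda>y. of_real (\<phi> y) * f y)"
  proof (rule Bochner_Integration.integrable_bound)
    show "integrable M (\<lambda>y. \<bar>\<phi> y\<bar> * C0)" using \<phi> by simp
    show "AE y in M. norm (of_real (\<phi> y) * f y) \<le> norm (\<bar>\<phi> y\<bar> * C0)"
      using bound[OF C0] \<open>0 \<le> C0\<close> by (simp add: abs_mult)
  qed measurable
  define I where "I = (LINT y|M. \<bar>\<phi> y\<bar>)"
  have I: "0 \<le> I" by (simp add: I_def)
  have le: "norm (LINT y|M. of_real (\<phi> y) * f y) \<le> I * C" if "Linf_norm M f < C" for C
  proof -
    have "{C. 0 \<le> C \<and> locally_ae M (\<lambda>x. norm (f x) \<le> C)} \<noteq> {}" using C0 \<open>0 \<le> C0\<close> by blast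
    from cInf_lessD[OF this that[unfolded Linf_norm_def]]
    obtain C' where C': "C' < C" "locally_ae M (\<lambda>x. norm (f x) \<le> C')" by auto
    have "locally_ae M (\<lambda>x. norm (f x) \<le> C)" using C'(2) by (rule locally_ae_mono) (use C'(1) in auto)
    note bd = bound[OF this]
    have "norm (LINT y|M. of_real (\<phi> y) * f y) \<le> (LINT y|M. norm (of_real (\<phi> y) * f y))"
      by (rule integral_norm_bound)
    also have "\<dots> \<le> (LINT y|M. \<bar>\<phi> y\<bar> * C)"
      using int \<phi> bd by (intro integral_mono_AE) auto
    also have "\<dots> = I * C" by (simp add: I_def)
    finally show ?thesis .
  qed
  show "norm (LINT y|M. of_real (\<phi> y) * f y) \<le> (LINT y|M. \<bar>\<phi> y\<bar>) * Linf_norm M f"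
    unfolding I_def[symmetric]
  proof (rule field_le_epsilon)
    fix \<epsilon> :: real assume "0 < \<epsilon>"
    have "norm (LINT y|M. of_real (\<phi> y) * f y) \<le> I * (Linf_norm M f + \<epsilon> / (I + 1))"
      using \<open>0 < \<epsilon>\<close> I by (intro le) simp
    also have "\<dots> = I * Linf_norm M f + I * (\<epsilon> / (I + 1))" by (simp add: algebra_simps)
    also have "I * (\<epsilon> / (I + 1)) \<le> \<epsilon>" using \<open>0 < \<epsilon>\<close> I by (simp add: field_simps)
    finally show "norm (LINT y|M. of_real (\<phi> y) * f y) \<le> I * Linf_norm M f + \<epsilon>" by simp
  qed
qed

text \<open>
  The value \<open>0\<close> outside \<open>L\<^sup>\<infinity>\<close> places every density functional in one compact product of discs.
\<close>

definition density_functional :: "('a \<Rightarrow> real) \<Rightarrow> ('a \<Rightarrow> complex) \<Rightarrow> complex" where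
  "density_functional \<phi> f = (if f \<in> Linf_space M then LINT y|M. of_real (\<phi> y) * f y else 0)"

definition means :: "(('a \<Rightarrow> complex) \<Rightarrow> complex) set" where
  "means = {m. (\<forall>f\<in>Linf_space M. \<forall>g\<in>Linf_space M. m (\<lambda>x. f x + g x) = m f + m g) \<and>
     (\<forall>c. \<forall>f\<in>Linf_space M. m (\<lambda>x. c * f x) = c * m f) \<and>
     (\<forall>f\<in>{f \<in> Linf_space M. locally_ae M (\<lambda>x. f x \<in> \<real>\<^sub>\<ge>\<^sub>0)}. m f \<in> \<real>\<^sub>\<ge>\<^sub>0) \<and>
     m (\<lambda>x. 1) = 1}"

lemma closed_means: "closed means"
  unfolding means_def
proof (intro closed_Collect_conj closed_Collect_Ball closed_Collect_all closed_Collect_eq)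
  show "closed {m. (m f :: complex) \<in> \<real>\<^sub>\<ge>\<^sub>0}" for f :: "'a \<Rightarrow> complex"
    using closed_vimage[OF closed_nonneg_Reals_complex continuous_on_product_coordinates[of f]]
    by (simp add: vimage_def)
qed (auto intro!: continuous_intros)

lemma density_functional_mean:
  assumes \<phi>: "integrable M \<phi>" "\<And>y. 0 \<le> \<phi> y" "(LINT y|M. \<phi> y) = 1"
  shows "density_functional \<phi> \<in> means"
    and "f \<in> Linf_space M \<Longrightarrow> norm (density_functional \<phi> f) \<le> Linf_norm M f"
proof -
  note int = integrable_mult_Linf[OF \<phi>(1)]
  have pos: "density_functional \<phi> f \<in> \<real>\<^sub>\<ge>\<^sub>0" if f: "f \<in> Linf_space M" and ae: "locally_ae M (\<lambda>x. f x \<in> \<real>\<^sub>\<ge>\<^sub>0)" for f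
  proof -
    have fm [measurable]: "f \<in> borel_measurable M" and [measurable]: "\<phi> \<in> borel_measurable M"
      using f \<phi> by (auto simp: Linf_space_def)
    have AE: "AE y in M. \<phi> y \<noteq> 0 \<longrightarrow> f y \<in> \<real>\<^sub>\<ge>\<^sub>0" by (rule locally_ae_on_integrable[OF \<phi>(1) ae])
    have "(LINT y|M. of_real (\<phi> y) * f y) = (LINT y|M. complex_of_real (\<phi> y * Re (f y)))"
    proof (rule integral_cong_AE)
      show "AE y in M. of_real (\<phi> y) * f y = complex_of_real (\<phi> y * Re (f y))"
        using AE by eventually_elim (auto simp: complex_nonneg_Reals_iff complex_eq_iff)
    qed measurable
    also have "\<dots> = of_real (LINT y|M. \<phi> y * Re (f y))" by (rule integral_complex_of_real)
    finally have "(LINT y|M. of_real (\<phi> y) * f y) = of_real (LINT y|M. \<phi> y * Re (f y))" .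
    moreover have "0 \<le> (LINT y|M. \<phi> y * Re (f y))"
    proof (rule integral_nonneg_AE)
      show "AE y in M. 0 \<le> \<phi> y * Re (f y)"
        using AE
      proof eventually_elim
        case (elim y)
        then show ?case using \<phi>(2)[of y] by (cases "\<phi> y = 0") (auto simp: complex_nonneg_Reals_iff)
      qed
    qed
    ultimately show ?thesis using f by (simp add: density_functional_def)
  qed
  show "density_functional \<phi> \<in> means"
    unfolding means_def mem_Collect_eq
  proof (intro conjI ballI allI)
    fix f g assume "f \<in> Linf_space M" "g \<in> Linf_space M"
    then show "density_functional \<phi> (\<lambda>x. f x + g x) = density_functional \<phi> f + density_functional \<phi> g"
      using Linf_add[of f g] int[of f] int[of g] by (simp add: density_functional_def distrib_left)
  next
    fix c f assume f: "f \<in> Linf_space M"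
    have "(\<lambda>y. of_real (\<phi> y) * (c * f y)) = (\<lambda>y. c * (of_real (\<phi> y) * f y))" by (simp add: mult_ac)
    then show "density_functional \<phi> (\<lambda>x. c * f x) = c * density_functional \<phi> f"
      using f Linf_scale[OF f, of c] by (simp add: density_functional_def)
  next
    show "density_functional \<phi> (\<lambda>x. 1) = 1"
      using \<phi>(3) by (simp add: density_functional_def Linf_one)
  qed (use pos in auto)
  show "norm (density_functional \<phi> f) \<le> Linf_norm M f" if f: "f \<in> Linf_space M"
    using integral_mult_Linf_le[OF \<phi>(1) f] \<phi>(2,3) f by (simp add: density_functional_def)
qed

lemma density_functional_left_translate:
  assumes \<phi>: "integrable M \<phi>" and f: "f \<in> Linf_space M"
  shows "norm (density_functional \<phi> (left_translate x f) - density_functional \<phi> f) \<le>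
    (LINT y|M. \<bar>\<phi> (x + y) - \<phi> y\<bar>) * Linf_norm M f"
proof -
  have [measurable]: "f \<in> borel_measurable M" "\<phi> \<in> borel_measurable M"
    using f \<phi> by (auto simp: Linf_space_def)
  have m: "(\<lambda>y. f (- x + y)) \<in> borel_measurable M"
    by (rule measurable_compose[OF translation_measurable]) measurable
  have "(LINT y|M. of_real (\<phi> y) * f (- x + y)) = (LINT y|M. of_real (\<phi> (x + y)) * f (- x + (x + y)))"
    using m by (intro integral_translation[symmetric]) measurable
  also have "\<dots> = (LINT y|M. of_real (\<phi> (x + y)) * f y)" by (simp add: add.assoc[symmetric])
  finally have 1: "(LINT y|M. of_real (\<phi> y) * f (- x + y)) = (LINT y|M. of_real (\<phi> (x + y)) * f y)" .
  have \<phi>': "integrable M (\<lambda>y. \<phi> (x + y))" by (rule integrable_translation[OF \<phi>])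
  have "density_functional \<phi> (left_translate x f) - density_functional \<phi> f =
      (LINT y|M. of_real (\<phi> (x + y)) * f y) - (LINT y|M. of_real (\<phi> y) * f y)"
    using f Linf_left_translate[OF f, of x] by (simp add: density_functional_def left_translate_def 1)
  also have "\<dots> = (LINT y|M. of_real (\<phi> (x + y)) * f y - of_real (\<phi> y) * f y)"
    by (rule Bochner_Integration.integral_diff[symmetric, OF integrable_mult_Linf[OF \<phi>' f] integrable_mult_Linf[OF \<phi> f]])
  also have "\<dots> = (LINT y|M. of_real (\<phi> (x + y) - \<phi> y) * f y)" by (simp add: algebra_simps)
  finally show ?thesis
    using integral_mult_Linf_le[OF Bochner_Integration.integrable_diff[OF \<phi>' \<phi>] f] by simp
qed

text \<open>
  Density functionals lie in a compact product of discs indexed by functions. The functionals that are invariant under \<open>x\<close> up to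
  \<open>1/(n+1)\<close> form closed sets, and almost invariant densities give these sets the finite intersection property.
\<close>

lemma amenable_if_almost_invariant_densities:
  assumes "\<And>F \<eta>. finite F \<Longrightarrow> 0 < \<eta> \<Longrightarrow> \<exists>\<phi> :: 'a \<Rightarrow> real. (\<forall>y. 0 \<le> \<phi> y) \<and> integrable M \<phi> \<and>
    (LINT y|M. \<phi> y) = 1 \<and> (\<forall>s\<in>F. (LINT y|M. \<bar>\<phi> (- s + y) - \<phi> y\<bar>) < \<eta>)"
  shows "amenable M"
proof -
  define X where "X f = (if f \<in> Linf_space M then cball 0 (Linf_norm M f) else {0 :: complex})" for f
  define S where "S = PiE UNIV X \<inter> means"
  have "compactin (product_topology (\<lambda>f. euclidean) UNIV) (PiE UNIV X)"
    by (intro compactin_PiE[THEN iffD2] disjI2 ballI) (auto simp: X_def)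
  then have "compact (PiE UNIV X)" by (simp add: euclidean_product_topology)
  then have S: "compact S" unfolding S_def by (rule compact_Int_closed[OF _ closed_means])
  define Inv where "Inv i = {m. \<forall>f\<in>Linf_space M.
      norm (m (left_translate (fst i) f) - m f :: complex) \<le> Linf_norm M f / Suc (snd i)}" for i :: "'a \<times> nat"
  have "S \<inter> (\<Inter>i\<in>UNIV. Inv i) \<noteq> {}"
  proof (rule compact_imp_fip_image[OF S])
    show "closed (Inv i)" for i
      unfolding Inv_def by (intro closed_Collect_Ball closed_Collect_le continuous_intros) auto
    fix I :: "('a \<times> nat) set" assume I: "finite I"
    define N where "N = Max (insert 0 (snd ` I))"
    have N: "snd i \<le> N" if "i \<in> I" for i using I that by (auto simp: N_def)
    have "0 < 1 / real (Suc N)" by simp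
    from assms[OF finite_imageI[OF I] this, of "\<lambda>i. - fst i"]
    obtain \<phi> :: "'a \<Rightarrow> real" where \<phi>: "\<forall>y. 0 \<le> \<phi> y" "integrable M \<phi>" "(LINT y|M. \<phi> y) = 1"
      "\<forall>s\<in>(\<lambda>i. - fst i) ` I. (LINT y|M. \<bar>\<phi> (- s + y) - \<phi> y\<bar>) < 1 / Suc N"
      by (elim exE conjE)
    have "density_functional \<phi> \<in> S"
      unfolding S_def PiE_UNIV_domain
      using density_functional_mean[OF \<phi>(2) _ \<phi>(3)] \<phi>(1)
      by (auto simp: X_def density_functional_def)
    moreover have "density_functional \<phi> \<in> Inv i" if i: "i \<in> I" for i
      unfolding Inv_def
    proof (intro CollectI ballI)
      fix f assume f: "f \<in> Linf_space M"
      have "(LINT y|M. \<bar>\<phi> (fst i + y) - \<phi> y\<bar>) \<le> 1 / Suc N"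
        using bspec[OF \<phi>(4), of "- fst i"] i by force
      also have "\<dots> \<le> 1 / Suc (snd i)" using N[OF i] by (simp add: field_simps)
      finally have "(LINT y|M. \<bar>\<phi> (fst i + y) - \<phi> y\<bar>) * Linf_norm M f \<le> 1 / Suc (snd i) * Linf_norm M f"
        by (intro mult_right_mono Linf_norm_nonneg[OF f])
      with density_functional_left_translate[OF \<phi>(2) f, of "fst i"]
      show "norm (density_functional \<phi> (left_translate (fst i) f) - density_functional \<phi> f) \<le> Linf_norm M f / Suc (snd i)"
        by simp
    qed
    ultimately show "S \<inter> (\<Inter>i\<in>I. Inv i) \<noteq> {}" by blast
  qed
  then obtain m where mS: "m \<in> S" and mI: "\<And>i. m \<in> Inv i" by auto
  have mean: "m \<in> means" and mX: "\<And>f. m f \<in> X f" using mS by (auto simp: S_def)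
  have "m (left_translate x f) = m f" if f: "f \<in> Linf_space M" for x f
  proof -
    have le: "norm (m (left_translate x f) - m f) \<le> Linf_norm M f / Suc n" for n
      using mI[of "(x, n)"] f by (simp add: Inv_def)
    have "(\<lambda>n. Linf_norm M f / Suc n) \<longlonglongrightarrow> 0"
      using tendsto_mult_right_zero[OF LIMSEQ_inverse_real_of_nat, of "Linf_norm M f"]
      by (simp add: divide_inverse)
    then have "norm (m (left_translate x f) - m f) \<le> 0"
      by (rule LIMSEQ_le_const) (use le in auto)
    then show ?thesis by simp
  qed
  moreover have "m \<in> Linf_dual M"
  proof -
    have "\<exists>K. \<forall>f\<in>Linf_space M. norm (m f) \<le> K * Linf_norm M f"
    proof (intro exI[of _ 1] ballI)
      fix f assume "f \<in> Linf_space M"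
      then show "norm (m f) \<le> 1 * Linf_norm M f" using mX[of f] by (simp add: X_def)
    qed
    then show ?thesis using mean by (simp add: Linf_dual_def means_def)
  qed
  ultimately show ?thesis
    using mean unfolding amenable_def means_def by (intro bexI[of _ m]) auto
qed

end

section \<open>Ideals with a bounded approximate identity\<close>

context Lp_group
begin

text \<open>
  Take a bump function \<open>f\<close> supported in \<open>U\<close> with \<open>yUU\<inverse>\<close> disjoint from \<open>H\<close>, and convolve its translate by \<open>y\<close> with
  \<open>f~\<close>: the value at \<open>y\<close> is \<open>\<integral> f\<^sup>2 > 0\<close>, and the support lies in \<open>yUU\<inverse>\<close>.
\<close>

lemma coefficient_function_at_point:
  assumes H: "closed H" and y: "y \<notin> H"
  obtains f g where "compactly_supported f" "compactly_supported g"
    "convolution M f (tilde g) y \<noteq> 0" "\<And>x. x \<in> H \<Longrightarrow> convolution M f (tilde g) x = 0"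
proof -
  have "open ((\<lambda>z. y + z) -` (- H))" using H by (intro open_vimage continuous_intros) auto
  moreover have "0 \<in> (\<lambda>z. y + z) -` (- H)" using y by simp
  ultimately obtain U where U: "open U" "0 \<in> U" "\<And>u v. u \<in> U \<Longrightarrow> v \<in> U \<Longrightarrow> u - v \<in> (\<lambda>z. y + z) -` (- H)"
    using diff_neighbourhood by metis
  obtain f :: "'a \<Rightarrow> real" where f: "compactly_supported f" "f 0 = 1" "\<And>x. x \<notin> U \<Longrightarrow> f x = 0" "\<And>x. 0 \<le> f x"
    using bump_function[OF locally_compact U(1,2)] by metis
  have fcont: "continuous_on UNIV f" using f(1) by (simp add: compactly_supported_def)
  define g where "g x = complex_of_real (f x)" for x
  have g: "compactly_supported g"
    using f(1) unfolding compactly_supported_def g_def by (auto intro!: continuous_intros)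
  have g2: "compactly_supported (\<lambda>x. g x * cnj (g x))"
    using g unfolding compactly_supported_def by (auto intro!: continuous_intros)
  have gm: "g \<in> borel_measurable M" using g by (intro continuous_imp_measurable) (simp add: compactly_supported_def)
  define h where "h z = g (- y + z)" for z
  show ?thesis
  proof (rule that)
    show "compactly_supported h" unfolding h_def[abs_def] by (rule compactly_supported_add_left[OF g])
    show "compactly_supported g" by (rule g)
    show "convolution M h (tilde g) y \<noteq> 0"
    proof
      assume 0: "convolution M h (tilde g) y = 0"
      have "convolution M h (tilde g) y = (LINT z|M. g z * cnj (g z))"
        unfolding convolution_tilde h_def
        by (rule integral_translation) (use gm in measurable)
      also have "\<dots> = (LINT z|M. complex_of_real ((f z)\<^sup>2))" by (simp add: g_def power2_eq_square)
      also have "\<dots> = of_real (LINT z|M. (f z)\<^sup>2)" by (rule integral_complex_of_real)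
      finally have "(LINT z|M. (f z)\<^sup>2) = 0" using 0 by simp
      moreover have "integrable M (\<lambda>z. (f z)\<^sup>2)"
        using integrable_norm[OF compactly_supported_integrable[OF g2]]
        by (simp add: g_def norm_mult power2_eq_square)
      ultimately have "AE z in M. (f z)\<^sup>2 = 0"
        by (subst (asm) integral_nonneg_eq_0_iff_AE) auto
      then have AE: "AE z in M. z \<notin> f -` {0<..}" by eventually_elim auto
      have op: "open (f -` {0<..})" by (rule open_vimage[OF _ fcont]) simp
      then have "f -` {0<..} \<in> null_sets M" using AE by (subst AE_iff_null_sets) auto
      moreover have "emeasure M (f -` {0<..}) \<noteq> 0" using f(2) by (intro emeasure_open_pos[OF op, of 0]) simp
      ultimately show False by auto
    qed
    fix x assume x: "x \<in> H"
    have "h z * cnj (g (- x + z)) = 0" for z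
    proof (rule ccontr)
      assume "h z * cnj (g (- x + z)) \<noteq> 0"
      then have "- y + z \<in> U" "- x + z \<in> U" using f(3) by (fastforce simp: h_def g_def)+
      then have "y + ((- y + z) - (- x + z)) \<notin> H" using U(3) by blast
      moreover have "y + ((- y + z) - (- x + z)) = x"
        by (simp add: diff_conv_add_uminus minus_add add.assoc del: add_uminus_conv_diff)
      ultimately show False using x by simp
    qed
    then show "convolution M h (tilde g) x = 0"
      by (simp only: convolution_tilde Bochner_Integration.integral_zero)
  qed
qed

text \<open>
  Divide \<open>\<bar>b(y) e(y) - b(y)\<bar> \<le> \<parallel>b e - b\<parallel>\<close> by \<open>\<bar>b(y)\<bar>\<close>, where \<open>b\<close> belongs to the ideal and \<open>b(y) \<noteq> 0\<close>.
\<close>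

lemma approximate_identity_near_1:
  assumes H: "closed H" and e: "bounded_approximate_identity (Ip_ideal M p H) (Ap_norm M p) D r e"
    and Y: "finite Y" "Y \<inter> H = {}"
  obtains \<beta> where "\<beta> \<in> D" "\<And>y. y \<in> Y \<Longrightarrow> norm (e \<beta> y - 1) < 1 / 2"
proof -
  have D: "directed_set D r" and e_in: "\<And>\<alpha>. \<alpha> \<in> D \<Longrightarrow> e \<alpha> \<in> Ip_ideal M p H"
    and e_lim: "\<And>b \<epsilon>. b \<in> Ip_ideal M p H \<Longrightarrow> 0 < \<epsilon> \<Longrightarrow>
      \<exists>\<alpha>\<in>D. \<forall>\<beta>. (\<alpha>, \<beta>) \<in> r \<longrightarrow> Ap_norm M p (\<lambda>x. b x * e \<beta> x - b x) < \<epsilon>"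
    using e by (auto simp: bounded_approximate_identity_def)
  have one: "\<exists>\<alpha>\<in>D. \<forall>\<beta>\<in>D. (\<alpha>, \<beta>) \<in> r \<longrightarrow> norm (e \<beta> y - 1) < 1 / 2" if "y \<in> Y" for y
  proof -
    have "y \<notin> H" using that Y by auto
    then obtain f g where f: "compactly_supported f" and g: "compactly_supported g"
      and by0: "convolution M f (tilde g) y \<noteq> 0" and bH: "\<And>x. x \<in> H \<Longrightarrow> convolution M f (tilde g) x = 0"
      using coefficient_function_at_point[OF H] by metis
    define b where "b = convolution M f (tilde g)"
    have "b \<in> Ip_ideal M p H" using convolution_in_Ap[OF f g] bH by (simp add: Ip_ideal_def b_def)
    then obtain \<alpha> where \<alpha>: "\<alpha> \<in> D"
      "\<And>\<beta>. (\<alpha>, \<beta>) \<in> r \<Longrightarrow> Ap_norm M p (\<lambda>x. b x * e \<beta> x - b x) < norm (b y) / 2"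
      using e_lim[of b "norm (b y) / 2"] by0 by (auto simp: b_def)
    have "norm (e \<beta> y - 1) < 1 / 2" if \<beta>: "\<beta> \<in> D" "(\<alpha>, \<beta>) \<in> r" for \<beta>
    proof -
      have "e \<beta> \<in> Ap_space M p" using e_in[OF \<beta>(1)] by (simp add: Ip_ideal_def)
      from norm_le_Ap_norm[OF product_minus_in_Ap[OF f g this], of y]
      have "norm (b y * e \<beta> y - b y) < norm (b y) / 2" using \<alpha>(2)[OF \<beta>(2)] by (simp add: b_def)
      also have "b y * e \<beta> y - b y = b y * (e \<beta> y - 1)" by (simp add: algebra_simps)
      finally have "norm (b y) * norm (e \<beta> y - 1) < norm (b y) * (1 / 2)" by (simp add: norm_mult)
      then show ?thesis using by0 by (simp add: b_def)
    qed
    then show ?thesis using \<alpha>(1) by blast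
  qed
  have "\<exists>\<gamma>\<in>D. \<forall>y\<in>Y'. \<forall>\<beta>\<in>D. (\<gamma>, \<beta>) \<in> r \<longrightarrow> norm (e \<beta> y - 1) < 1 / 2" if "Y' \<subseteq> Y" for Y'
    using finite_subset[OF that Y(1)] that
  proof (induction Y' rule: finite_induct)
    case empty
    then show ?case using D by (auto simp: directed_set_def)
  next
    case (insert y Y')
    then obtain \<gamma> where \<gamma>: "\<gamma> \<in> D" "\<forall>y\<in>Y'. \<forall>\<beta>\<in>D. (\<gamma>, \<beta>) \<in> r \<longrightarrow> norm (e \<beta> y - 1) < 1 / 2" by auto
    obtain \<alpha> where \<alpha>: "\<alpha> \<in> D" "\<forall>\<beta>\<in>D. (\<alpha>, \<beta>) \<in> r \<longrightarrow> norm (e \<beta> y - 1) < 1 / 2" using one[of y] insert.prems by blast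
    obtain \<delta> where \<delta>: "\<delta> \<in> D" "(\<alpha>, \<delta>) \<in> r" "(\<gamma>, \<delta>) \<in> r" using D \<alpha>(1) \<gamma>(1) unfolding directed_set_def by blast
    have "trans r" using D by (simp add: directed_set_def preorder_on_def)
    then have "(\<alpha>, \<beta>) \<in> r \<and> (\<gamma>, \<beta>) \<in> r" if "(\<delta>, \<beta>) \<in> r" for \<beta> using \<delta> that by (meson transD)
    then show ?case using \<alpha>(2) \<gamma>(2) \<delta>(1) by (intro bexI[of _ \<delta>]) auto
  qed
  then obtain \<gamma> where \<gamma>: "\<gamma> \<in> D" "\<forall>y\<in>Y. \<forall>\<beta>\<in>D. (\<gamma>, \<beta>) \<in> r \<longrightarrow> norm (e \<beta> y - 1) < 1 / 2" by blast
  have "(\<gamma>, \<gamma>) \<in> r" using D \<gamma>(1) by (auto simp: directed_set_def preorder_on_def refl_on_def)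
  then show ?thesis using that[of \<gamma>] \<gamma> by blast
qed

text \<open>
  A point \<open>x\<close> cannot lie in both cosets \<open>H\<close> and \<open>aH\<close>. So one of \<open>e(x)\<close>, \<open>e(a\<inverse>x)\<close> is close to \<open>1\<close>, and the other is
  either close to \<open>1\<close> or zero.
\<close>

lemma bounded_locally_large_if_approximate_identity:
  assumes H: "add_subgroup H" "closed H" "H \<noteq> UNIV"
    and e: "bounded_approximate_identity (Ip_ideal M p H) (Ap_norm M p) D r e"
  obtains C where "bounded_locally_large C"
proof -
  obtain a where a: "a \<notin> H" using H(3) by blast
  obtain C where C: "\<forall>\<alpha>\<in>D. Ap_norm M p (e \<alpha>) \<le> C"
    using e unfolding bounded_approximate_identity_def by blast
  have e_in: "\<And>\<alpha>. \<alpha> \<in> D \<Longrightarrow> e \<alpha> \<in> Ip_ideal M p H"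
    using e by (simp add: bounded_approximate_identity_def)
  have "bounded_locally_large ((C + 1) + (C + 1))"
    unfolding bounded_locally_large_def
  proof (intro allI impI)
    fix X :: "'a set" assume X: "finite X"
    define Y where "Y = (X \<union> (\<lambda>x. - a + x) ` X) - H"
    have Y: "finite Y" "Y \<inter> H = {}" using X by (auto simp: Y_def)
    obtain \<beta> where \<beta>: "\<beta> \<in> D" "\<And>y. y \<in> Y \<Longrightarrow> norm (e \<beta> y - 1) < 1 / 2"
      using approximate_identity_near_1[OF H(2) e Y] by metis
    have e\<beta>: "e \<beta> \<in> Ap_space M p" "\<And>x. x \<in> H \<Longrightarrow> e \<beta> x = 0"
      using e_in[OF \<beta>(1)] by (auto simp: Ip_ideal_def)
    have "Ap_norm M p (e \<beta>) < C + 1" using bspec[OF C \<beta>(1)] by simp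
    then have bd: "Ap_bounded_by M p (e \<beta>) (C + 1)" by (rule Ap_norm_less_imp_Ap_bounded_by[OF e\<beta>(1)])
    have large: "1 / 2 \<le> Re (e \<beta> y)" if "y \<in> Y" for y
    proof -
      have "\<bar>Re (e \<beta> y - 1)\<bar> < 1 / 2" using \<beta>(2)[OF that] abs_Re_le_cmod le_less_trans by blast
      then have "- (1 / 2) < Re (e \<beta> y - 1)" by linarith
      then show ?thesis by simp
    qed
    have "1 / 2 \<le> Re (e \<beta> x + e \<beta> (- a + x))" if x: "x \<in> X" for x
    proof -
      have "x \<notin> H \<or> - a + x \<notin> H"
      proof (rule ccontr)
        assume "\<not> (x \<notin> H \<or> - a + x \<notin> H)"
        then have xH: "x \<in> H" "- a + x \<in> H" by auto
        have "- (- a + x) \<in> H" using H(1) xH(2) unfolding add_subgroup_def by blast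
        with xH(1) have "x + - (- a + x) \<in> H" using H(1) unfolding add_subgroup_def by blast
        moreover have "x + - (- a + x) = a" by (simp add: minus_add add.assoc[symmetric] del: add_uminus_conv_diff)
        ultimately show False using a by simp
      qed
      then have "x \<in> Y \<and> - a + x \<in> Y \<or> x \<in> Y \<and> - a + x \<in> H \<or> x \<in> H \<and> - a + x \<in> Y"
        using x by (auto simp: Y_def)
      then show ?thesis using large[of x] large[of "- a + x"] e\<beta>(2)[of x] e\<beta>(2)[of "- a + x"] by auto
    qed
    then show "\<exists>v. Ap_bounded_by M p v ((C + 1) + (C + 1)) \<and> (\<forall>x\<in>X. 1 / 2 \<le> Re (v x))"
      using Ap_bounded_by_add[OF bd Ap_bounded_by_left_translate[OF bd, of a]] by blast
  qed
  then show ?thesis by (rule that)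
qed

end

theorem corollary2:
  fixes M :: "'a::{topological_group_add,t2_space} measure"
    and p :: real
    and H :: "'a set"
    and D :: "'i set" and r :: "'i rel" and e :: "'i \<Rightarrow> 'a \<Rightarrow> complex"
  assumes "locally_compact_space (euclidean :: 'a topology)"
    and "left_haar_measure M"
    and "1 < p"
    and "add_subgroup H" and "closed H" and "H \<noteq> UNIV"
    and "bounded_approximate_identity (Ip_ideal M p H) (Ap_norm M p) D r e"
  shows "amenable M"
proof -
  interpret Lp_group M p "conjugate_exponent p"
    by unfold_locales (simp_all add: assms(1-3))
  obtain C where "bounded_locally_large C"
    using bounded_locally_large_if_approximate_identity[OF assms(4-7)] by metis
  then show ?thesis
    by (intro amenable_if_almost_invariant_densities) (metis almost_invariant_density)
qed

end
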